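(* Let $(\Phi_1,\ldots,\Phi_p,F_1,\ldots,F_q)$ be a formal non-degenerate discrete integrable system of type $(p,q)$ on $\mathbb{K}^n$ ($\mathbb{K}=\mathbb{C}$ or $\mathbb{R}$) at the common fixed point $0$. Assume that the linear part of $\Phi_i$ at the origin reads $\Phi_i^{(1)}(x_1,\ldots,x_n)=(\mu_{i1}x_1,\ldots,\mu_{in}x_n)$ for all $i=1,\ldots,p$. Suppose the family $\{\Phi_i^{(1)}\}_{i=1}^p$ is either projectively hyperbolic, or infinitesimally integrable with a weakly non-resonant family of generators. Then there is a formal diffeomorphism, tangent to the identity at $0$, which conjugates each $\Phi_i$, $i=1,\ldots,p$, to $$\hat\Phi_i=(\mu_{i1}x_1(1+\hat\varphi_{i1}),\ldots,\mu_{in}x_n(1+\hat\varphi_{in})),$$ where the $\hat\varphi_{ik}$ are formal power series such that each $\hat\varphi_{ik}$ is a common first integral of $\Phi_1^{(1)},\ldots,\Phi_p^{(1)}$ (i.e. $\hat\varphi_{ik}\circ\Phi_j^{(1)}=\hat\varphi_{ik}$ for all $j$; in particular the $\hat\Phi_i$ are in Poincaré-Dulac normal form), and such that for every $i=1,\ldots,p$ $$\prod_{k=1}^n(1+\hat\varphi_{ik})^{\gamma_k}=1\qquad\text{for all }(\gamma_1,\ldots,\gamma_n)\in\Omega,$$ where $\Omega=\{(\ell_1,\ldots,\ell_n)\in\mathbb{N}^n:\ \mu_{i1}^{\ell_1}\cdots\mu_{in}^{\ell_n}=1\ \text{for } i=1,\ldots,p\}$.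
   Context: $\mathbb{N}=\{0,1,2,\ldots\}$. All diffeomorphisms considered (germs or formal) fix $0\in\mathbb{K}^n$ and have the form $\Phi(x)=Ax+$ higher order terms, where $A$ has a logarithm (a matrix $B$ with entries in $\mathbb{K}$ with $A=e^B$, denoted $\ln A$). $\Phi^{(1)}(x)=Ax$ is the linear part. A first integral of $\Phi$ is a function (or formal power series) $F$ with $F\circ\Phi=F$; a first integral of a vector field $X$ is $F$ with $X(F)=0$. Integrable system of type $(p,q)$: $p\ge 1$, $q=n-p$; pairwise commuting diffeomorphisms $\Phi_1,\ldots,\Phi_p$ with linear parts $A_1,\ldots,A_p$, where $\Phi_1$ has $0$ as an isolated fixed point, together with common first integrals $F_1,\ldots,F_q$ of all the $\Phi_i$, such that: (i) the matrices $\ln A_1,\ldots,\ln A_p$ are linearly independent over $\mathbb{K}$ (if $\mathbb{K}=\mathbb{C}$ this is required for every possible choice of the logarithms); (ii) $F_1,\ldots,F_q$ are functionally independent almost everywhere: $dF_1\wedge\cdots\wedge dF_q\neq 0$ almost everywhere. In a formal system the $\Phi_i$ and $F_j$ are formal power series, identities are identities of formal power series (in (ii), the wedge is not identically zero), and the isolated-fixed-point requirement, meaningful only for germs, is void. Non-degenerate: for all $i$ the matrix $A_i$ is diagonalizable over $\mathbb{C}$, and there exist $q$ functionally independent homogeneous polynomials $P_1,\ldots,P_q$ such that $(\Phi_1^{(1)},\ldots,\Phi_p^{(1)},P_1,\ldots,P_q)$ is an integrable system of type $(p,q)$. Projectively hyperbolic: the $p$ real vectors $(\ln|\mu_{i1}|,\ldots,\ln|\mu_{in}|)$,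 $i=1,\ldots,p$, are $\mathbb{R}$-linearly independent. Infinitesimally integrable: there exist logarithms $\ln A_i$ of the $A_i$ such that every common first integral of $\Phi_1^{(1)},\ldots,\Phi_p^{(1)}$ is also a common first integral of the linear vector fields $X_i$ defined by $\ln A_i$; the (chosen and fixed) $X_1,\ldots,X_p$ are called infinitesimal generators ($\Phi_i^{(1)}=e^{X_i}$). Weakly non-resonant: a family of commuting linear vector fields $X_1,\ldots,X_p$ with semi-simple parts $X_i^{ss}=\sum_{m=1}^n\lambda_{im}x_m\frac{\partial}{\partial x_m}$ is weakly non-resonant if there do not exist integers $k_1,\ldots,k_n$ with $(\sum_m k_m\lambda_{1m},\ldots,\sum_m k_m\lambda_{pm})\in 2\sqrt{-1}\pi\mathbb{Z}^p\setminus\{0\}$. Poincaré-Dulac normal form: commuting diffeomorphisms $\Phi_i$ satisfying $\Phi_i\circ\Phi_j^{ss}=\Phi_j^{ss}\circ\Phi_i$ for all $i,j$, where $\Phi_j^{ss}$ is the semi-simple part of the linear part of $\Phi_j$ (here $\Phi_j^{ss}=\Phi_j^{(1)}$).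
   Formalization: For K = R the infinitesimal generators are also required to be linearly independent (automatic for K = C); otherwise Φ = (x, y + x²), F = x, ln I a rotation generator of angle 2π, generator X = 0 is a counterexample. *)

theory Defs
  imports "HOL-Analysis.Analysis" "HOL-Combinatorics.Permutations"
begin

section \<open>Formal power series in the variables indexed by a finite type\<close>

text \<open>A series is its family of coefficients; the exponent \<open>m :: nat ^ 'n\<close> stands for the
  monomial \<open>\<Prod>k. x\<^sub>k ^ (m $ k)\<close>.\<close>

typedef ('a, 'n::finite) mfps = "UNIV :: (nat ^ 'n \<Rightarrow> 'a) set"
  morphisms mfps_nth Abs_mfps
  by simp

lemma mfps_nth_Abs [simp]: "mfps_nth (Abs_mfps f) = f"
  by (simp add: Abs_mfps_inverse)

lemma mfps_eq_iff: "f = g \<longleftrightarrow> (\<forall>m. mfps_nth f m = mfps_nth g m)"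
  by (metis ext mfps_nth_inject)

lemma finite_vec_le: "finite {a :: nat ^ 'n::finite. \<forall>k. a $ k \<le> b k}"
proof -
  have "finite (Pi\<^sub>E (UNIV :: 'n set) (\<lambda>k. {..b k}))"
    by (intro finite_PiE) auto
  moreover have "vec_nth ` {a :: nat ^ 'n. \<forall>k. a $ k \<le> b k} \<subseteq> Pi\<^sub>E UNIV (\<lambda>k. {..b k})"
    by auto
  ultimately have "finite (vec_nth ` {a :: nat ^ 'n. \<forall>k. a $ k \<le> b k})"
    by (rule finite_subset[rotated])
  then show ?thesis
    by (rule finite_imageD) (auto simp: inj_on_def vec_eq_iff)
qed

lemma finite_vec_splits: "finite {(a, b). a + b = (m :: nat ^ 'n::finite)}"
proof (rule finite_subset)
  let ?S = "{a :: nat ^ 'n. \<forall>k. a $ k \<le> m $ k}"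
  show "{(a, b). a + b = m} \<subseteq> ?S \<times> ?S"
    by auto
  show "finite (?S \<times> ?S)"
    using finite_vec_le[of "vec_nth m"] by blast
qed

instantiation mfps :: (comm_ring_1, finite) comm_ring_1
begin

definition "0 = Abs_mfps (\<lambda>_. 0)"
definition "1 = Abs_mfps (\<lambda>m. if m = 0 then 1 else 0)"
definition "f + g = Abs_mfps (\<lambda>m. mfps_nth f m + mfps_nth g m)"
definition "f - g = Abs_mfps (\<lambda>m. mfps_nth f m - mfps_nth g m)"
definition "- f = Abs_mfps (\<lambda>m. - mfps_nth f m)"
definition "f * g = Abs_mfps (\<lambda>m. \<Sum>(a, b) \<in> {(a, b). a + b = m}. mfps_nth f a * mfps_nth g b)"

lemma mfps_nth_0 [simp]: "mfps_nth 0 m = 0"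
  by (simp add: zero_mfps_def)

lemma mfps_nth_1: "mfps_nth 1 m = (if m = 0 then 1 else 0)"
  by (simp add: one_mfps_def)

lemma mfps_nth_add [simp]: "mfps_nth (f + g) m = mfps_nth f m + mfps_nth g m"
  by (simp add: plus_mfps_def)

lemma mfps_nth_diff [simp]: "mfps_nth (f - g) m = mfps_nth f m - mfps_nth g m"
  by (simp add: minus_mfps_def)

lemma mfps_nth_minus [simp]: "mfps_nth (- f) m = - mfps_nth f m"
  by (simp add: uminus_mfps_def)

lemma mfps_nth_mult:
  "mfps_nth (f * g) m = (\<Sum>(a, b) \<in> {(a, b). a + b = m}. mfps_nth f a * mfps_nth g b)"
  by (simp add: times_mfps_def)

instance
proof
  fix f g h :: "('a, 'b) mfps"
  show "f + g + h = f + (g + h)" "f + g = g + f" "0 + f = f" "- f + f = 0" "f - g = f + - g"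
    by (simp_all add: mfps_eq_iff algebra_simps)
  show "(0 :: ('a, 'b) mfps) \<noteq> 1"
    by (auto simp: mfps_eq_iff mfps_nth_1)
  show "(f + g) * h = f * h + g * h"
    by (simp add: mfps_eq_iff mfps_nth_mult algebra_simps sum.distrib case_prod_unfold)
  show "f * g = g * f"
    unfolding mfps_eq_iff mfps_nth_mult
    by (auto intro!: sum.reindex_bij_witness[of _ prod.swap prod.swap] simp: algebra_simps)
  show "1 * f = f"
    unfolding mfps_eq_iff
  proof
    fix m
    have "mfps_nth (1 * f) m = (\<Sum>(a, b) \<in> {(0, m)}. mfps_nth 1 a * mfps_nth f b)"
      unfolding mfps_nth_mult
      by (rule sum.mono_neutral_right[OF finite_vec_splits]) (auto simp: mfps_nth_1 split: if_splits)
    then show "mfps_nth (1 * f) m = mfps_nth f m"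
      by (simp add: mfps_nth_1)
  qed
  show "f * g * h = f * (g * h)"
    unfolding mfps_eq_iff
  proof
    fix m
    let ?S = "\<lambda>m :: nat ^ 'b. {(a, b). a + b = m}"
    let ?t = "\<lambda>a b c. mfps_nth f a * mfps_nth g b * mfps_nth h c"
    have "mfps_nth (f * g * h) m
        = (\<Sum>u \<in> ?S m. \<Sum>v \<in> ?S (fst u). ?t (fst v) (snd v) (snd u))"
      by (simp add: mfps_nth_mult case_prod_unfold sum_distrib_right)
    also have "\<dots> = (\<Sum>(u, v) \<in> (SIGMA u : ?S m. ?S (fst u)). ?t (fst v) (snd v) (snd u))"
      by (rule sum.Sigma) (auto simp: finite_vec_splits)
    also have "\<dots> = (\<Sum>(u, v) \<in> (SIGMA u : ?S m. ?S (snd u)). ?t (fst u) (fst v) (snd v))"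
      by (rule sum.reindex_bij_witness[of _
            "\<lambda>((a, _), (b, c)). ((a + b, c), (a, b))" "\<lambda>((_, c), (a, b)). ((a, b + c), (b, c))"])
        (auto simp: add.assoc)
    also have "\<dots> = (\<Sum>u \<in> ?S m. \<Sum>v \<in> ?S (snd u). ?t (fst u) (fst v) (snd v))"
      by (rule sum.Sigma[symmetric]) (auto simp: finite_vec_splits)
    also have "\<dots> = mfps_nth (f * (g * h)) m"
      by (simp add: mfps_nth_mult case_prod_unfold sum_distrib_left mult.assoc)
    finally show "mfps_nth (f * g * h) m = mfps_nth (f * (g * h)) m" .
  qed
qed

end

definition mfps_const :: "'a::zero \<Rightarrow> ('a, 'n::finite) mfps" where
  "mfps_const c = Abs_mfps (\<lambda>m. if m = 0 then c else 0)"

definition mfps_X :: "'n \<Rightarrow> ('a::zero_neq_one, 'n::finite) mfps" where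
  "mfps_X k = Abs_mfps (\<lambda>m. if m = axis k 1 then 1 else 0)"

definition mfps_pderiv :: "'n \<Rightarrow> ('a::comm_ring_1, 'n::finite) mfps \<Rightarrow> ('a, 'n) mfps" where
  "mfps_pderiv k f = Abs_mfps (\<lambda>m. of_nat (m $ k + 1) * mfps_nth f (m + axis k 1))"

abbreviation mdegree :: "nat ^ 'n::finite \<Rightarrow> nat" where
  "mdegree m \<equiv> (\<Sum>k\<in>UNIV. m $ k)"

definition mfps_homogeneous :: "('a::zero, 'n::finite) mfps \<Rightarrow> bool" where
  "mfps_homogeneous f \<longleftrightarrow> (\<exists>d. \<forall>m. mfps_nth f m \<noteq> 0 \<longrightarrow> mdegree m = d)"

definition coeffs_in :: "'a set \<Rightarrow> ('a, 'n::finite) mfps \<Rightarrow> bool" where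
  "coeffs_in K f \<longleftrightarrow> (\<forall>m. mfps_nth f m \<in> K)"


section \<open>Formal maps\<close>

type_synonym ('a, 'n) fmap = "('a, 'n) mfps ^ 'n"

text \<open>\<open>F \<circ> \<Phi>\<close>. The truncation to \<open>mdegree l \<le> mdegree m\<close> loses nothing as long as \<open>\<Phi>\<close> has no
  constant term, which holds for every formal map considered below: then \<open>\<Phi>\<^sup>l\<close> has no terms of
  degree less than \<open>mdegree l\<close>.\<close>

definition mfps_subst :: "('a::comm_ring_1, 'n::finite) mfps \<Rightarrow> ('a, 'n) fmap \<Rightarrow> ('a, 'n) mfps" where
  "mfps_subst F \<Phi> = Abs_mfps (\<lambda>m. \<Sum>l | mdegree l \<le> mdegree m.
      mfps_nth F l * mfps_nth (\<Prod>k\<in>UNIV. (\<Phi> $ k) ^ (l $ k)) m)"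

definition fmap_comp :: "('a::comm_ring_1, 'n::finite) fmap \<Rightarrow> ('a, 'n) fmap \<Rightarrow> ('a, 'n) fmap" where
  "fmap_comp \<Phi> \<Psi> = (\<chi> k. mfps_subst (\<Phi> $ k) \<Psi>)"

definition linear_part :: "('a, 'n::finite) fmap \<Rightarrow> 'a ^ 'n ^ 'n" where
  "linear_part \<Phi> = (\<chi> k m. mfps_nth (\<Phi> $ k) (axis m 1))"

definition linear_fmap :: "'a::comm_ring_1 ^ 'n ^ 'n \<Rightarrow> ('a, 'n::finite) fmap" where
  "linear_fmap A = (\<chi> k. \<Sum>m\<in>UNIV. mfps_const (A $ k $ m) * mfps_X m)"

definition first_integral :: "('a::comm_ring_1, 'n::finite) fmap \<Rightarrow> ('a, 'n) mfps \<Rightarrow> bool" where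
  "first_integral \<Phi> F \<longleftrightarrow> mfps_subst F \<Phi> = F"

text \<open>\<open>X(F)\<close> for the linear vector field \<open>X = \<Sum>k (B x)\<^sub>k \<partial>/\<partial>x\<^sub>k\<close>, whose time-one flow is
  \<open>x \<mapsto> exp B x\<close>.\<close>

definition linear_vf_apply :: "'a::comm_ring_1 ^ 'n ^ 'n \<Rightarrow> ('a, 'n::finite) mfps \<Rightarrow> ('a, 'n) mfps" where
  "linear_vf_apply B F = (\<Sum>k\<in>UNIV. linear_fmap B $ k * mfps_pderiv k F)"

text \<open>The coefficient \<open>(dF\<^sub>0 \<and> \<dots> \<and> dF\<^bsub>q-1\<^esub>)(\<partial>\<^bsub>s 0\<^esub>, \<dots>, \<partial>\<^bsub>s (q-1)\<^esub>)\<close> of the wedge product.\<close>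

definition wedge_coeff ::
  "nat \<Rightarrow> (nat \<Rightarrow> ('a::comm_ring_1, 'n::finite) mfps) \<Rightarrow> (nat \<Rightarrow> 'n) \<Rightarrow> ('a, 'n) mfps" where
  "wedge_coeff q F s =
    (\<Sum>\<sigma> | \<sigma> permutes {..<q}. of_int (sign \<sigma>) * (\<Prod>j<q. mfps_pderiv (s (\<sigma> j)) (F j)))"

definition functionally_independent :: "nat \<Rightarrow> (nat \<Rightarrow> ('a::comm_ring_1, 'n::finite) mfps) \<Rightarrow> bool" where
  "functionally_independent q F \<longleftrightarrow> (\<exists>s. wedge_coeff q F s \<noteq> 0)"


section \<open>Matrices\<close>

definition diag_matrix :: "'a::zero ^ 'n \<Rightarrow> 'a ^ 'n ^ 'n" where
  "diag_matrix d = (\<chi> i j. if i = j then d $ i else 0)"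

definition mat_power :: "'a::semiring_1 ^ 'n ^ 'n \<Rightarrow> nat \<Rightarrow> 'a ^ 'n ^ 'n" where
  "mat_power B k = (((**) B) ^^ k) (mat 1)"

definition matrix_exp :: "complex ^ 'n ^ 'n \<Rightarrow> complex ^ 'n ^ 'n" where
  "matrix_exp B = (\<Sum>k. (1 / fact k) *\<^sub>R mat_power B k)"

definition is_matrix_log :: "complex set \<Rightarrow> complex ^ 'n ^ 'n \<Rightarrow> complex ^ 'n ^ 'n \<Rightarrow> bool" where
  "is_matrix_log K A B \<longleftrightarrow> (\<forall>r s. B $ r $ s \<in> K) \<and> matrix_exp B = A"

definition diagonalizable :: "complex ^ 'n ^ 'n \<Rightarrow> bool" where
  "diagonalizable A \<longleftrightarrow> (\<exists>(P :: complex ^ 'n ^ 'n) d. invertible P \<and> A = P ** diag_matrix d ** matrix_inv P)"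

definition is_semisimple_part :: "complex ^ 'n ^ 'n \<Rightarrow> complex ^ 'n ^ 'n \<Rightarrow> bool" where
  "is_semisimple_part S A \<longleftrightarrow> diagonalizable S \<and> (\<exists>k. mat_power (A - S) k = 0) \<and>
     S ** (A - S) = (A - S) ** S"

text \<open>Linear independence over \<open>K\<close> of the family \<open>v 0, \<dots>, v (p - 1)\<close> of vectors indexed by \<open>'b\<close>.\<close>

definition family_independent :: "'a::comm_ring_1 set \<Rightarrow> nat \<Rightarrow> (nat \<Rightarrow> 'b \<Rightarrow> 'a) \<Rightarrow> bool" where
  "family_independent K p v \<longleftrightarrow>
    (\<forall>c. (\<forall>i<p. c i \<in> K) \<longrightarrow> (\<forall>s. (\<Sum>i<p. c i * v i s) = 0) \<longrightarrow> (\<forall>i<p. c i = 0))"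

definition matrices_independent :: "complex set \<Rightarrow> nat \<Rightarrow> (nat \<Rightarrow> complex ^ 'n ^ 'n) \<Rightarrow> bool" where
  "matrices_independent K p B \<longleftrightarrow> family_independent K p (\<lambda>i (r, s). B i $ r $ s)"


section \<open>Formal discrete integrable systems\<close>

text \<open>The base field is represented by the set \<open>K\<close> of its elements, \<open>UNIV\<close> or \<open>\<real>\<close>, inside the
  complex numbers; real power series and real matrices are complex ones with entries in \<open>\<real>\<close>.
  Families are indexed by \<open>i < p\<close> and \<open>j < q\<close>, the coordinates by the type \<open>'n\<close>.\<close>

definition formal_diffeo :: "complex set \<Rightarrow> (complex, 'n::finite) fmap \<Rightarrow> bool" where
  "formal_diffeo K \<Phi> \<longleftrightarrow> (\<forall>k. coeffs_in K (\<Phi> $ k) \<and> mfps_nth (\<Phi> $ k) 0 = 0) \<and>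
     (\<exists>B. is_matrix_log K (linear_part \<Phi>) B)"

text \<open>Over \<open>\<real>\<close>, \<open>ln A\<^sub>i\<close> stands for some choice of real logarithms.\<close>

definition logs_independent :: "complex set \<Rightarrow> nat \<Rightarrow> (nat \<Rightarrow> complex ^ 'n ^ 'n) \<Rightarrow> bool" where
  "logs_independent K p A \<longleftrightarrow>
    (if K = UNIV
     then \<forall>B. (\<forall>i<p. is_matrix_log K (A i) (B i)) \<longrightarrow> matrices_independent K p B
     else \<exists>B. (\<forall>i<p. is_matrix_log K (A i) (B i)) \<and> matrices_independent K p B)"

definition integrable_system ::
  "complex set \<Rightarrow> nat \<Rightarrow> nat \<Rightarrow> (nat \<Rightarrow> (complex, 'n::finite) fmap) \<Rightarrow>
    (nat \<Rightarrow> (complex, 'n) mfps) \<Rightarrow> bool" where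
  "integrable_system K p q \<Phi> F \<longleftrightarrow>
     p \<ge> 1 \<and> p + q = CARD('n) \<and>
     (\<forall>i<p. formal_diffeo K (\<Phi> i)) \<and>
     (\<forall>i<p. \<forall>j<p. fmap_comp (\<Phi> i) (\<Phi> j) = fmap_comp (\<Phi> j) (\<Phi> i)) \<and>
     (\<forall>j<q. coeffs_in K (F j) \<and> (\<forall>i<p. first_integral (\<Phi> i) (F j))) \<and>
     logs_independent K p (\<lambda>i. linear_part (\<Phi> i)) \<and>
     functionally_independent q F"

definition nondegenerate ::
  "complex set \<Rightarrow> nat \<Rightarrow> nat \<Rightarrow> (nat \<Rightarrow> (complex, 'n::finite) fmap) \<Rightarrow> bool" where
  "nondegenerate K p q \<Phi> \<longleftrightarrow>
     (\<forall>i<p. diagonalizable (linear_part (\<Phi> i))) \<and>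
     (\<exists>P. (\<forall>j<q. mfps_homogeneous (P j)) \<and>
        integrable_system K p q (\<lambda>i. linear_fmap (linear_part (\<Phi> i))) P)"

definition projectively_hyperbolic :: "nat \<Rightarrow> (nat \<Rightarrow> complex ^ 'n) \<Rightarrow> bool" where
  "projectively_hyperbolic p \<mu> \<longleftrightarrow>
     family_independent (UNIV :: real set) p (\<lambda>i k. ln (cmod (\<mu> i $ k)))"

text \<open>The family \<open>X\<close> of generators is \<open>(ln A\<^sub>i)\<^sub>i\<close> for a choice of logarithms that is independent as
  required of an integrable system; for \<open>K = UNIV\<close> every choice is, so the second conjunct only
  matters for \<open>K = \<real>\<close>.\<close>

definition infinitesimal_generators ::
  "complex set \<Rightarrow> nat \<Rightarrow> (nat \<Rightarrow> complex ^ 'n ^ 'n) \<Rightarrow> (nat \<Rightarrow> complex ^ 'n::finite ^ 'n) \<Rightarrow> bool" where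
  "infinitesimal_generators K p A X \<longleftrightarrow>
     (\<forall>i<p. is_matrix_log K (A i) (X i)) \<and> matrices_independent K p X \<and>
     (\<forall>F. coeffs_in K F \<and> (\<forall>i<p. first_integral (linear_fmap (A i)) F) \<longrightarrow>
          (\<forall>i<p. linear_vf_apply (X i) F = 0))"

text \<open>The semi-simple parts are simultaneously diagonal in some complex linear coordinates, given by
  \<open>P\<close>; the diagonal entries \<open>lam i $ m\<close> are determined up to a common permutation of the coordinates,
  which does not affect the condition.\<close>

definition weakly_nonresonant :: "nat \<Rightarrow> (nat \<Rightarrow> complex ^ 'n::finite ^ 'n) \<Rightarrow> bool" where
  "weakly_nonresonant p X \<longleftrightarrow>
     (\<forall>i<p. \<forall>j<p. X i ** X j = X j ** X i) \<and>
     (\<exists>P lam. invertible P \<and>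
        (\<forall>i<p. is_semisimple_part (P ** diag_matrix (lam i) ** matrix_inv P) (X i)) \<and>
        \<not> (\<exists>k :: int ^ 'n.
             (\<forall>i<p. \<exists>z :: int. (\<Sum>m\<in>UNIV. of_int (k $ m) * lam i $ m) = 2 * \<i> * of_real pi * of_int z) \<and>
             (\<exists>i<p. (\<Sum>m\<in>UNIV. of_int (k $ m) * lam i $ m) \<noteq> 0)))"

definition poincare_dulac_nf :: "nat \<Rightarrow> (nat \<Rightarrow> (complex, 'n::finite) fmap) \<Rightarrow> bool" where
  "poincare_dulac_nf p \<Phi> \<longleftrightarrow>
     (\<forall>i<p. \<forall>j<p. fmap_comp (\<Phi> i) (\<Phi> j) = fmap_comp (\<Phi> j) (\<Phi> i)) \<and>
     (\<exists>S. \<forall>j<p. is_semisimple_part (S j) (linear_part (\<Phi> j)) \<and>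
        (\<forall>i<p. fmap_comp (\<Phi> i) (linear_fmap (S j)) = fmap_comp (linear_fmap (S j)) (\<Phi> i)))"

definition resonant_exponents :: "nat \<Rightarrow> (nat \<Rightarrow> complex ^ 'n) \<Rightarrow> (nat ^ 'n::finite) set" where
  "resonant_exponents p \<mu> = {l. \<forall>i<p. (\<Prod>k\<in>UNIV. (\<mu> i $ k) ^ (l $ k)) = 1}"

text \<open>The map \<open>x \<mapsto> (\<mu>\<^sub>k x\<^sub>k (1 + \<phi>\<^sub>k))\<^sub>k\<close>.\<close>

definition scaled_fmap :: "'a::comm_ring_1 ^ 'n \<Rightarrow> ('a, 'n::finite) mfps ^ 'n \<Rightarrow> ('a, 'n) fmap" where
  "scaled_fmap \<mu> \<phi> = (\<chi> k. mfps_const (\<mu> $ k) * mfps_X k * (1 + \<phi> $ k))"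

end

theory Submission
  imports Defs "HOL-Computational_Algebra.Polynomial"
begin

text \<open>
  The operators \<open>f \<mapsto> f \<circ> \<Phi>\<^sub>i\<close> commute and are triangular for the degree filtration. Their joint
  generalized eigenspaces are multiplicative, so taking coordinates \<open>\<Psi>\<^sub>k = x\<^sub>k + \<dots>\<close> in the eigenspace
  of \<open>(\<mu>\<^bsub>ik\<^esub>)\<^sub>i\<close> normalizes all \<open>\<Phi>\<^sub>i\<close> simultaneously: in these coordinates only resonant monomials
  survive, both in the maps and in the first integrals \<open>F\<^sub>j\<close>.

  Either hypothesis provides \<open>p\<close> linearly independent vectors \<open>w\<^sub>i\<close>, namely
  \<open>(ln \<bar>\<mu>\<^bsub>ik\<^esub>\<bar>)\<^sub>k\<close> or the eigenvalues of the generators, that are orthogonal to all resonances.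
  Let \<open>G\<close> be a normalized map divided by its linear part. Its logarithm is a vector field
  \<open>\<Sum>k Y\<^sub>k \<partial>\<^sub>k\<close> annihilating the \<open>F\<^sub>j\<close>. Since the \<open>F\<^sub>j\<close> involve only exponents from the
  \<open>q\<close>-dimensional space orthogonal to the \<open>w\<^sub>i\<close> and are \<open>q\<close> independent functions, the field satisfies
  \<open>\<Sum>k r\<^sub>k Y\<^sub>k / x\<^sub>k = 0\<close> for all \<open>r\<close> in that space. For \<open>r = m - e\<^sub>k\<close>, where \<open>x\<^sup>m\<close> is
  a resonant monomial without \<open>x\<^sub>k\<close> in the \<open>k\<close>-th component, this says \<open>x\<^sub>k\<close> divides \<open>Y\<^sub>k\<close> and hence
  \<open>G\<^sub>k\<close>; for \<open>r = \<gamma> \<in> \<Omega>\<close> it says that \<open>x\<^sup>\<gamma>\<close> is invariant under \<open>G\<close>.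
\<close>

section \<open>The order filtration and substitution\<close>

text \<open>The obstacle is that a Poincare-Dulac normal form may contain, in its
  \<open>k\<close>-th component, a resonant monomial \<open>x^m\<close> with \<open>m_k = 0\<close>;
  only the first integrals exclude it. Their invariance \<open>F \<circ> G = F\<close> is nonlinear
  in \<open>G\<close>. The logarithm turns it into linear equations for a vector field, open to
  linear algebra over the fraction field.

  The exponent \<open>r = m - e_k\<close> is orthogonal to the weights because \<open>x^m\<close>
  and \<open>x_k\<close> have the same multiplier under every linear part. Since
  \<open>r_k = -1\<close>, the relation for \<open>r\<close> expresses \<open>Y_k / x_k\<close>
  through the other quotients, none of which can have a pole along \<open>x_k = 0\<close>. From
  \<open>Y_k\<close> the conclusion passes to \<open>G_k\<close> at a counterexample of least
  degree, where the coefficients of both agree.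

  The coordinate change \<Psi> is never inverted. Composition with \<Psi> is injective on series and
  onto those with coefficients in \<open>K\<close>, and this replaces the inverse map. Membership of
  the coefficients in \<open>K\<close> is carried along so that real data give a real normal
  form.\<close>

lemma mdegree_add: "mdegree (a + b) = mdegree a + mdegree b"
  by (simp add: sum.distrib)

lemma sum_vec_add [simp]: "(\<Sum>k\<in>UNIV. (a :: nat ^ 'n::finite) $ k + b $ k) = mdegree a + mdegree b"
  by (simp add: sum.distrib)

lemma mdegree_axis [simp]: "mdegree (axis k c :: nat ^ 'n::finite) = c"
  by (simp add: axis_def)

lemma mdegree_zero_iff: "mdegree (m :: nat ^ 'n::finite) = 0 \<longleftrightarrow> m = 0"
  by (auto simp: vec_eq_iff)

lemma mdegree_1: "mdegree (m :: nat ^ 'n::finite) = 1 \<longleftrightarrow> (\<exists>k. m = axis k 1)"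
proof
  assume "mdegree m = 1"
  then obtain k where "m $ k = 1" "\<And>j. j \<noteq> k \<Longrightarrow> m $ j = 0"
    by (subst (asm) sum_eq_1_iff) auto
  then have "m = axis k 1"
    by (auto simp: vec_eq_iff axis_def)
  then show "\<exists>k. m = axis k 1" ..
qed (auto simp: axis_def)

lemma finite_mdegree_le [simp]: "finite {l :: nat ^ 'n::finite. mdegree l \<le> N}"
proof (rule finite_subset)
  show "{l :: nat ^ 'n. mdegree l \<le> N} \<subseteq> {a. \<forall>k. a $ k \<le> N}"
  proof safe
    fix x :: "nat ^ 'n" and k assume "mdegree x \<le> N"
    moreover have "x $ k \<le> mdegree x" by (rule member_le_sum) auto
    ultimately show "x $ k \<le> N" by simp
  qed
qed (rule finite_vec_le)

definition order_ge :: "nat \<Rightarrow> ('a::comm_ring_1, 'n::finite) mfps \<Rightarrow> bool" where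
  "order_ge N f \<longleftrightarrow> (\<forall>m. mdegree m < N \<longrightarrow> mfps_nth f m = 0)"

lemma order_geD: "order_ge N f \<Longrightarrow> mdegree m < N \<Longrightarrow> mfps_nth f m = 0"
  by (simp add: order_ge_def)

lemma order_ge_0 [simp]: "order_ge 0 f" by (simp add: order_ge_def)
lemma order_ge_zero [simp]: "order_ge N 0" by (simp add: order_ge_def)
lemma order_ge_add: "order_ge N f \<Longrightarrow> order_ge N g \<Longrightarrow> order_ge N (f + g)" by (simp add: order_ge_def)
lemma order_ge_diff: "order_ge N f \<Longrightarrow> order_ge N g \<Longrightarrow> order_ge N (f - g)" by (simp add: order_ge_def)
lemma order_ge_mono: "order_ge N f \<Longrightarrow> M \<le> N \<Longrightarrow> order_ge M f" by (auto simp: order_ge_def)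
lemma order_ge_sum: "(\<And>x. x \<in> S \<Longrightarrow> order_ge N (f x)) \<Longrightarrow> order_ge N (sum f S)"
  by (induction S rule: infinite_finite_induct) (auto intro: order_ge_add)

lemma order_ge_mult:
  assumes "order_ge N f" "order_ge M g"
  shows "order_ge (N + M) (f * g)"
  unfolding order_ge_def mfps_nth_mult
proof (intro allI impI sum.neutral ballI)
  fix m :: "nat ^ 'b" and x assume m: "mdegree m < N + M" and x: "x \<in> {(a, b). a + b = m}"
  obtain a b where ab: "x = (a, b)" by (cases x)
  with x have "mdegree a + mdegree b = mdegree m" by auto
  with m have "mdegree a < N \<or> mdegree b < M" by linarith
  with assms show "(case x of (a, b) \<Rightarrow> mfps_nth f a * mfps_nth g b) = 0"
    by (auto simp: ab order_ge_def)
qed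

lemma order_ge_mult_left: "order_ge N g \<Longrightarrow> order_ge N (f * g)"
  using order_ge_mult[of 0 f N g] by simp

lemma order_ge_mult_right: "order_ge N f \<Longrightarrow> order_ge N (f * g)"
  using order_ge_mult[of N f 0 g] by simp

lemma order_ge_1: "order_ge 1 f \<longleftrightarrow> mfps_nth f 0 = 0"
proof -
  have "mdegree m < 1 \<longleftrightarrow> m = 0" for m :: "nat ^ 'b"
    using mdegree_zero_iff[of m] by linarith
  then show ?thesis
    by (simp only: order_ge_def) auto
qed

lemma order_ge_power: "order_ge N f \<Longrightarrow> order_ge (N * k) (f ^ k)"
  by (induction k) (use order_ge_mult in \<open>auto simp: add.commute\<close>)

lemma order_ge_prod:
  "(\<And>x. x \<in> S \<Longrightarrow> order_ge (d x) (f x)) \<Longrightarrow> order_ge (sum d S) (prod f S)"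
  by (induction S rule: infinite_finite_induct) (auto intro: order_ge_mult)

lemma order_ge_eq_0: "(\<And>N. order_ge N f) \<Longrightarrow> f = 0"
  by (auto simp: mfps_eq_iff order_ge_def)

lemma mfps_nth_const: "mfps_nth (mfps_const c) m = (if m = 0 then c else 0)"
  by (simp add: mfps_const_def)

lemma mfps_nth_const_mult [simp]:
  fixes f :: "('a::comm_ring_1, 'n::finite) mfps"
  shows "mfps_nth (mfps_const c * f) m = c * mfps_nth f m"
proof -
  have "mfps_nth (mfps_const c * f) m = (\<Sum>(a, b) \<in> {(0, m)}. mfps_nth (mfps_const c :: ('a, 'n) mfps) a * mfps_nth f b)"
    unfolding mfps_nth_mult
    by (rule sum.mono_neutral_right[OF finite_vec_splits]) (auto simp: mfps_nth_const split: if_splits)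
  then show ?thesis by (simp add: mfps_nth_const)
qed

lemma mfps_const_0 [simp]: "mfps_const 0 = 0" by (simp add: mfps_eq_iff mfps_nth_const)
lemma mfps_const_1 [simp]: "mfps_const 1 = 1" by (simp add: mfps_eq_iff mfps_nth_const mfps_nth_1)
lemma mfps_const_mult: "mfps_const (c * d) = mfps_const c * mfps_const (d :: 'a::comm_ring_1)"
  by (simp add: mfps_eq_iff mfps_nth_const)
lemma mfps_const_add: "mfps_const (c + d) = mfps_const c + mfps_const (d :: 'a::comm_ring_1)"
  by (simp add: mfps_eq_iff mfps_nth_const)
lemma mfps_const_minus: "mfps_const (- c) = - mfps_const (c :: 'a::comm_ring_1)"
  by (simp add: mfps_eq_iff mfps_nth_const)
lemma mfps_const_power: "mfps_const (c ^ k) = mfps_const (c :: 'a::comm_ring_1) ^ k"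
  by (induction k) (simp_all add: mfps_const_mult)
lemma mfps_const_prod: "mfps_const (prod c S) = (\<Prod>x\<in>S. mfps_const (c x :: 'a::comm_ring_1))"
  by (induction S rule: infinite_finite_induct) (simp_all add: mfps_const_mult)
lemma mfps_const_of_nat: "mfps_const (of_nat c :: 'a::comm_ring_1) = of_nat c"
  by (induction c) (simp_all add: mfps_const_add)

lemma mfps_nth_sum: "mfps_nth (sum f S) m = (\<Sum>x\<in>S. mfps_nth (f x) m)"
  by (induction S rule: infinite_finite_induct) simp_all


lemma order_ge_const_mult: "order_ge N f \<Longrightarrow> order_ge N (mfps_const c * f)"
  by (simp add: order_ge_def)

lemma mfps_nth_X: "mfps_nth (mfps_X k) m = (if m = axis k 1 then 1 else 0)"
  by (simp add: mfps_X_def)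

section \<open>Powers of a map, and composition as a ring homomorphism\<close>

definition mpow :: "('a::comm_ring_1, 'n::finite) fmap \<Rightarrow> nat ^ 'n \<Rightarrow> ('a, 'n) mfps" where
  "mpow \<Phi> l = (\<Prod>k\<in>UNIV. (\<Phi> $ k) ^ (l $ k))"

lemma mpow_0 [simp]: "mpow \<Phi> 0 = 1" by (simp add: mpow_def)
lemma mpow_add: "mpow \<Phi> (a + b) = mpow \<Phi> a * mpow \<Phi> b"
  by (simp add: mpow_def power_add prod.distrib)
lemma mpow_axis: "mpow \<Phi> (axis k 1) = \<Phi> $ k"
proof -
  have "mpow \<Phi> (axis k 1) = (\<Prod>j\<in>UNIV. if j = k then \<Phi> $ j else 1)"
    unfolding mpow_def by (intro prod.cong) (auto simp: axis_def)
  then show ?thesis by simp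
qed

lemma mpow_axis_Suc_0 [simp]: "mpow \<Phi> (axis k (Suc 0)) = \<Phi> $ k"
  using mpow_axis by simp

abbreviation no_const :: "('a::comm_ring_1, 'n::finite) fmap \<Rightarrow> bool" where
  "no_const \<Phi> \<equiv> \<forall>k. mfps_nth (\<Phi> $ k) 0 = 0"

lemma order_ge_mpow: "no_const \<Phi> \<Longrightarrow> order_ge (mdegree l) (mpow \<Phi> l)"
  unfolding mpow_def using order_ge_power[of 1]
  by (intro order_ge_prod) (force simp flip: order_ge_1)

lemma mfps_nth_subst: "mfps_nth (mfps_subst F \<Phi>) m =
    (\<Sum>l | mdegree l \<le> mdegree m. mfps_nth F l * mfps_nth (mpow \<Phi> l) m)"
  by (simp add: mfps_subst_def mpow_def)

text \<open>Any bound \<open>N\<close> above the degree may serve as truncation, so coefficients of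
  different degrees can be computed over one common index set.\<close>

lemma mfps_nth_subst':
  assumes "no_const \<Phi>" "mdegree m \<le> N"
  shows "mfps_nth (mfps_subst F \<Phi>) m =
    (\<Sum>l | mdegree l \<le> N. mfps_nth F l * mfps_nth (mpow \<Phi> l) m)"
  unfolding mfps_nth_subst
  by (rule sum.mono_neutral_left)
     (use assms order_geD[OF order_ge_mpow[OF assms(1)], of m] in auto)

lemma subst_add: "mfps_subst (f + g) \<Phi> = mfps_subst f \<Phi> + mfps_subst g \<Phi>"
  by (simp add: mfps_eq_iff mfps_nth_subst algebra_simps sum.distrib)
lemma subst_diff: "mfps_subst (f - g) \<Phi> = mfps_subst f \<Phi> - mfps_subst g \<Phi>"
  by (simp add: mfps_eq_iff mfps_nth_subst algebra_simps sum_subtractf)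
lemma subst_0 [simp]: "mfps_subst 0 \<Phi> = 0"
  by (simp add: mfps_eq_iff mfps_nth_subst)
lemma subst_const_mult: "mfps_subst (mfps_const c * f) \<Phi> = mfps_const c * mfps_subst f \<Phi>"
  by (simp add: mfps_eq_iff mfps_nth_subst mult.assoc sum_distrib_left)
lemma subst_1 [simp]: "mfps_subst 1 \<Phi> = 1"
proof -
  have "(\<Sum>l | mdegree l \<le> mdegree m. mfps_nth 1 l * mfps_nth (mpow \<Phi> l) m) =
      (\<Sum>l\<in>{0}. mfps_nth 1 l * mfps_nth (mpow \<Phi> l) m)" for m
    by (rule sum.mono_neutral_right) (auto simp: mfps_nth_1)
  then show ?thesis
    by (simp add: mfps_eq_iff mfps_nth_subst mfps_nth_1)
qed
lemma subst_const [simp]: "mfps_subst (mfps_const c) \<Phi> = mfps_const c"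
  using subst_const_mult[of c 1 \<Phi>] by simp
lemma subst_sum: "mfps_subst (sum f S) \<Phi> = (\<Sum>x\<in>S. mfps_subst (f x) \<Phi>)"
  by (induction S rule: infinite_finite_induct) (simp_all add: subst_add)

lemma subst_X [simp]:
  assumes "no_const \<Phi>" shows "mfps_subst (mfps_X k) \<Phi> = \<Phi> $ k"
proof -
  have "mfps_nth (mfps_subst (mfps_X k) \<Phi>) m = mfps_nth (\<Phi> $ k) m" for m
  proof -
    have "mfps_nth (mfps_subst (mfps_X k) \<Phi>) m =
      (\<Sum>l | mdegree l \<le> mdegree m + 1. mfps_nth (mfps_X k) l * mfps_nth (mpow \<Phi> l) m)"
      by (rule mfps_nth_subst'[OF assms]) simp
    also have "\<dots> = (\<Sum>l\<in>{axis k 1}. mfps_nth (mfps_X k) l * mfps_nth (mpow \<Phi> l) m)"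
    proof (rule sum.mono_neutral_right[OF finite_mdegree_le])
      show "{axis k 1} \<subseteq> {l. mdegree l \<le> mdegree m + 1}"
        by (simp only: singleton_insert_inj_eq' insert_subset mem_Collect_eq mdegree_axis) auto
    qed (auto simp: mfps_nth_X)
    finally show ?thesis by (simp add: mfps_nth_X)
  qed
  then show ?thesis by (simp add: mfps_eq_iff)
qed

lemma subst_mult:
  fixes f g :: "('a::comm_ring_1, 'b::finite) mfps"
  assumes "no_const \<Phi>"
  shows "mfps_subst (f * g) \<Phi> = mfps_subst f \<Phi> * mfps_subst g \<Phi>"
  unfolding mfps_eq_iff
proof
  fix m :: "nat ^ 'b"
  let ?N = "mdegree m"
  let ?D = "{l. mdegree l \<le> ?N}"
  let ?t = "\<lambda>a b. mfps_nth f a * mfps_nth g b * mfps_nth (mpow \<Phi> (a + b)) m"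
  have "mfps_nth (mfps_subst (f * g) \<Phi>) m =
      (\<Sum>l\<in>?D. \<Sum>u\<in>{(a, b). a + b = l}. ?t (fst u) (snd u))"
    unfolding mfps_nth_subst mfps_nth_mult sum_distrib_right
    by (intro sum.cong refl) (auto simp: case_prod_unfold)
  also have "\<dots> = (\<Sum>(l, u)\<in>(SIGMA l:?D. {(a, b). a + b = l}). ?t (fst u) (snd u))"
    by (rule sum.Sigma) (auto simp: finite_vec_splits)
  also have "\<dots> = (\<Sum>u\<in>{(a, b). mdegree (a + b) \<le> ?N}. ?t (fst u) (snd u))"
    by (rule sum.reindex_bij_witness[of _ "\<lambda>(a, b). (a + b, (a, b))" snd]) auto
  \<comment> \<open>Pairs of total degree above \<open>?N\<close> contribute nothing, as
    \<open>mpow \<Phi> (a + b)\<close> starts in degree \<open>mdegree (a + b)\<close>. The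
    triangular range may therefore be completed to a product.\<close>
  also have "\<dots> = (\<Sum>u\<in>?D \<times> ?D. ?t (fst u) (snd u))"
  proof (rule sum.mono_neutral_left)
    show "\<forall>u\<in>?D \<times> ?D - {(a, b). mdegree (a + b) \<le> ?N}. ?t (fst u) (snd u) = 0"
    proof (intro ballI)
      fix u :: "(nat ^ 'b) \<times> (nat ^ 'b)" assume "u \<in> ?D \<times> ?D - {(a, b). mdegree (a + b) \<le> ?N}"
      then have "mdegree m < mdegree (fst u + snd u)"
        by (auto simp: not_le)
      then show "?t (fst u) (snd u) = 0"
        by (simp only: order_geD[OF order_ge_mpow[OF assms]] mult_zero_right)
    qed
  qed auto
  also have "\<dots> = (\<Sum>a\<in>?D. \<Sum>b\<in>?D. ?t a b)"
    by (subst sum.cartesian_product) (simp add: case_prod_unfold)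
  also have "\<dots> = (\<Sum>a\<in>?D. \<Sum>b\<in>?D. \<Sum>(u, v)\<in>{(u, v). u + v = m}.
      (mfps_nth f a * mfps_nth (mpow \<Phi> a) u) * (mfps_nth g b * mfps_nth (mpow \<Phi> b) v))"
    unfolding mpow_add mfps_nth_mult sum_distrib_left
    by (intro sum.cong refl) (auto simp: ac_simps)
  also have "\<dots> = (\<Sum>(u, v)\<in>{(u, v). u + v = m}. \<Sum>a\<in>?D. \<Sum>b\<in>?D.
      (mfps_nth f a * mfps_nth (mpow \<Phi> a) u) * (mfps_nth g b * mfps_nth (mpow \<Phi> b) v))"
    unfolding case_prod_unfold
    by (subst sum.swap[of _ "{p. fst p + snd p = m}"], subst sum.swap[of _ "{p. fst p + snd p = m}"]) simp
  also have "\<dots> = (\<Sum>(u, v)\<in>{(u, v). u + v = m}.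
      mfps_nth (mfps_subst f \<Phi>) u * mfps_nth (mfps_subst g \<Phi>) v)"
  proof (intro sum.cong refl)
    fix x assume "x \<in> {(u, v). u + v = m}"
    then obtain u v where x: "x = (u, v)" "u + v = m" by auto
    then have *: "mdegree u \<le> ?N" "mdegree v \<le> ?N" by auto
    show "(case x of (u, v) \<Rightarrow> \<Sum>a\<in>?D. \<Sum>b\<in>?D.
        (mfps_nth f a * mfps_nth (mpow \<Phi> a) u) * (mfps_nth g b * mfps_nth (mpow \<Phi> b) v)) =
      (case x of (u, v) \<Rightarrow> mfps_nth (mfps_subst f \<Phi>) u * mfps_nth (mfps_subst g \<Phi>) v)"
      unfolding x by (simp add: mfps_nth_subst'[OF assms *(1)] mfps_nth_subst'[OF assms *(2)] sum_product)
  qed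
  finally show "mfps_nth (mfps_subst (f * g) \<Phi>) m = mfps_nth (mfps_subst f \<Phi> * mfps_subst g \<Phi>) m"
    by (simp add: mfps_nth_mult)
qed

lemma subst_power: "no_const \<Phi> \<Longrightarrow> mfps_subst (f ^ k) \<Phi> = mfps_subst f \<Phi> ^ k"
  by (induction k) (simp_all add: subst_mult)

lemma subst_prod: "no_const \<Phi> \<Longrightarrow> mfps_subst (prod f S) \<Phi> = (\<Prod>x\<in>S. mfps_subst (f x) \<Phi>)"
  by (induction S rule: infinite_finite_induct) (simp_all add: subst_mult)

lemma order_ge_subst: "no_const \<Phi> \<Longrightarrow> order_ge N f \<Longrightarrow> order_ge N (mfps_subst f \<Phi>)"
  unfolding order_ge_def mfps_nth_subst by (auto intro!: sum.neutral)

definition mX :: "('a::comm_ring_1, 'n::finite) fmap" where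
  "mX = (\<chi> k. mfps_X k)"

lemma mX_nth [simp]: "mX $ k = mfps_X k" by (simp add: mX_def)

lemma no_const_mX [simp]: "no_const mX"
  by (auto simp: mfps_nth_X axis_def vec_eq_iff)

lemma mfps_nth_X_mult_add:
  "mfps_nth (mfps_X k * f) (m + axis k 1) = (mfps_nth f m :: 'a::comm_ring_1)"
proof -
  have "mfps_nth (mfps_X k * f) (m + axis k 1) =
     (\<Sum>(a, b) \<in> {(axis k 1, m)}. mfps_nth (mfps_X k) a * mfps_nth f b)"
    unfolding mfps_nth_mult
    by (rule sum.mono_neutral_right[OF finite_vec_splits])
       (auto simp: mfps_nth_X add.commute split: if_splits)
  then show ?thesis by (simp add: mfps_nth_X)
qed

lemmas mfps_nth_X_mult_add_Suc_0 [simp] = mfps_nth_X_mult_add[unfolded One_nat_def]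

lemma mfps_nth_X_mult_eq_0:
  fixes f :: "('a::comm_ring_1, 'n::finite) mfps"
  assumes "m $ k = 0"
  shows "mfps_nth (mfps_X k * f) m = 0"
  unfolding mfps_nth_mult using assms by (intro sum.neutral) (auto simp: mfps_nth_X axis_def)

lemma vec_minus_axis:
  fixes m :: "nat ^ 'n::finite"
  assumes "m $ k \<noteq> 0" shows "m - axis k 1 + axis k 1 = m"
  using assms by (auto simp: vec_eq_iff axis_def)

lemma mfps_X_mult_cancel:
  assumes "mfps_X k * f = mfps_X k * (g :: ('a::comm_ring_1, 'n::finite) mfps)" shows "f = g"
  unfolding mfps_eq_iff by (metis assms mfps_nth_X_mult_add)

lemma mfps_X_dvd:
  fixes f :: "('a::comm_ring_1, 'n::finite) mfps"
  assumes "\<And>m. m $ k = 0 \<Longrightarrow> mfps_nth f m = 0"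
  shows "f = mfps_X k * Abs_mfps (\<lambda>m. mfps_nth f (m + axis k 1))"
  unfolding mfps_eq_iff
proof
  fix m :: "nat ^ 'n"
  show "mfps_nth f m = mfps_nth (mfps_X k * Abs_mfps (\<lambda>m. mfps_nth f (m + axis k 1))) m"
  proof (cases "m $ k = 0")
    case False
    show ?thesis
      using mfps_nth_X_mult_add[of k "Abs_mfps (\<lambda>m. mfps_nth f (m + axis k 1))" "m - axis k 1"]
      by (simp only: mfps_nth_Abs vec_minus_axis[OF False])
  qed (simp add: assms mfps_nth_X_mult_eq_0)
qed

lemma mdegree_induct [case_names zero axis]:
  fixes l :: "nat ^ 'n::finite"
  assumes "P 0" "\<And>l k. P l \<Longrightarrow> P (l + axis k 1)"
  shows "P l"
proof (induction "mdegree l" arbitrary: l)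
  case 0
  then show ?case using assms(1) mdegree_zero_iff by metis
next
  case (Suc d)
  then have "l \<noteq> 0" by auto
  then obtain k where k: "l $ k \<noteq> 0" by (auto simp: vec_eq_iff)
  note eq = vec_minus_axis[OF k]
  have "mdegree l = mdegree (l - axis k 1) + mdegree (axis k 1 :: nat ^ 'n)"
    by (subst mdegree_add[symmetric]) (simp only: eq)
  with Suc(2) have "d = mdegree (l - axis k 1)" unfolding mdegree_axis by linarith
  from assms(2)[OF Suc(1)[OF this], of k] show ?case by (simp only: eq)
qed

lemma mfps_nth_mpow_mX: "mfps_nth (mpow mX l) m = (if m = l then 1 else 0)"
proof (induction l arbitrary: m rule: mdegree_induct)
  case (axis l k)
  show ?case
  proof (cases "m $ k = 0")
    case True
    then have "m \<noteq> l + axis k 1" by (auto simp: axis_def)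
    with True show ?thesis
      by (simp add: mpow_add mpow_axis mult.commute[of _ "mfps_X k"] mfps_nth_X_mult_eq_0)
  next
    case False
    have "mfps_nth (mpow mX (l + axis k 1)) (m - axis k 1 + axis k 1)
        = (if m - axis k 1 = l then 1 else 0 :: 'a)"
      by (simp add: mpow_add mpow_axis mult.commute[of _ "mfps_X k"] axis)
    moreover have "m - axis k 1 = l \<longleftrightarrow> m = l + axis k 1"
      using vec_minus_axis[OF False] add_right_cancel[of "m - axis k 1" "axis k 1" l] by argo
    ultimately show ?thesis
      unfolding vec_minus_axis[OF False] by (simp only:)
  qed
qed (auto simp: mfps_nth_1)

lemma subst_mX [simp]: "mfps_subst f mX = f"
proof -
  have "(\<Sum>l | mdegree l \<le> mdegree m. mfps_nth f l * mfps_nth (mpow mX l) m) =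
     (\<Sum>l\<in>{m}. mfps_nth f l * mfps_nth (mpow mX l) m)" for m
    by (rule sum.mono_neutral_right) (auto simp: mfps_nth_mpow_mX)
  then show ?thesis by (simp add: mfps_eq_iff mfps_nth_subst mfps_nth_mpow_mX)
qed

lemma mfps_truncate:
  "order_ge (Suc N) (f - (\<Sum>l | mdegree l \<le> N. mfps_const (mfps_nth f l) * mpow mX l))"
  unfolding order_ge_def
proof (intro allI impI)
  fix m :: "nat ^ 'b" assume m: "mdegree m < Suc N"
  have "(\<Sum>l | mdegree l \<le> N. mfps_nth f l * mfps_nth (mpow mX l) m) =
     (\<Sum>l\<in>{m}. mfps_nth f l * mfps_nth (mpow mX l) m)"
    by (rule sum.mono_neutral_right) (use m in \<open>auto simp: mfps_nth_mpow_mX\<close>)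
  then show "mfps_nth (f - (\<Sum>l | mdegree l \<le> N. mfps_const (mfps_nth f l) * mpow mX l)) m = 0"
    by (simp add: mfps_nth_sum mfps_nth_mpow_mX)
qed

text \<open>Polynomials are dense for the degree filtration, so an additive operator that loses at
  most one degree is determined by its values on monomials. The tolerated loss of one degree admits
  derivations.\<close>

lemma continuous_additive_eq_0:
  fixes T :: "('a::comm_ring_1, 'n::finite) mfps \<Rightarrow> ('a, 'n) mfps"
  assumes add: "\<And>f g. T (f + g) = T f + T g"
    and cont: "\<And>N f. order_ge (Suc N) f \<Longrightarrow> order_ge N (T f)"
    and zero: "\<And>c l. T (mfps_const c * mpow mX l) = 0"
  shows "T f = 0"
proof (rule order_ge_eq_0)
  fix N
  have T0: "T 0 = 0" using add[of 0 0] by simp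
  have "T (sum g S) = (\<Sum>x\<in>S. T (g x))" for S :: "(nat ^ 'n) set" and g
    by (induction S rule: infinite_finite_induct) (simp_all add: add T0)
  then have "T (\<Sum>l | mdegree l \<le> N. mfps_const (mfps_nth f l) * mpow mX l) = 0"
    by (simp add: zero)
  moreover have "T f = T (\<Sum>l | mdegree l \<le> N. mfps_const (mfps_nth f l) * mpow mX l) +
      T (f - (\<Sum>l | mdegree l \<le> N. mfps_const (mfps_nth f l) * mpow mX l))"
    by (simp flip: add)
  ultimately show "order_ge N (T f)"
    using cont[OF mfps_truncate[of N f]] by simp
qed

lemma subst_mpow:
  "no_const \<Phi> \<Longrightarrow> mfps_subst (mpow \<Psi> l) \<Phi> = mpow (\<chi> k. mfps_subst (\<Psi> $ k) \<Phi>) l"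
  by (simp add: mpow_def subst_prod subst_power)

lemma subst_mpow_mX: "no_const \<Phi> \<Longrightarrow> mfps_subst (mpow mX l) \<Phi> = mpow \<Phi> l"
  by (simp add: subst_mpow)

lemma no_const_subst: "no_const \<Phi> \<Longrightarrow> mfps_nth f 0 = 0 \<Longrightarrow> mfps_nth (mfps_subst f \<Phi>) 0 = 0"
  using order_ge_subst[of \<Phi> 1 f] unfolding order_ge_1 by blast

lemma no_const_comp: "no_const \<Phi> \<Longrightarrow> no_const \<Psi> \<Longrightarrow> no_const (fmap_comp \<Phi> \<Psi>)"
  by (simp add: fmap_comp_def no_const_subst)

lemma subst_subst:
  fixes f :: "('a::comm_ring_1, 'b::finite) mfps"
  assumes "no_const \<Phi>" "no_const \<Psi>"
  shows "mfps_subst (mfps_subst f \<Phi>) \<Psi> = mfps_subst f (fmap_comp \<Phi> \<Psi>)"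
proof -
  let ?T = "\<lambda>f. mfps_subst (mfps_subst f \<Phi>) \<Psi> - mfps_subst f (fmap_comp \<Phi> \<Psi>)"
  have nc: "no_const (fmap_comp \<Phi> \<Psi>)" by (rule no_const_comp[OF assms])
  have "?T f = 0"
  proof (rule continuous_additive_eq_0[of ?T])
    fix N and f :: "('a, 'b) mfps" assume "order_ge (Suc N) f"
    then have "order_ge N f" by (rule order_ge_mono) simp
    then show "order_ge N (?T f)"
      by (intro order_ge_diff order_ge_subst assms nc)
  next
    fix c l
    show "?T (mfps_const c * mpow mX l) = 0"
      using assms nc by (simp add: subst_const_mult subst_mpow_mX subst_mpow fmap_comp_def)
  qed (simp add: subst_add)
  then show ?thesis by simp
qed


section \<open>Power series over an integral domain form an integral domain\<close>

text \<open>Minimizing one coordinate after the other selects lexicographically least exponents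
  \<open>a\<close> and \<open>b\<close>; equality of the sums then forces equality coordinate by
  coordinate. Induction over the finite set \<open>A\<close> stands in for an ordering of the index
  type. With all coordinates in \<open>A\<close>, the coefficient at \<open>a + b\<close> of a
  product of nonzero series is a single nonzero product.\<close>

lemma unique_split:
  fixes S T :: "(nat ^ 'n::finite) set"
  assumes "finite A" "S \<noteq> {}" "T \<noteq> {}"
  shows "\<exists>a\<in>S. \<exists>b\<in>T. \<forall>a'\<in>S. \<forall>b'\<in>T. a' + b' = a + b \<longrightarrow> (\<forall>k\<in>A. a' $ k = a $ k)"
  using assms
proof (induction A arbitrary: S T)
  case (insert v A)
  define min where "min U = {a\<in>U. \<forall>a'\<in>U. a $ v \<le> a' $ v}" for U :: "(nat ^ 'n) set"
  have ne: "min U \<noteq> {}" if "U \<noteq> {}" for U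
  proof -
    from that obtain u where "u \<in> U" by blast
    then obtain a where "a \<in> U" "\<forall>a'\<in>U. a $ v \<le> a' $ v"
      using ex_has_least_nat[of "\<lambda>a. a \<in> U" u "\<lambda>a. a $ v"] by auto
    then show ?thesis by (auto simp: min_def)
  qed
  from insert.IH[OF ne[OF insert.prems(1)] ne[OF insert.prems(2)]]
  obtain a b where ab: "a \<in> min S" "b \<in> min T"
    "\<forall>a'\<in>min S. \<forall>b'\<in>min T. a' + b' = a + b \<longrightarrow> (\<forall>k\<in>A. a' $ k = a $ k)"
    by (elim bexE) (rule that)
  show ?case
  proof (intro bexI ballI impI)
    show "a \<in> S" "b \<in> T" using ab(1,2) by (auto simp: min_def)
    fix a' b' k assume *: "a' \<in> S" "b' \<in> T" "a' + b' = a + b" "k \<in> insert v A"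
    have "a' $ v + b' $ v = a $ v + b $ v" using arg_cong[OF *(3), of "\<lambda>m. m $ v"] by simp
    moreover have "a $ v \<le> a' $ v" "b $ v \<le> b' $ v" using ab(1,2) *(1,2) by (auto simp: min_def)
    ultimately have v: "a' $ v = a $ v" "b' $ v = b $ v" by auto
    then have "a' \<in> min S" "b' \<in> min T" using ab(1,2) *(1,2) by (auto simp: min_def)
    from ab(3)[rule_format, OF this *(3)] have "\<forall>k\<in>A. a' $ k = a $ k" by simp
    then show "a' $ k = a $ k" using *(4) v by blast
  qed
qed auto

instance mfps :: (idom, finite) idom
proof
  fix f g :: "('a, 'b) mfps" assume "f \<noteq> 0" "g \<noteq> 0"
  then have "{m. mfps_nth f m \<noteq> 0} \<noteq> {}" "{m. mfps_nth g m \<noteq> 0} \<noteq> {}"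
    by (auto simp: mfps_eq_iff)
  from unique_split[OF finite_class.finite_UNIV this] obtain a b where
    ab: "mfps_nth f a \<noteq> 0" "mfps_nth g b \<noteq> 0" and
    uni': "\<forall>a'\<in>{m. mfps_nth f m \<noteq> 0}. \<forall>b'\<in>{m. mfps_nth g m \<noteq> 0}.
      a' + b' = a + b \<longrightarrow> (\<forall>k\<in>UNIV. a' $ k = a $ k)"
    by (elim bexE) (rule that, auto)
  have uni: "a' = a" if "mfps_nth f a' \<noteq> 0" "mfps_nth g b' \<noteq> 0" "a' + b' = a + b" for a' b'
    using uni' that by (auto simp: vec_eq_iff)
  have "mfps_nth (f * g) (a + b) = (\<Sum>(u, v)\<in>{(a, b)}. mfps_nth f u * mfps_nth g v)"
    unfolding mfps_nth_mult
  proof (rule sum.mono_neutral_right[OF finite_vec_splits])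
    show "\<forall>x\<in>{(u, v). u + v = a + b} - {(a, b)}. (case x of (u, v) \<Rightarrow> mfps_nth f u * mfps_nth g v) = 0"
    proof
      fix x assume x: "x \<in> {(u, v). u + v = a + b} - {(a, b)}"
      obtain u v where uv: "x = (u, v)" by (cases x)
      then have "u + v = a + b" "(u, v) \<noteq> (a, b)" using x by auto
      then have "mfps_nth f u = 0 \<or> mfps_nth g v = 0"
        using uni[of u v] by (cases "u = a") auto
      then show "(case x of (u, v) \<Rightarrow> mfps_nth f u * mfps_nth g v) = 0"
        unfolding uv by auto
    qed
  qed auto
  with ab have "mfps_nth (f * g) (a + b) \<noteq> 0" by simp
  then show "f * g \<noteq> 0" by auto
qed

section \<open>Coefficients in a subfield\<close>

lemma coeffs_in_nth: "coeffs_in K f \<Longrightarrow> mfps_nth f m \<in> K" by (simp add: coeffs_in_def)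

definition is_subfield :: "'a::field set \<Rightarrow> bool" where
  "is_subfield K \<longleftrightarrow> 0 \<in> K \<and> 1 \<in> K \<and> (\<forall>x\<in>K. \<forall>y\<in>K. x + y \<in> K \<and> x * y \<in> K) \<and>
     (\<forall>x\<in>K. - x \<in> K \<and> inverse x \<in> K)"

context
  fixes K :: "'a::field set"
  assumes K: "is_subfield K"
begin

lemma subfield_closed: "0 \<in> K" "1 \<in> K"
  "x \<in> K \<Longrightarrow> y \<in> K \<Longrightarrow> x + y \<in> K" "x \<in> K \<Longrightarrow> y \<in> K \<Longrightarrow> x * y \<in> K"
  "x \<in> K \<Longrightarrow> - x \<in> K" "x \<in> K \<Longrightarrow> inverse x \<in> K"
  using K by (auto simp: is_subfield_def)

lemma subfield_diff: "x \<in> K \<Longrightarrow> y \<in> K \<Longrightarrow> x - y \<in> K"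
  using subfield_closed(3)[of x "- y"] subfield_closed(5)[of y] by simp

lemma subfield_divide: "x \<in> K \<Longrightarrow> y \<in> K \<Longrightarrow> x / y \<in> K"
  by (simp add: divide_inverse subfield_closed)

lemma subfield_sum: "(\<And>x. x \<in> S \<Longrightarrow> f x \<in> K) \<Longrightarrow> sum f S \<in> K"
  by (induction S rule: infinite_finite_induct) (auto intro: subfield_closed)

lemma subfield_prod: "(\<And>x. x \<in> S \<Longrightarrow> f x \<in> K) \<Longrightarrow> prod f S \<in> K"
  by (induction S rule: infinite_finite_induct) (auto intro: subfield_closed)

lemma subfield_power: "x \<in> K \<Longrightarrow> x ^ k \<in> K"
  by (induction k) (auto intro: subfield_closed)

lemma coeffs_in_add: "coeffs_in K f \<Longrightarrow> coeffs_in K g \<Longrightarrow> coeffs_in K (f + g)"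
  by (simp add: coeffs_in_def subfield_closed subfield_diff)
lemma coeffs_in_diff: "coeffs_in K f \<Longrightarrow> coeffs_in K g \<Longrightarrow> coeffs_in K (f - g)"
  by (simp add: coeffs_in_def subfield_closed subfield_diff)
lemma coeffs_in_const_mult: "c \<in> K \<Longrightarrow> coeffs_in K g \<Longrightarrow> coeffs_in K (mfps_const c * g)"
  by (simp add: coeffs_in_def subfield_closed subfield_diff)
lemma coeffs_in_1: "coeffs_in K 1"
  by (simp add: coeffs_in_def mfps_nth_1 subfield_closed)
lemma coeffs_in_X: "coeffs_in K (mfps_X k)"
  by (simp add: coeffs_in_def mfps_nth_X subfield_closed)
lemma coeffs_in_mult: "coeffs_in K f \<Longrightarrow> coeffs_in K g \<Longrightarrow> coeffs_in K (f * g)"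
  unfolding coeffs_in_def mfps_nth_mult by (auto intro!: subfield_sum subfield_closed(4))
lemma coeffs_in_power: "coeffs_in K f \<Longrightarrow> coeffs_in K (f ^ k)"
  by (induction k) (auto intro: coeffs_in_1 coeffs_in_mult)
lemma coeffs_in_prod: "(\<And>x. x \<in> S \<Longrightarrow> coeffs_in K (f x)) \<Longrightarrow> coeffs_in K (prod f S)"
  by (induction S rule: infinite_finite_induct) (auto intro: coeffs_in_1 coeffs_in_mult)
lemma coeffs_in_subst:
  "coeffs_in K f \<Longrightarrow> (\<And>k. coeffs_in K (\<Phi> $ k)) \<Longrightarrow> coeffs_in K (mfps_subst f \<Phi>)"
  unfolding coeffs_in_def[of K "mfps_subst f \<Phi>"] mfps_nth_subst mpow_def
  by (auto intro!: subfield_sum subfield_closed(4) coeffs_in_nth coeffs_in_prod coeffs_in_power)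

end

section \<open>Diagonal linear parts\<close>

abbreviation vpow :: "'a::comm_ring_1 ^ 'n::finite \<Rightarrow> nat ^ 'n \<Rightarrow> 'a" where
  "vpow \<mu> l \<equiv> (\<Prod>k\<in>UNIV. (\<mu> $ k) ^ (l $ k))"

lemma vpow_add: "vpow \<mu> (a + b) = vpow \<mu> a * vpow \<mu> b"
  by (simp add: power_add prod.distrib)

lemma vpow_axis: "vpow \<mu> (axis k 1) = \<mu> $ k"
proof -
  have "vpow \<mu> (axis k 1) = (\<Prod>j\<in>UNIV. if j = k then \<mu> $ j else 1)"
    by (intro prod.cong) (auto simp: axis_def)
  then show ?thesis by simp
qed

definition diag_linear :: "'a::comm_ring_1 ^ 'n::finite \<Rightarrow> ('a, 'n) fmap \<Rightarrow> bool" where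
  "diag_linear \<mu> \<Phi> \<longleftrightarrow> no_const \<Phi> \<and> linear_part \<Phi> = diag_matrix \<mu>"

lemma diag_linear_no_const: "diag_linear \<mu> \<Phi> \<Longrightarrow> no_const \<Phi>"
  by (simp add: diag_linear_def)

lemma order_ge_2I:
  assumes "mfps_nth f 0 = 0" "\<And>j. mfps_nth f (axis j 1) = 0"
  shows "order_ge 2 f"
  unfolding order_ge_def
proof (intro allI impI)
  fix m :: "nat ^ 'b" assume "mdegree m < 2"
  then have "mdegree m = 0 \<or> mdegree m = 1" by linarith
  then show "mfps_nth f m = 0"
    using assms unfolding mdegree_zero_iff mdegree_1 by auto
qed

lemma axis_eq_iff: "axis j (1::nat) = axis k 1 \<longleftrightarrow> j = k"
  by (auto simp: axis_def vec_eq_iff)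

lemma axis_1_neq_0 [simp]: "axis j (Suc 0) \<noteq> 0" "0 \<noteq> axis j (Suc 0)"
  by (auto simp: axis_def vec_eq_iff)

lemma diag_linear_order:
  assumes "diag_linear \<mu> \<Phi>"
  shows "order_ge 2 (\<Phi> $ k - mfps_const (\<mu> $ k) * mfps_X k)"
proof (rule order_ge_2I)
  show "mfps_nth (\<Phi> $ k - mfps_const (\<mu> $ k) * mfps_X k) 0 = 0"
    using assms by (simp add: diag_linear_def mfps_nth_X)
  fix j
  have "linear_part \<Phi> $ k $ j = diag_matrix \<mu> $ k $ j"
    using assms by (simp add: diag_linear_def)
  then show "mfps_nth (\<Phi> $ k - mfps_const (\<mu> $ k) * mfps_X k) (axis j 1) = 0"
    unfolding linear_part_def diag_matrix_def
    by (simp add: mfps_nth_X axis_eq_iff[unfolded One_nat_def] split: if_splits)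
qed

lemma diag_linearI:
  assumes "\<And>k. order_ge 2 (\<Phi> $ k - mfps_const (\<mu> $ k) * mfps_X k)"
  shows "diag_linear \<mu> \<Phi>"
proof -
  have "mfps_nth (\<Phi> $ k - mfps_const (\<mu> $ k) * mfps_X k) 0 = 0" for k
    by (rule order_geD[OF assms]) simp
  moreover have "mfps_nth (\<Phi> $ k - mfps_const (\<mu> $ k) * mfps_X k) (axis j 1) = 0" for k j
    by (rule order_geD[OF assms]) simp
  ultimately have "linear_part \<Phi> $ k $ j = diag_matrix \<mu> $ k $ j" "mfps_nth (\<Phi> $ k) 0 = 0" for k j
    unfolding linear_part_def diag_matrix_def
    by (auto simp: mfps_nth_X axis_eq_iff[unfolded One_nat_def])
  then show ?thesis
    unfolding diag_linear_def by (simp add: vec_eq_iff)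
qed

lemma mpow_lowest:
  assumes "diag_linear \<mu> \<Phi>"
  shows "order_ge (Suc (mdegree l)) (mpow \<Phi> l - mfps_const (vpow \<mu> l) * mpow mX l)"
proof (induction l rule: mdegree_induct)
  case (axis l k)
  let ?c = "mfps_const (vpow \<mu> l)"
  have nc: "no_const \<Phi>" using assms by (rule diag_linear_no_const)
  have "order_ge (Suc (mdegree l) + 1) ((mpow \<Phi> l - ?c * mpow mX l) * \<Phi> $ k)"
    by (rule order_ge_mult[OF axis]) (use nc in \<open>simp only: order_ge_1\<close>)
  moreover have "order_ge (mdegree l + 2) (?c * (mpow mX l * (\<Phi> $ k - mfps_const (\<mu> $ k) * mfps_X k)))"
    by (intro order_ge_const_mult order_ge_mult order_ge_mpow no_const_mX diag_linear_order assms)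
  moreover have "mpow \<Phi> (l + axis k 1) - mfps_const (vpow \<mu> (l + axis k 1)) * mpow mX (l + axis k 1) =
     (mpow \<Phi> l - ?c * mpow mX l) * \<Phi> $ k +
     ?c * (mpow mX l * (\<Phi> $ k - mfps_const (\<mu> $ k) * mfps_X k))"
    by (simp only: mpow_add mpow_axis vpow_add vpow_axis mfps_const_mult mX_nth) (simp add: algebra_simps)
  ultimately show ?case
    unfolding mdegree_add mdegree_axis by (auto intro: order_ge_add)
qed simp

text \<open>Composition is triangular for the degree filtration: on the lowest-degree part it acts
  like the linear part, which multiplies \<open>x^m\<close> by \<open>vpow \<mu> m\<close>. Degrees
  below \<open>N\<close> are included, both sides being 0 there.\<close>

lemma subst_lowest:
  assumes \<Phi>: "diag_linear \<mu> \<Phi>" and f: "order_ge N f" and m: "mdegree m \<le> N"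
  shows "mfps_nth (mfps_subst f \<Phi>) m = vpow \<mu> m * mfps_nth f m"
proof -
  have "mfps_nth f l * mfps_nth (mpow \<Phi> l) m = 0" if "mdegree l \<le> mdegree m" "l \<noteq> m" for l
  proof (cases "mdegree l < N")
    case True
    then show ?thesis using order_geD[OF f] by simp
  next
    case False
    with m that have "mdegree m < Suc (mdegree l)" by simp
    from order_geD[OF mpow_lowest[OF \<Phi>] this] that(2) show ?thesis
      by (simp add: mfps_nth_mpow_mX)
  qed
  then have "mfps_nth (mfps_subst f \<Phi>) m = (\<Sum>l\<in>{m}. mfps_nth f l * mfps_nth (mpow \<Phi> l) m)"
    unfolding mfps_nth_subst by (intro sum.mono_neutral_right) auto
  moreover have "mfps_nth (mpow \<Phi> m) m = vpow \<mu> m"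
    using order_geD[OF mpow_lowest[OF \<Phi>, of m], of m] by (simp add: mfps_nth_mpow_mX)
  ultimately show ?thesis by (simp add: mult.commute)
qed

lemma subst_inj:
  fixes f g :: "('a::idom, 'n::finite) mfps"
  assumes \<Phi>: "diag_linear \<mu> \<Phi>" and \<mu>: "\<And>k. \<mu> $ k \<noteq> 0" and eq: "mfps_subst f \<Phi> = mfps_subst g \<Phi>"
  shows "f = g"
proof -
  have "order_ge N (f - g)" for N
  proof (induction N)
    case (Suc N)
    have "mfps_nth (f - g) m = 0" if "mdegree m \<le> N" for m
    proof -
      have "vpow \<mu> m * mfps_nth (f - g) m = 0"
        using subst_lowest[OF \<Phi> Suc that] eq by (simp add: subst_diff)
      then show ?thesis using \<mu> by simp
    qed
    then show ?case by (simp add: order_ge_def less_Suc_eq_le)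
  qed simp
  then have "f - g = 0" by (rule order_ge_eq_0)
  then show ?thesis by simp
qed

text \<open>Successive approximation in the degree filtration: the correction at stage
  \<open>N\<close> has order \<open>N\<close>, so every coefficient becomes stationary. By
  \<open>congr\<close> the condition \<open>Q N\<close> ignores changes of order \<open>N\<close>,
  and hence passes to the limit.\<close>

lemma approx_limit:
  assumes init: "Q N0 f0" "coeffs_in K f0"
    and step: "\<And>N f. N \<ge> N0 \<Longrightarrow> Q N f \<Longrightarrow> coeffs_in K f \<Longrightarrow>
      \<exists>g. order_ge N (g - f) \<and> coeffs_in K g \<and> Q (Suc N) g"
    and congr: "\<And>N f g. N \<ge> N0 \<Longrightarrow> Q N f \<Longrightarrow> order_ge N (g - f) \<Longrightarrow> Q N g"
  shows "\<exists>g. coeffs_in K g \<and> order_ge N0 (g - f0) \<and> (\<forall>N\<ge>N0. Q N g)"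
proof -
  have "\<exists>s. \<forall>n. (Q (N0 + n) (s n) \<and> coeffs_in K (s n) \<and> (n = 0 \<longrightarrow> s n = f0)) \<and>
      order_ge (N0 + n) (s (Suc n) - s n)"
  proof (rule dependent_nat_choice)
    fix x n assume "Q (N0 + n) x \<and> coeffs_in K x \<and> (n = 0 \<longrightarrow> x = f0)"
    with step[of "N0 + n" x] show "\<exists>y. (Q (N0 + Suc n) y \<and> coeffs_in K y \<and> (Suc n = 0 \<longrightarrow> y = f0)) \<and>
        order_ge (N0 + n) (y - x)" by auto
  qed (use init in auto)
  then obtain s where s: "\<And>n. Q (N0 + n) (s n)" "\<And>n. coeffs_in K (s n)" "s 0 = f0"
    "\<And>n. order_ge (N0 + n) (s (Suc n) - s n)" by blast
  have s': "order_ge (N0 + n) (s (n + d) - s n)" for n d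
  proof (induction d)
    case (Suc d)
    have "order_ge (N0 + n) (s (Suc (n + d)) - s (n + d))"
      by (rule order_ge_mono[OF s(4)]) simp
    from order_ge_add[OF this Suc] show ?case by simp
  qed simp
  \<comment> \<open>From stage \<open>Suc (mdegree m)\<close> on, all corrections have order above
    \<open>mdegree m\<close>, so this coefficient is final.\<close>
  define g where "g = Abs_mfps (\<lambda>m. mfps_nth (s (Suc (mdegree m))) m)"
  have g: "order_ge (N0 + n) (g - s n)" for n
    unfolding order_ge_def
  proof (intro allI impI)
    fix m :: "nat ^ 'b" assume m: "mdegree m < N0 + n"
    show "mfps_nth (g - s n) m = 0"
    proof (cases "Suc (mdegree m) \<le> n")
      case True
      then obtain d where "n = Suc (mdegree m) + d" using le_Suc_ex by blast
      with order_geD[OF s'[of "Suc (mdegree m)" d], of m] show ?thesis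
        by (simp add: g_def)
    next
      case False
      then obtain d where "Suc (mdegree m) = n + d" using le_Suc_ex[of n "Suc (mdegree m)"] by auto
      with order_geD[OF s'[of n d] m] show ?thesis
        by (simp add: g_def)
    qed
  qed
  have "Q N g" if "N \<ge> N0" for N
    using congr[of "N0 + (N - N0)", OF _ s(1) g] that by simp
  moreover have "coeffs_in K g"
    using s(2) by (auto simp: coeffs_in_def g_def)
  ultimately show ?thesis using g[of 0] s(3) by auto
qed

text \<open>The residue \<open>f - H \<circ> \<Psi>\<close> is removed degree by degree: as \<Psi>
  is tangent to the identity, adding the degree-\<open>N\<close> part of the residue to
  \<open>H\<close> cancels exactly that part.\<close>

lemma subst_surj:
  assumes K: "is_subfield K" and \<Psi>: "diag_linear (\<chi> k. 1) \<Psi>" "\<And>k. coeffs_in K (\<Psi> $ k)"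
    and f: "coeffs_in K f"
  obtains H where "coeffs_in K H" "mfps_subst H \<Psi> = f"
proof -
  have nc: "no_const \<Psi>" using \<Psi>(1) by (rule diag_linear_no_const)
  have "\<exists>H. coeffs_in K H \<and> order_ge 0 (H - 0) \<and> (\<forall>N\<ge>0. order_ge N (f - mfps_subst H \<Psi>))"
  proof (rule approx_limit)
    show "coeffs_in K 0" by (simp add: coeffs_in_def subfield_closed(1)[OF K])
  next
    fix N H assume H: "order_ge N (f - mfps_subst H \<Psi>)" "coeffs_in K H"
    define r where "r = f - mfps_subst H \<Psi>"
    define h where "h = Abs_mfps (\<lambda>m. if mdegree m = N then mfps_nth r m else 0)"
    have h: "order_ge N h" by (simp add: h_def order_ge_def)
    have "coeffs_in K r" unfolding r_def
      by (intro coeffs_in_diff[OF K] coeffs_in_subst[OF K] f \<Psi> H)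
    then have "coeffs_in K h" by (auto simp: h_def coeffs_in_def subfield_closed(1)[OF K])
    moreover have "mfps_nth (r - mfps_subst h \<Psi>) m = 0" if "mdegree m \<le> N" for m
    proof -
      have "mfps_nth r m = 0" if "mdegree m \<noteq> N"
        using that \<open>mdegree m \<le> N\<close> H(1) by (simp add: r_def order_ge_def)
      then show ?thesis
        using subst_lowest[OF \<Psi>(1) h that] by (auto simp: h_def)
    qed
    then have "order_ge (Suc N) (f - mfps_subst (H + h) \<Psi>)"
      by (simp add: r_def order_ge_def less_Suc_eq_le subst_add algebra_simps)
    ultimately show "\<exists>g. order_ge N (g - H) \<and> coeffs_in K g \<and> order_ge (Suc N) (f - mfps_subst g \<Psi>)"
      using h H(2) by (intro exI[of _ "H + h"]) (auto intro: coeffs_in_add[OF K])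
  next
    fix N H g assume "order_ge N (f - mfps_subst H \<Psi>)" "order_ge N (g - H)"
    from order_ge_diff[OF this(1) order_ge_subst[OF nc this(2)]]
    show "order_ge N (f - mfps_subst g \<Psi>)" by (simp add: subst_diff)
  qed auto
  then obtain H where H: "coeffs_in K H" "\<And>N. order_ge N (f - mfps_subst H \<Psi>)" by auto
  from order_ge_eq_0[OF H(2)] have "mfps_subst H \<Psi> = f" by simp
  with H(1) show ?thesis by (rule that)
qed

section \<open>Joint generalized eigenspaces and the normal form\<close>

text \<open>The operator \<open>f \<mapsto> f \<circ> \<Phi>\<close> minus the scalar
  \<open>c\<close>, whose iterated kernels form the generalized eigenspace of \<open>c\<close>. For
  \<open>c = 1\<close> it is a difference operator, for \<open>c = 0\<close> composition
  itself.\<close>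

definition twist :: "('a::comm_ring_1, 'n::finite) fmap \<Rightarrow> 'a \<Rightarrow> ('a, 'n) mfps \<Rightarrow> ('a, 'n) mfps" where
  "twist \<Phi> c f = mfps_subst f \<Phi> - mfps_const c * f"

lemma twist_add: "twist \<Phi> c (f + g) = twist \<Phi> c f + twist \<Phi> c g"
  by (simp add: twist_def subst_add algebra_simps)
lemma twist_const_mult: "twist \<Phi> c (mfps_const d * f) = mfps_const d * twist \<Phi> c f"
  by (simp add: twist_def subst_const_mult right_diff_distrib mult.left_commute)

lemma twist_0 [simp]: "twist \<Phi> c 0 = 0"
  by (simp add: twist_def)
lemma twist_pow_0 [simp]: "(twist \<Phi> c ^^ k) 0 = 0"
  by (induction k) simp_all

lemma twist_pow_add: "(twist \<Phi> c ^^ k) (f + g) = (twist \<Phi> c ^^ k) f + (twist \<Phi> c ^^ k) g"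
  by (induction k) (simp_all add: twist_add)
lemma twist_pow_const_mult: "(twist \<Phi> c ^^ k) (mfps_const d * f) = mfps_const d * (twist \<Phi> c ^^ k) f"
  by (induction k) (simp_all add: twist_const_mult)

lemma order_ge_twist: "no_const \<Phi> \<Longrightarrow> order_ge N f \<Longrightarrow> order_ge N (twist \<Phi> c f)"
  unfolding twist_def by (intro order_ge_diff order_ge_subst order_ge_const_mult)
lemma order_ge_twist_pow: "no_const \<Phi> \<Longrightarrow> order_ge N f \<Longrightarrow> order_ge N ((twist \<Phi> c ^^ k) f)"
  by (induction k) (auto intro: order_ge_twist)
lemma order_ge_twist_pow_mono:
  assumes "no_const \<Phi>" "order_ge N ((twist \<Phi> c ^^ k) f)" "k \<le> k'"
  shows "order_ge N ((twist \<Phi> c ^^ k') f)"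
proof -
  obtain d where "k' = d + k" using assms(3) by (metis add.commute le_Suc_ex)
  then show ?thesis using order_ge_twist_pow[OF assms(1,2), where k = d and c = c] by (simp add: funpow_add)
qed

lemma coeffs_in_twist:
  "is_subfield K \<Longrightarrow> c \<in> K \<Longrightarrow> (\<And>k. coeffs_in K (\<Phi> $ k)) \<Longrightarrow> coeffs_in K f \<Longrightarrow> coeffs_in K (twist \<Phi> c f)"
  unfolding twist_def by (intro coeffs_in_diff coeffs_in_subst coeffs_in_const_mult)
lemma coeffs_in_twist_pow:
  "is_subfield K \<Longrightarrow> c \<in> K \<Longrightarrow> (\<And>k. coeffs_in K (\<Phi> $ k)) \<Longrightarrow> coeffs_in K f \<Longrightarrow>
    coeffs_in K ((twist \<Phi> c ^^ k) f)"
  by (induction k) (auto intro: coeffs_in_twist)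

lemma twist_pow_lowest:
  assumes "diag_linear \<mu> \<Phi>" "order_ge N f" "mdegree m \<le> N"
  shows "mfps_nth ((twist \<Phi> c ^^ k) f) m = (vpow \<mu> m - c) ^ k * mfps_nth f m"
proof (induction k)
  case (Suc k)
  have "order_ge N ((twist \<Phi> c ^^ k) f)"
    by (intro order_ge_twist_pow diag_linear_no_const[OF assms(1)] assms)
  from subst_lowest[OF assms(1) this assms(3)] Suc show ?case
    by (simp add: twist_def[of \<Phi> c "(twist \<Phi> c ^^ k) f"] algebra_simps)
qed simp

lemma funpow_commute:
  assumes "\<And>x. f (g x) = g (f x)"
  shows "(f ^^ a) ((g ^^ b) x) = (g ^^ b) ((f ^^ a) x)"
proof -
  have *: "f ((g ^^ b) x) = (g ^^ b) (f x)" for x by (induction b) (simp_all add: assms)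
  show ?thesis by (induction a) (simp_all add: *)
qed

lemma twist_commute:
  assumes "no_const \<Phi>" "no_const \<Phi>'" "fmap_comp \<Phi> \<Phi>' = fmap_comp \<Phi>' \<Phi>"
  shows "twist \<Phi> c (twist \<Phi>' c' f) = twist \<Phi>' c' (twist \<Phi> c f)"
proof -
  have "mfps_subst (mfps_subst f \<Phi>') \<Phi> = mfps_subst (mfps_subst f \<Phi>) \<Phi>'"
    using assms by (simp add: subst_subst)
  moreover have "twist \<Phi> c (twist \<Phi>' c' f) = mfps_subst (mfps_subst f \<Phi>') \<Phi> -
      mfps_const c' * mfps_subst f \<Phi> - mfps_const c * mfps_subst f \<Phi>' + mfps_const (c * c') * f"
    for c c' \<Phi> \<Phi>' by (simp add: twist_def subst_diff subst_const_mult right_diff_distrib mfps_const_mult)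
  ultimately show ?thesis by (simp add: mult.commute)
qed

text \<open>The eigenvector arises from \<open>x_k\<close> by corrections of growing degree, with
  power \<open>N\<close> of the operator paired with degree \<open>N\<close>. A non-resonant
  coefficient in degree \<open>N\<close> is removed by a correction, a resonant one by the
  additional application of the operator. One correction has to serve all \<open>i\<close>, which
  commutation makes possible. The start is 2 because one application already takes
  \<open>x_k\<close> to order 2; corrections then leave the linear part alone.\<close>

lemma ex_generalized_eigenvector:
  fixes \<Phi> :: "nat \<Rightarrow> ('a::field, 'n::finite) fmap"
  assumes K: "is_subfield K"
    and \<Phi>: "\<And>i. i < p \<Longrightarrow> diag_linear (\<mu> i) (\<Phi> i)" "\<And>i k. i < p \<Longrightarrow> coeffs_in K (\<Phi> i $ k)"
    and comm: "\<And>i j. i < p \<Longrightarrow> j < p \<Longrightarrow> fmap_comp (\<Phi> i) (\<Phi> j) = fmap_comp (\<Phi> j) (\<Phi> i)"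
    and \<mu>: "\<And>i k. i < p \<Longrightarrow> \<mu> i $ k \<in> K"
  shows "\<exists>f. coeffs_in K f \<and> order_ge 2 (f - mfps_X k) \<and>
    (\<forall>N\<ge>2. \<forall>i<p. order_ge N ((twist (\<Phi> i) (\<mu> i $ k) ^^ N) f))"
proof (rule approx_limit)
  let ?T = "\<lambda>i. twist (\<Phi> i) (\<mu> i $ k)"
  have nc: "no_const (\<Phi> i)" if "i < p" for i using \<Phi>(1)[OF that] by (rule diag_linear_no_const)
  show "\<forall>i<p. order_ge 2 ((?T i ^^ 2) (mfps_X k))"
  proof (intro allI impI)
    fix i assume i: "i < p"
    have "order_ge 2 (?T i (mfps_X k))"
      unfolding twist_def subst_X[OF nc[OF i]] by (rule diag_linear_order[OF \<Phi>(1)[OF i]])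
    then show "order_ge 2 ((?T i ^^ 2) (mfps_X k))"
      using nc[OF i] by (simp add: numeral_2_eq_2 order_ge_twist)
  qed
  show "coeffs_in K (mfps_X k)" by (rule coeffs_in_X[OF K])
next
  let ?T = "\<lambda>i. twist (\<Phi> i) (\<mu> i $ k)"
  have nc: "no_const (\<Phi> i)" if "i < p" for i using \<Phi>(1)[OF that] by (rule diag_linear_no_const)
  fix N f assume f: "\<forall>i<p. order_ge N ((?T i ^^ N) f)" "coeffs_in K f"
  define r where "r i = (?T i ^^ N) f" for i
  \<comment> \<open>Both sides are the coefficient at \<open>m\<close> obtained by applying the
    \<open>N\<close>-th powers of both operators to \<open>f\<close>, in either order. Hence the
    corrections demanded by two non-resonant indices coincide.\<close>
  have compat: "(vpow (\<mu> j) m - \<mu> j $ k) ^ N * mfps_nth (r i) m = (vpow (\<mu> i) m - \<mu> i $ k) ^ N * mfps_nth (r j) m"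
    if "i < p" "j < p" "mdegree m \<le> N" for i j m
  proof -
    have "(?T j ^^ N) (r i) = (?T i ^^ N) (r j)"
      unfolding r_def
      by (rule funpow_commute) (intro twist_commute nc that comm)
    moreover have "order_ge N (r i)" "order_ge N (r j)" using f that by (auto simp: r_def)
    ultimately show ?thesis
      using twist_pow_lowest[OF \<Phi>(1)[OF that(2)], of N "r i" m N "\<mu> j $ k"]
        twist_pow_lowest[OF \<Phi>(1)[OF that(1)], of N "r j" m N "\<mu> i $ k"] that(3) by simp
  qed
  define nonres where "nonres i m \<longleftrightarrow> i < p \<and> vpow (\<mu> i) m \<noteq> \<mu> i $ k" for i m
  \<comment> \<open>By \<open>compat\<close> any other non-resonant index would yield the same
    correction.\<close>
  define s where "s m = (SOME i. nonres i m)" for m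
  have s: "nonres (s m) m" if "nonres i m" for i m
    using that unfolding s_def by (rule someI)
  define h where "h = Abs_mfps (\<lambda>m. if mdegree m = N \<and> nonres (s m) m
    then - mfps_nth (r (s m)) m / (vpow (\<mu> (s m)) m - \<mu> (s m) $ k) ^ N else 0)"
  have h: "order_ge N h" by (simp add: h_def order_ge_def)
  have rK: "coeffs_in K (r i)" if "i < p" for i
    unfolding r_def using that f \<mu> \<Phi> by (intro coeffs_in_twist_pow K) auto
  have hK: "coeffs_in K h"
    unfolding coeffs_in_def h_def mfps_nth_Abs
  proof
    fix m
    show "(if mdegree m = N \<and> nonres (s m) m
        then - mfps_nth (r (s m)) m / (vpow (\<mu> (s m)) m - \<mu> (s m) $ k) ^ N else 0) \<in> K"
    proof (cases "nonres (s m) m")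
      case True
      then have "s m < p" by (simp add: nonres_def)
      then have "- mfps_nth (r (s m)) m / (vpow (\<mu> (s m)) m - \<mu> (s m) $ k) ^ N \<in> K"
        by (intro subfield_divide[OF K] subfield_power[OF K] subfield_diff[OF K] subfield_prod[OF K]
            subfield_closed(5)[OF K] \<mu> coeffs_in_nth[OF rK])
      then show ?thesis by (simp add: subfield_closed(1)[OF K])
    qed (simp add: subfield_closed(1)[OF K])
  qed
  have "order_ge (Suc N) ((?T i ^^ Suc N) (f + h))" if i: "i < p" for i
  proof -
    let ?d = "\<lambda>m. vpow (\<mu> i) m - \<mu> i $ k"
    have o: "order_ge N ((?T i ^^ N) (f + h))"
      unfolding twist_pow_add using f i h nc by (auto intro!: order_ge_add[OF _ order_ge_twist_pow])
    have "mfps_nth ((?T i ^^ Suc N) (f + h)) m = 0" if m: "mdegree m \<le> N" for m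
    proof -
      have eq: "mfps_nth ((?T i ^^ N) (f + h)) m = mfps_nth (r i) m + ?d m ^ N * mfps_nth h m"
        unfolding twist_pow_add mfps_nth_add twist_pow_lowest[OF \<Phi>(1)[OF i] h m] by (simp add: r_def)
      \<comment> \<open>The outer factor \<open>?d m\<close> is the effect of the last application
        of the operator in lowest degree; it settles the resonant case, where it is 0.\<close>
      have "?d m * (mfps_nth (r i) m + ?d m ^ N * mfps_nth h m) = 0"
      proof (cases "nonres i m \<and> mdegree m = N")
        case True
        then have ns: "nonres (s m) m" by (auto intro: s)
        have sp: "s m < p" using ns by (simp add: nonres_def)
        have nz: "(vpow (\<mu> (s m)) m - \<mu> (s m) $ k) ^ N \<noteq> 0" using ns by (simp add: nonres_def)
        have "mfps_nth (r i) m + ?d m ^ N * mfps_nth h m = 0"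
          using True ns nz compat[OF i sp m] by (simp add: h_def field_simps)
        then show ?thesis by simp
      next
        case False
        then consider "vpow (\<mu> i) m = \<mu> i $ k" | "mdegree m < N"
          using i m by (auto simp: nonres_def)
        then show ?thesis
        proof cases
          case 2
          then have "mfps_nth h m = 0" "mfps_nth (r i) m = 0"
            using f i h by (auto simp: order_ge_def r_def)
          then show ?thesis by simp
        qed simp
      qed
      then show ?thesis
        using twist_pow_lowest[OF \<Phi>(1)[OF i] o m, of 1 "\<mu> i $ k"] eq by simp
    qed
    then show ?thesis by (simp add: order_ge_def less_Suc_eq_le)
  qed
  then show "\<exists>g. order_ge N (g - f) \<and> coeffs_in K g \<and> (\<forall>i<p. order_ge (Suc N) ((?T i ^^ Suc N) g))"
    using h hK f(2) by (intro exI[of _ "f + h"]) (auto intro: coeffs_in_add[OF K] simp del: funpow.simps)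
next
  let ?T = "\<lambda>i. twist (\<Phi> i) (\<mu> i $ k)"
  fix N f g assume fg: "\<forall>i<p. order_ge N ((?T i ^^ N) f)" "order_ge N (g - f)"
  show "\<forall>i<p. order_ge N ((?T i ^^ N) g)"
  proof (intro allI impI)
    fix i assume i: "i < p"
    have "order_ge N ((?T i ^^ N) (f + (g - f)))"
      unfolding twist_pow_add
      using fg i diag_linear_no_const[OF \<Phi>(1)[OF i]] by (auto intro!: order_ge_add[OF _ order_ge_twist_pow])
    then show "order_ge N ((?T i ^^ N) g)" by simp
  qed
qed

text \<open>A twisted Leibniz rule: \<open>f * g\<close> is sent to \<open>twist \<Phi> a f\<close>
  times \<open>g \<circ> \<Phi>\<close>, plus \<open>a\<close> times
  \<open>f * twist \<Phi> b g\<close>. Composition with \<Phi> commutes with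
  \<open>twist \<Phi> b\<close>, so both summands fall under the induction on \<open>j + k\<close>;
  once \<open>j\<close> or \<open>k\<close> is 0, one factor itself has order \<open>N\<close>.
  Generalized eigenspaces are therefore multiplicative.\<close>

lemma twist_pow_mult:
  assumes nc: "no_const \<Phi>"
  shows "order_ge N ((twist \<Phi> a ^^ j) f) \<Longrightarrow> order_ge N ((twist \<Phi> b ^^ k) g) \<Longrightarrow>
    order_ge N ((twist \<Phi> (a * b) ^^ (j + k)) (f * g))"
proof (induction "j + k" arbitrary: j k f g)
  case 0
  then show ?case by (simp add: order_ge_mult_right)
next
  case (Suc n)
  show ?case
  proof (cases "j = 0 \<or> k = 0")
    case True
    then have "order_ge N (f * g)"
      using Suc.prems by (auto intro: order_ge_mult_right order_ge_mult_left)
    then show ?thesis by (rule order_ge_twist_pow[OF nc])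
  next
    case False
    then obtain j' k' where jk: "j = Suc j'" "k = Suc k'" by (meson not0_implies_Suc)
    have eq: "twist \<Phi> (a * b) (f * g) =
        twist \<Phi> a f * mfps_subst g \<Phi> + mfps_const a * (f * twist \<Phi> b g)"
      by (simp add: twist_def subst_mult[OF nc] mfps_const_mult algebra_simps)
    have c: "(twist \<Phi> b ^^ k) (mfps_subst g \<Phi>) = mfps_subst ((twist \<Phi> b ^^ k) g) \<Phi>"
      by (induction k) (simp_all add: twist_def subst_diff subst_const_mult)
    have 1: "order_ge N ((twist \<Phi> (a * b) ^^ (j' + k)) (twist \<Phi> a f * mfps_subst g \<Phi>))"
    proof (rule Suc.hyps(1))
      show "n = j' + k" using Suc.hyps(2) jk by simp
      show "order_ge N ((twist \<Phi> a ^^ j') (twist \<Phi> a f))"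
        using Suc.prems(1) by (simp add: jk funpow_swap1)
      show "order_ge N ((twist \<Phi> b ^^ k) (mfps_subst g \<Phi>))"
        unfolding c by (rule order_ge_subst[OF nc Suc.prems(2)])
    qed
    have 2: "order_ge N ((twist \<Phi> (a * b) ^^ (j + k')) (f * twist \<Phi> b g))"
    proof (rule Suc.hyps(1))
      show "n = j + k'" using Suc.hyps(2) jk by simp
      show "order_ge N ((twist \<Phi> b ^^ k') (twist \<Phi> b g))"
        using Suc.prems(2) by (simp add: jk funpow_swap1)
    qed (rule Suc.prems(1))
    have "(twist \<Phi> (a * b) ^^ (j + k)) (f * g) = (twist \<Phi> (a * b) ^^ (j' + k)) (twist \<Phi> (a * b) (f * g))"
      by (simp add: jk funpow_swap1)
    also have "\<dots> = (twist \<Phi> (a * b) ^^ (j' + k)) (twist \<Phi> a f * mfps_subst g \<Phi>) +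
        mfps_const a * (twist \<Phi> (a * b) ^^ (j + k')) (f * twist \<Phi> b g)"
      unfolding eq twist_pow_add twist_pow_const_mult by (simp add: jk del: funpow.simps)
    finally show ?thesis using 1 2 by (auto intro: order_ge_add order_ge_const_mult)
  qed
qed

text \<open>The exponent \<open>k\<close> may grow with \<open>N\<close>: the space of series is
  infinite-dimensional, and a nilpotent action can be expected only modulo each degree. This form is
  closed under limits in the degree filtration.\<close>

definition gen_eig ::
  "nat \<Rightarrow> (nat \<Rightarrow> ('a::comm_ring_1, 'n::finite) fmap) \<Rightarrow> (nat \<Rightarrow> 'a) \<Rightarrow> ('a, 'n) mfps \<Rightarrow> bool" where
  "gen_eig p \<Phi> \<xi> f \<longleftrightarrow> (\<forall>N. \<forall>i<p. \<exists>k. order_ge N ((twist (\<Phi> i) (\<xi> i) ^^ k) f))"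

lemma gen_eig_cong: "gen_eig p \<Phi> \<xi> f \<Longrightarrow> (\<And>i. i < p \<Longrightarrow> \<xi> i = \<xi>' i) \<Longrightarrow> gen_eig p \<Phi> \<xi>' f"
  by (simp add: gen_eig_def)

context
  fixes p :: nat and \<Phi> :: "nat \<Rightarrow> ('a::comm_ring_1, 'n::finite) fmap"
  assumes ncs: "\<forall>i<p. no_const (\<Phi> i)"
begin

lemma gen_eig_no_const: "i < p \<Longrightarrow> no_const (\<Phi> i)" using ncs by blast

lemma gen_eig_add:
  assumes "gen_eig p \<Phi> \<xi> f" "gen_eig p \<Phi> \<xi> g" shows "gen_eig p \<Phi> \<xi> (f + g)"
  unfolding gen_eig_def
proof (intro allI impI)
  fix N i assume i: "i < p"
  obtain k1 k2 where "order_ge N ((twist (\<Phi> i) (\<xi> i) ^^ k1) f)" "order_ge N ((twist (\<Phi> i) (\<xi> i) ^^ k2) g)"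
    using assms i unfolding gen_eig_def by blast
  then have "order_ge N ((twist (\<Phi> i) (\<xi> i) ^^ (max k1 k2)) (f + g))"
    unfolding twist_pow_add
    by (intro order_ge_add; elim order_ge_twist_pow_mono[OF gen_eig_no_const[OF i]]) auto
  then show "\<exists>k. order_ge N ((twist (\<Phi> i) (\<xi> i) ^^ k) (f + g))" ..
qed

lemma gen_eig_const_mult: "gen_eig p \<Phi> \<xi> f \<Longrightarrow> gen_eig p \<Phi> \<xi> (mfps_const c * f)"
  unfolding gen_eig_def twist_pow_const_mult by (meson order_ge_const_mult)

lemma gen_eig_0: "gen_eig p \<Phi> \<xi> 0"
  by (simp add: gen_eig_def)

lemma gen_eig_diff:
  assumes "gen_eig p \<Phi> \<xi> f" "gen_eig p \<Phi> \<xi> g" shows "gen_eig p \<Phi> \<xi> (f - g)"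
  using gen_eig_add[OF assms(1) gen_eig_const_mult[OF assms(2), of "-1"]]
  by (simp add: mfps_const_minus)

lemma gen_eig_sum: "(\<And>x. x \<in> S \<Longrightarrow> gen_eig p \<Phi> \<xi> (f x)) \<Longrightarrow> gen_eig p \<Phi> \<xi> (sum f S)"
  by (induction S rule: infinite_finite_induct) (auto intro: gen_eig_add gen_eig_0)

lemma gen_eig_mult:
  "gen_eig p \<Phi> \<xi> f \<Longrightarrow> gen_eig p \<Phi> \<xi>' g \<Longrightarrow> gen_eig p \<Phi> (\<lambda>i. \<xi> i * \<xi>' i) (f * g)"
  unfolding gen_eig_def using twist_pow_mult[OF gen_eig_no_const] by meson

lemma gen_eig_first_integral:
  assumes "\<forall>i<p. first_integral (\<Phi> i) f" shows "gen_eig p \<Phi> (\<lambda>_. 1) f"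
  unfolding gen_eig_def
proof (intro allI impI)
  fix N i assume "i < p"
  then have "(twist (\<Phi> i) 1 ^^ 1) f = 0" using assms by (simp add: twist_def first_integral_def)
  then show "\<exists>k. order_ge N ((twist (\<Phi> i) 1 ^^ k) f)" by (metis order_ge_zero)
qed

lemma gen_eig_mpow:
  assumes "\<And>k. gen_eig p \<Phi> (\<lambda>i. \<mu> i $ k) (\<Psi> $ k)"
  shows "gen_eig p \<Phi> (\<lambda>i. vpow (\<mu> i) l) (mpow \<Psi> l)"
proof (induction l rule: mdegree_induct)
  case zero
  have "gen_eig p \<Phi> (\<lambda>_. 1) 1" by (rule gen_eig_first_integral) (simp add: first_integral_def)
  then show ?case by simp
next
  case (axis l k)
  from gen_eig_mult[OF this assms[of k]] show ?case
    by (simp only: mpow_add mpow_axis vpow_add vpow_axis)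
qed

lemma gen_eig_limit:
  assumes "\<And>N. \<exists>g. gen_eig p \<Phi> \<xi> g \<and> order_ge N (f - g)"
  shows "gen_eig p \<Phi> \<xi> f"
  unfolding gen_eig_def
proof (intro allI impI)
  fix N i assume i: "i < p"
  obtain g where g: "gen_eig p \<Phi> \<xi> g" "order_ge N (f - g)" using assms by blast
  then obtain k where "order_ge N ((twist (\<Phi> i) (\<xi> i) ^^ k) g)" using i unfolding gen_eig_def by blast
  with g(2) have "order_ge N ((twist (\<Phi> i) (\<xi> i) ^^ k) (g + (f - g)))"
    unfolding twist_pow_add by (intro order_ge_add[OF _ order_ge_twist_pow[OF gen_eig_no_const[OF i]]])
  then show "\<exists>k. order_ge N ((twist (\<Phi> i) (\<xi> i) ^^ k) f)" by auto
qed

end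

text \<open>The terms of \<open>H\<close> with the right multipliers already give an element of the
  eigenspace, as a limit of combinations of products of the \<open>\<Psi> $ k\<close>. The rest then
  lies there too. On each of its lowest-degree monomials some twisted operator acts by a nonzero
  scalar, so no power of it can kill them, and the rest is 0.\<close>

lemma gen_eig_expansion:
  fixes \<Phi> :: "nat \<Rightarrow> ('a::idom, 'n::finite) fmap"
  assumes \<Phi>1: "\<forall>i<p. diag_linear (\<mu> i) (\<Phi> i)"
    and \<Psi>: "diag_linear (\<chi> k. 1) \<Psi>" "\<And>k. gen_eig p \<Phi> (\<lambda>i. \<mu> i $ k) (\<Psi> $ k)"
    and H: "gen_eig p \<Phi> \<xi> (mfps_subst H \<Psi>)"
    and m: "mfps_nth H m \<noteq> 0" and i: "i < p"
  shows "vpow (\<mu> i) m = \<xi> i"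
proof -
  note \<Phi> = \<Phi>1[rule_format]
  have nc: "no_const (\<Phi> i)" if "i < p" for i using \<Phi>[OF that] by (rule diag_linear_no_const)
  then have ncs: "\<forall>i<p. no_const (\<Phi> i)" by blast
  have nc': "no_const \<Psi>" using \<Psi>(1) by (rule diag_linear_no_const)
  define H' where "H' = Abs_mfps (\<lambda>m. if \<forall>i<p. vpow (\<mu> i) m = \<xi> i then mfps_nth H m else 0)"
  have "gen_eig p \<Phi> \<xi> (mfps_subst H' \<Psi>)"
  proof (rule gen_eig_limit[OF ncs])
    fix N
    let ?t = "\<Sum>l | mdegree l \<le> N. mfps_const (mfps_nth H' l) * mpow mX l"
    have "gen_eig p \<Phi> \<xi> (mfps_const (mfps_nth H' l) * mpow \<Psi> l)" for l
    proof (cases "\<forall>i<p. vpow (\<mu> i) l = \<xi> i")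
      case True
      then have "gen_eig p \<Phi> \<xi> (mpow \<Psi> l)"
        using gen_eig_mpow[OF ncs \<Psi>(2), of l] by (auto elim: gen_eig_cong)
      then show ?thesis by (rule gen_eig_const_mult[OF ncs])
    next
      case False
      then have "mfps_nth H' l = 0" by (auto simp: H'_def)
      then show ?thesis by (simp add: gen_eig_0[OF ncs])
    qed
    then have "gen_eig p \<Phi> \<xi> (mfps_subst ?t \<Psi>)"
      unfolding subst_sum subst_const_mult subst_mpow_mX[OF nc'] by (intro gen_eig_sum[OF ncs])
    moreover have "order_ge N (mfps_subst H' \<Psi> - mfps_subst ?t \<Psi>)"
      using order_ge_subst[OF nc' order_ge_mono[OF mfps_truncate[of N H'], of N]]
      by (simp add: subst_diff)
    ultimately show "\<exists>g. gen_eig p \<Phi> \<xi> g \<and> order_ge N (mfps_subst H' \<Psi> - g)" by blast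
  qed
  from gen_eig_diff[OF ncs H this] have D: "gen_eig p \<Phi> \<xi> (mfps_subst (H - H') \<Psi>)"
    by (simp add: subst_diff)
  have "order_ge N (H - H')" for N
  proof (induction N)
    case (Suc N)
    have "mfps_nth (H - H') m = 0" if m: "mdegree m \<le> N" for m
    proof (rule ccontr)
      assume nz: "mfps_nth (H - H') m \<noteq> 0"
      then obtain i where i: "i < p" "vpow (\<mu> i) m \<noteq> \<xi> i"
        by (auto simp: H'_def split: if_splits)
      obtain k where "order_ge (Suc N) ((twist (\<Phi> i) (\<xi> i) ^^ k) (mfps_subst (H - H') \<Psi>))"
        using D i(1) unfolding gen_eig_def by blast
      then have "mfps_nth ((twist (\<Phi> i) (\<xi> i) ^^ k) (mfps_subst (H - H') \<Psi>)) m = 0"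
        by (rule order_geD) (use m in simp)
      moreover have "order_ge N (mfps_subst (H - H') \<Psi>)" by (rule order_ge_subst[OF nc' Suc])
      ultimately have "(vpow (\<mu> i) m - \<xi> i) ^ k * mfps_nth (mfps_subst (H - H') \<Psi>) m = 0"
        using twist_pow_lowest[OF \<Phi>[OF i(1)] _ m] by simp
      moreover have "mfps_nth (mfps_subst (H - H') \<Psi>) m = mfps_nth (H - H') m"
        using subst_lowest[OF \<Psi>(1) Suc m] by simp
      ultimately show False using nz i(2) by simp
    qed
    then show ?case by (simp add: order_ge_def less_Suc_eq_le)
  qed simp
  then have "H - H' = 0" by (rule order_ge_eq_0)
  then have "mfps_nth H m = mfps_nth H' m" by simp
  with m i show ?thesis by (auto simp: H'_def split: if_splits)
qed

text \<open>By commutation, composing \<open>\<Psi> $ k\<close> with \<open>\<Phi> i\<close> stays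
  in the eigenspace of \<open>\<Psi> $ k\<close>. Its expansion in \<Psi> is the \<open>k\<close>-th
  component of the conjugated map and so has resonant terms only. First integrals belong to the
  joint eigenvalue 1.\<close>

theorem poincare_dulac:
  fixes \<Phi> :: "nat \<Rightarrow> ('a::field, 'n::finite) fmap"
  assumes K: "is_subfield K"
    and \<Phi>: "\<And>i. i < p \<Longrightarrow> diag_linear (\<mu> i) (\<Phi> i)" "\<And>i k. i < p \<Longrightarrow> coeffs_in K (\<Phi> i $ k)"
    and comm: "\<And>i j. i < p \<Longrightarrow> j < p \<Longrightarrow> fmap_comp (\<Phi> i) (\<Phi> j) = fmap_comp (\<Phi> j) (\<Phi> i)"
    and \<mu>: "\<And>i k. i < p \<Longrightarrow> \<mu> i $ k \<in> K"
  obtains \<Psi> \<Phi>' where "diag_linear (\<chi> k. 1) \<Psi>" "\<And>k. coeffs_in K (\<Psi> $ k)"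
    "\<And>i. i < p \<Longrightarrow> fmap_comp \<Psi> (\<Phi> i) = fmap_comp (\<Phi>' i) \<Psi>"
    "\<And>i. i < p \<Longrightarrow> diag_linear (\<mu> i) (\<Phi>' i)" "\<And>i k. i < p \<Longrightarrow> coeffs_in K (\<Phi>' i $ k)"
    "\<And>i j k m. i < p \<Longrightarrow> j < p \<Longrightarrow> mfps_nth (\<Phi>' i $ k) m \<noteq> 0 \<Longrightarrow> vpow (\<mu> j) m = \<mu> j $ k"
    "\<And>F i m. \<forall>i<p. first_integral (\<Phi> i) (mfps_subst F \<Psi>) \<Longrightarrow> i < p \<Longrightarrow>
       mfps_nth F m \<noteq> 0 \<Longrightarrow> vpow (\<mu> i) m = 1"
proof -
  have nc: "no_const (\<Phi> i)" if "i < p" for i using \<Phi>(1)[OF that] by (rule diag_linear_no_const)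
  then have ncs: "\<forall>i<p. no_const (\<Phi> i)" by blast
  have \<Phi>1: "\<forall>i<p. diag_linear (\<mu> i) (\<Phi> i)" using \<Phi>(1) by blast
  have "\<exists>f. coeffs_in K f \<and> order_ge 2 (f - mfps_X k) \<and>
    (\<forall>N\<ge>2. \<forall>i<p. order_ge N ((twist (\<Phi> i) (\<mu> i $ k) ^^ N) f))" for k
    by (rule ex_generalized_eigenvector[OF K]) (auto intro: \<Phi> comm \<mu>)
  then obtain psi where psi: "\<And>k. coeffs_in K (psi k)" "\<And>k. order_ge 2 (psi k - mfps_X k)"
    "\<And>k N i. N \<ge> 2 \<Longrightarrow> i < p \<Longrightarrow> order_ge N ((twist (\<Phi> i) (\<mu> i $ k) ^^ N) (psi k))" by metis
  define \<Psi> where "\<Psi> = (\<chi> k. psi k)"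
  have \<Psi>: "diag_linear (\<chi> k. 1) \<Psi>"
    by (rule diag_linearI) (simp add: \<Psi>_def psi)
  have \<Psi>K: "\<And>k. coeffs_in K (\<Psi> $ k)" by (simp add: \<Psi>_def psi)
  have eig: "gen_eig p \<Phi> (\<lambda>i. \<mu> i $ k) (\<Psi> $ k)" for k
    unfolding gen_eig_def
  proof (intro allI impI)
    fix N i assume "i < p"
    from order_ge_mono[OF psi(3)[OF _ this, of "N + 2" k], of N]
    show "\<exists>ka. order_ge N ((twist (\<Phi> i) (\<mu> i $ k) ^^ ka) (\<Psi> $ k))"
      by (auto simp: \<Psi>_def simp del: funpow.simps)
  qed
  \<comment> \<open>\<open>H i k\<close> is the \<open>k\<close>-th component of the conjugate of
    \<open>\<Phi> i\<close> by \<Psi>, found by solving for it instead of composing with an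
    inverse.\<close>
  have "\<exists>H. coeffs_in K H \<and> mfps_subst H \<Psi> = mfps_subst (\<Psi> $ k) (\<Phi> i)" if "i < p" for i k
    by (rule subst_surj[OF K \<Psi> \<Psi>K, of "mfps_subst (\<Psi> $ k) (\<Phi> i)"])
      (use that in \<open>auto intro!: coeffs_in_subst[OF K] \<Phi> \<Psi>K\<close>)
  then obtain H where H: "\<And>i k. i < p \<Longrightarrow> coeffs_in K (H i k)"
    "\<And>i k. i < p \<Longrightarrow> mfps_subst (H i k) \<Psi> = mfps_subst (\<Psi> $ k) (\<Phi> i)" by metis
  define \<Phi>' where "\<Phi>' i = (\<chi> k. H i k)" for i
  show ?thesis
  proof (rule that[OF \<Psi> \<Psi>K])
    show "fmap_comp \<Psi> (\<Phi> i) = fmap_comp (\<Phi>' i) \<Psi>" if "i < p" for i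
      using H(2)[OF that] by (simp add: fmap_comp_def \<Phi>'_def vec_eq_iff)
    show "coeffs_in K (\<Phi>' i $ k)" if "i < p" for i k
      using H(1)[OF that] by (simp add: \<Phi>'_def)
    show "diag_linear (\<mu> i) (\<Phi>' i)" if i: "i < p" for i
    proof (rule diag_linearI)
      fix k
      have 0: "mfps_nth (H i k) 0 = 0"
        using subst_lowest[OF \<Psi>, of 0 "H i k" 0] H(2)[OF i]
          no_const_subst[OF nc[OF i], of "\<Psi> $ k"] diag_linear_no_const[OF \<Psi>] by simp
      have o: "order_ge 1 (H i k)" "order_ge 1 (\<Psi> $ k)"
        unfolding order_ge_1 using 0 diag_linear_no_const[OF \<Psi>] by auto
      have "mfps_nth (H i k) (axis j 1) = \<mu> i $ j * mfps_nth (\<Psi> $ k) (axis j 1)" for j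
        using subst_lowest[OF \<Psi> o(1), of "axis j 1"] H(2)[OF i]
          subst_lowest[OF \<Phi>(1)[OF i] o(2), of "axis j 1"]
        unfolding vpow_axis mdegree_axis by simp
      moreover have "mfps_nth (\<Psi> $ k) (axis j 1) = (if k = j then 1 else 0)" for j
      proof -
        have "linear_part \<Psi> $ k $ j = diag_matrix (\<chi> k. 1) $ k $ j"
          using \<Psi> by (simp add: diag_linear_def)
        then show ?thesis by (simp add: linear_part_def diag_matrix_def)
      qed
      ultimately show "order_ge 2 (\<Phi>' i $ k - mfps_const (\<mu> i $ k) * mfps_X k)"
        using 0 by (intro order_ge_2I) (auto simp: \<Phi>'_def mfps_nth_X axis_eq_iff[unfolded One_nat_def])
    qed
    show "vpow (\<mu> j) m = \<mu> j $ k" if ij: "i < p" "j < p" "mfps_nth (\<Phi>' i $ k) m \<noteq> 0" for i j k m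
    proof -
      have "gen_eig p \<Phi> (\<lambda>i. \<mu> i $ k) (mfps_subst (\<Psi> $ k) (\<Phi> i))"
        unfolding gen_eig_def
      proof (intro allI impI)
        fix N a assume a: "a < p"
        then obtain l where "order_ge N ((twist (\<Phi> a) (\<mu> a $ k) ^^ l) (\<Psi> $ k))"
          using eig unfolding gen_eig_def by blast
        then have o: "order_ge N (mfps_subst ((twist (\<Phi> a) (\<mu> a $ k) ^^ l) (\<Psi> $ k)) (\<Phi> i))"
          by (rule order_ge_subst[OF nc[OF ij(1)]])
        \<comment> \<open>Commutation of twisted operators with scalar 0 on one side, where
          \<open>twist (\<Phi> i) 0\<close> is composition with \<open>\<Phi> i\<close>.\<close>
        have "mfps_subst (twist (\<Phi> a) c f) (\<Phi> i) = twist (\<Phi> a) c (mfps_subst f (\<Phi> i))" for c f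
          using twist_commute[OF nc[OF ij(1)] nc[OF a] comm[OF ij(1) a], of 0 c f]
          by (simp add: twist_def)
        then have "mfps_subst ((twist (\<Phi> a) c ^^ l) f) (\<Phi> i) = (twist (\<Phi> a) c ^^ l) (mfps_subst f (\<Phi> i))" for c f
          by (induction l) simp_all
        with o show "\<exists>l. order_ge N ((twist (\<Phi> a) (\<mu> a $ k) ^^ l) (mfps_subst (\<Psi> $ k) (\<Phi> i)))"
          by auto
      qed
      then have "gen_eig p \<Phi> (\<lambda>i. \<mu> i $ k) (mfps_subst (H i k) \<Psi>)" by (simp add: H(2)[OF ij(1)])
      from gen_eig_expansion[OF \<Phi>1 \<Psi> eig this _ ij(2)] ij(3) show ?thesis by (simp add: \<Phi>'_def)
    qed
    show "vpow (\<mu> i) m = 1"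
      if "\<forall>i<p. first_integral (\<Phi> i) (mfps_subst F \<Psi>)" "i < p" "mfps_nth F m \<noteq> 0" for F i m
      using gen_eig_expansion[OF \<Phi>1 \<Psi> eig gen_eig_first_integral[OF ncs that(1)] that(3,2)] by simp
  qed
qed

instance mfps :: ("{comm_ring_1, ring_char_0}", finite) ring_char_0
proof
  show "inj (of_nat :: nat \<Rightarrow> ('a, 'b) mfps)"
  proof (rule injI)
    fix a b assume "(of_nat a :: ('a, 'b) mfps) = of_nat b"
    then have "mfps_nth (mfps_const (of_nat a) :: ('a, 'b) mfps) 0 = mfps_nth (mfps_const (of_nat b) :: ('a, 'b) mfps) 0"
      by (simp add: mfps_const_of_nat)
    then show "a = b" by (simp add: mfps_nth_const)
  qed
qed

section \<open>Derivations\<close>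

text \<open>The Euler operator of \<open>x_k\<close> is diagonal on monomials. As multiplication by
  \<open>mfps_X k\<close> is injective, identities for \<open>mfps_pderiv\<close> can be checked on
  it without index shifts.\<close>

lemma mfps_nth_X_pderiv [simp]: "mfps_nth (mfps_X k * mfps_pderiv k f) m = of_nat (m $ k) * mfps_nth f m"
proof (cases "m $ k = 0")
  case False
  note eq = vec_minus_axis[OF False]
  have "(m - axis k 1) $ k + 1 = m $ k" using False by (simp add: axis_def)
  then show ?thesis
    using mfps_nth_X_mult_add[of k "mfps_pderiv k f" "m - axis k 1"]
    unfolding eq by (simp only: mfps_pderiv_def mfps_nth_Abs eq)
qed (simp add: mfps_nth_X_mult_eq_0)

lemma pderiv_eqI:
  "(\<And>m. of_nat (m $ k) * mfps_nth f m = mfps_nth (mfps_X k * g) m) \<Longrightarrow> mfps_pderiv k f = g"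
  by (rule mfps_X_mult_cancel[of k]) (simp add: mfps_eq_iff)

lemma pderiv_add: "mfps_pderiv k (f + g) = mfps_pderiv k f + mfps_pderiv k g"
  by (simp add: mfps_eq_iff mfps_pderiv_def algebra_simps)

lemma pderiv_const: "mfps_pderiv k (mfps_const c) = 0"
  by (rule pderiv_eqI) (simp add: mfps_nth_const)

lemma pderiv_X: "mfps_pderiv k (mfps_X j) = (if j = k then 1 else 0)"
  by (rule pderiv_eqI) (simp add: mfps_nth_X, auto simp: axis_def)

lemma pderiv_mult: "mfps_pderiv k (f * g) = mfps_pderiv k f * g + f * mfps_pderiv k g"
proof (rule pderiv_eqI)
  fix m :: "nat ^ 'b"
  have "of_nat (m $ k) * mfps_nth (f * g) m =
      (\<Sum>(a, b)\<in>{(a, b). a + b = m}. (of_nat (a $ k) + of_nat (b $ k)) * (mfps_nth f a * mfps_nth g b))"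
    unfolding mfps_nth_mult sum_distrib_left by (intro sum.cong) auto
  also have "\<dots> = mfps_nth ((mfps_X k * mfps_pderiv k f) * g + f * (mfps_X k * mfps_pderiv k g)) m"
    unfolding mfps_nth_add mfps_nth_mult[of _ g] mfps_nth_mult[of f "mfps_X k * mfps_pderiv k g"] mfps_nth_X_pderiv
    by (simp flip: sum.distrib add: case_prod_unfold algebra_simps)
  finally show "of_nat (m $ k) * mfps_nth (f * g) m =
      mfps_nth (mfps_X k * (mfps_pderiv k f * g + f * mfps_pderiv k g)) m"
    by (simp add: algebra_simps)
qed

lemma order_ge_pderiv: "order_ge (Suc N) f \<Longrightarrow> order_ge N (mfps_pderiv k f)"
  by (simp add: order_ge_def mfps_pderiv_def)

text \<open>The right-hand side is a derivation along \<Psi> with the same values on constants and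
  variables; both sides agree on monomials by the product rule and everywhere by continuity. This
  gives the chain rule for partial derivatives and, with \<open>mX\<close> for \<Psi>, shows that
  logarithms are vector fields.\<close>

lemma derivation_along_subst:
  fixes \<Psi> :: "('a::comm_ring_1, 'n::finite) fmap"
  assumes nc: "no_const \<Psi>"
    and add: "\<And>f g. T (f + g) = T f + T g"
    and mult: "\<And>f g. T (f * g) = T f * mfps_subst g \<Psi> + mfps_subst f \<Psi> * T g"
    and const: "\<And>c. T (mfps_const c) = 0"
    and cont: "\<And>N f. order_ge (Suc N) f \<Longrightarrow> order_ge N (T f)"
  shows "T f = (\<Sum>k\<in>UNIV. mfps_subst (mfps_pderiv k f) \<Psi> * T (mfps_X k))"
proof -
  define S where "S f = (\<Sum>k\<in>UNIV. mfps_subst (mfps_pderiv k f) \<Psi> * T (mfps_X k))" for f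
  define R where "R f = T f - S f" for f
  have S_mult: "S (f * g) = S f * mfps_subst g \<Psi> + mfps_subst f \<Psi> * S g" for f g
    by (simp add: S_def pderiv_mult subst_add subst_mult[OF nc] algebra_simps sum.distrib sum_distrib_left)
  have R_mult: "R (f * g) = R f * mfps_subst g \<Psi> + mfps_subst f \<Psi> * R g" for f g
    by (simp add: R_def mult S_mult algebra_simps)
  have R_const: "R (mfps_const c) = 0" for c
    by (simp add: R_def S_def const pderiv_const)
  have "S (mfps_X k) = (\<Sum>j\<in>UNIV. if j = k then T (mfps_X k) else 0)" for k
    unfolding S_def by (intro sum.cong) (auto simp: pderiv_X)
  then have R_X: "R (mfps_X k) = 0" for k
    by (simp add: R_def)
  have R_mX: "R (mpow mX l) = 0" for l
  proof (induction l rule: mdegree_induct)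
    case zero
    then show ?case using R_const[of 1] by simp
  next
    case (axis l k)
    then show ?case unfolding mpow_add mpow_axis by (simp add: R_mult R_X)
  qed
  have "R f = 0"
  proof (rule continuous_additive_eq_0[of R])
    show "R (f + g) = R f + R g" for f g
      by (simp add: R_def S_def add pderiv_add subst_add algebra_simps sum.distrib)
    show "order_ge N (R f)" if "order_ge (Suc N) f" for N f
      unfolding R_def S_def
      by (intro order_ge_diff cont that order_ge_sum order_ge_mult_right order_ge_subst nc order_ge_pderiv)
    show "R (mfps_const c * mpow mX l) = 0" for c l
      by (simp add: R_mult R_const R_mX)
  qed
  then show ?thesis by (simp add: R_def S_def)
qed

lemma pderiv_subst:
  assumes nc: "no_const \<Psi>"
  shows "mfps_pderiv j (mfps_subst f \<Psi>) =
    (\<Sum>k\<in>UNIV. mfps_subst (mfps_pderiv k f) \<Psi> * mfps_pderiv j (\<Psi> $ k))"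
  using derivation_along_subst[OF nc, of "\<lambda>f. mfps_pderiv j (mfps_subst f \<Psi>)" f]
  by (simp add: subst_add pderiv_add subst_mult[OF nc] pderiv_mult pderiv_const nc
      order_ge_pderiv order_ge_subst)

section \<open>The logarithm of a map tangent to the identity\<close>

lemma order_ge_twist_tangent:
  assumes G: "diag_linear (\<chi> k. 1) G" and f: "order_ge N f"
  shows "order_ge (Suc N) (twist G 1 f)"
  unfolding order_ge_def
proof (intro allI impI)
  fix m :: "nat ^ 'b" assume "mdegree m < Suc N"
  then show "mfps_nth (twist G 1 f) m = 0"
    using subst_lowest[OF G f, of m] by (simp add: twist_def)
qed

lemma order_ge_twist_pow_tangent:
  assumes G: "diag_linear (\<chi> k. 1) G"
  shows "order_ge k ((twist G 1 ^^ k) f)"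
  by (induction k) (simp_all add: order_ge_twist_tangent[OF G])

text \<open>The binomial theorem for \<open>1 + \<Delta>\<close> with \<Delta> =
  \<open>twist G 1\<close>: as \<Delta> raises the order, powers beyond \<open>D\<close> do not
  reach down to degree \<open>D\<close>.\<close>

lemma subst_iterate_binomial:
  assumes G: "diag_linear (\<chi> k. 1) G" and m: "mdegree m \<le> D"
  shows "mfps_nth (((\<lambda>f. mfps_subst f G) ^^ t) f) m =
    (\<Sum>k\<le>D. of_nat (t choose k) * mfps_nth ((twist G 1 ^^ k) f) m)"
proof (induction t arbitrary: f)
  case 0
  have "(\<Sum>k\<le>D. of_nat (0 choose k) * mfps_nth ((twist G 1 ^^ k) f) m) =
      (\<Sum>k\<in>{0}. of_nat (0 choose k) * mfps_nth ((twist G 1 ^^ k) f) m)"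
    by (rule sum.mono_neutral_right) (auto simp: binomial_eq_0)
  then show ?case by simp
next
  case (Suc t)
  let ?\<Delta> = "\<lambda>k. mfps_nth ((twist G 1 ^^ k) f) m"
  have top: "?\<Delta> (Suc D) = 0"
    by (rule order_geD[OF order_ge_twist_pow_tangent[OF G]]) (use m in simp)
  have lin: "((\<lambda>f. mfps_subst f G) ^^ t) (g + h) =
      ((\<lambda>f. mfps_subst f G) ^^ t) g + ((\<lambda>f. mfps_subst f G) ^^ t) h" for g h
    by (induction t) (simp_all add: subst_add)
  have "((\<lambda>f. mfps_subst f G) ^^ Suc t) f = ((\<lambda>f. mfps_subst f G) ^^ t) (f + twist G 1 f)"
    by (simp add: funpow_swap1[of "\<lambda>f. mfps_subst f G"] twist_def)
  then have "mfps_nth (((\<lambda>f. mfps_subst f G) ^^ Suc t) f) m =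
      (\<Sum>k\<le>D. of_nat (t choose k) * ?\<Delta> k) + (\<Sum>k\<le>D. of_nat (t choose k) * ?\<Delta> (Suc k))"
    by (simp only: lin mfps_nth_add Suc) (simp add: funpow_swap1)
  also have "(\<Sum>k\<le>D. of_nat (t choose k) * ?\<Delta> k) = (\<Sum>k\<le>Suc D. of_nat (t choose k) * ?\<Delta> k)"
    using top by simp
  also have "\<dots> = ?\<Delta> 0 + (\<Sum>k\<le>D. of_nat (t choose Suc k) * ?\<Delta> (Suc k))"
    by (subst sum.atMost_Suc_shift) simp
  also have "?\<Delta> 0 + (\<Sum>k\<le>D. of_nat (t choose Suc k) * ?\<Delta> (Suc k)) + (\<Sum>k\<le>D. of_nat (t choose k) * ?\<Delta> (Suc k)) =
      ?\<Delta> 0 + (\<Sum>k\<le>D. of_nat (Suc t choose Suc k) * ?\<Delta> (Suc k))"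
    by (simp add: sum.distrib distrib_right del: funpow.simps)
  also have "\<dots> = (\<Sum>k\<le>Suc D. of_nat (Suc t choose k) * ?\<Delta> k)"
    by (subst sum.atMost_Suc_shift) simp
  also have "\<dots> = (\<Sum>k\<le>D. of_nat (Suc t choose k) * ?\<Delta> k)"
    using top by simp
  finally show ?case .
qed

lemma binomial_poly: "\<exists>P :: 'a::field_char_0 poly. \<forall>t. poly P (of_nat t) = of_nat (t choose k)"
proof (induction k)
  case 0
  have "\<forall>t. poly [:1 :: 'a:] (of_nat t) = of_nat (t choose 0)" by simp
  then show ?case by blast
next
  case (Suc k)
  then obtain P :: "'a poly" where P: "\<And>t. poly P (of_nat t) = of_nat (t choose k)" by blast
  have "of_nat (Suc k) * of_nat (t choose Suc k) = (of_nat t - of_nat k) * (of_nat (t choose k) :: 'a)" for t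
    using gbinomial_mult_1[of "of_nat t :: 'a" k] by (simp add: binomial_gbinomial algebra_simps del: of_nat_Suc)
  then have "poly (smult (inverse (of_nat (Suc k))) ([:- of_nat k, 1:] * P)) (of_nat t) = of_nat (t choose Suc k)" for t
    by (simp add: P field_simps del: of_nat_Suc)
  then show ?case by blast
qed

lemma poly_eq_on_nats:
  fixes P Q :: "'a::field_char_0 poly"
  assumes "\<And>t::nat. poly P (of_nat t) = poly Q (of_nat t)" shows "P = Q"
proof (rule ccontr)
  assume "P \<noteq> Q"
  then have "finite {x. poly (P - Q) x = 0}" by (intro poly_roots_finite) simp
  moreover have "range (of_nat :: nat \<Rightarrow> 'a) \<subseteq> {x. poly (P - Q) x = 0}" using assms by auto
  ultimately have "finite (range (of_nat :: nat \<Rightarrow> 'a))" by (rule finite_subset[rotated])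
  then show False using range_inj_infinite[OF inj_of_nat] by blast
qed

text \<open>The coefficients of the iterates of \<open>f \<mapsto> f \<circ> G\<close> are polynomials in the number of
  iterations. Their linear coefficients give the logarithm of this operator, which is a derivation.\<close>

definition flow_coeff :: "('a::field_char_0, 'n::finite) fmap \<Rightarrow> ('a, 'n) mfps \<Rightarrow> nat ^ 'n \<Rightarrow> 'a poly" where
  "flow_coeff G f m = (SOME P. \<forall>t. poly P (of_nat t) = mfps_nth (((\<lambda>f. mfps_subst f G) ^^ t) f) m)"

definition mfps_log :: "('a::field_char_0, 'n::finite) fmap \<Rightarrow> ('a, 'n) mfps \<Rightarrow> ('a, 'n) mfps" where
  "mfps_log G f = Abs_mfps (\<lambda>m. coeff (flow_coeff G f m) 1)"

context
  fixes G :: "('a::field_char_0, 'n::finite) fmap"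
  assumes G: "diag_linear (\<chi> k. 1) G"
begin

abbreviation (input) iter where "iter t f \<equiv> ((\<lambda>f. mfps_subst f G) ^^ t) f"

lemma tangent_no_const: "no_const G"
  using G by (rule diag_linear_no_const)

lemma poly_flow_coeff: "poly (flow_coeff G f m) (of_nat t) = mfps_nth (iter t f) m"
proof -
  obtain B :: "nat \<Rightarrow> 'a poly" where B: "\<And>k t. poly (B k) (of_nat t) = of_nat (t choose k)"
    using binomial_poly by metis
  have "poly (\<Sum>k\<le>mdegree m. smult (mfps_nth ((twist G 1 ^^ k) f) m) (B k)) (of_nat t) = mfps_nth (iter t f) m" for t
    unfolding subst_iterate_binomial[OF G order_refl] by (simp add: poly_sum B mult.commute)
  then have "\<exists>P. \<forall>t. poly P (of_nat t) = mfps_nth (iter t f) m" by blast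
  from someI_ex[OF this] show ?thesis unfolding flow_coeff_def by blast
qed

lemma flow_coeff_eqI: "(\<And>t. poly P (of_nat t) = mfps_nth (iter t f) m) \<Longrightarrow> flow_coeff G f m = P"
  by (rule poly_eq_on_nats) (simp add: poly_flow_coeff)

lemma coeff_0_flow_coeff: "coeff (flow_coeff G f m) 0 = mfps_nth f m"
  using poly_flow_coeff[of f m 0] by (simp add: poly_0_coeff_0)

lemma iter_add: "iter t (f + g) = iter t f + iter t g"
  by (induction t) (simp_all add: subst_add)

lemma iter_mult: "iter t (f * g) = iter t f * iter t g"
  by (induction t) (simp_all add: subst_mult[OF tangent_no_const])

lemma log_add: "mfps_log G (f + g) = mfps_log G f + mfps_log G g"
proof -
  have "flow_coeff G (f + g) m = flow_coeff G f m + flow_coeff G g m" for m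
    by (rule flow_coeff_eqI) (simp add: poly_flow_coeff iter_add)
  then show ?thesis by (simp add: mfps_log_def mfps_eq_iff)
qed

text \<open>Every iterate is multiplicative, so the interpolating polynomials convolve like the
  coefficients. Their constant terms are the coefficients of \<open>f\<close> and \<open>g\<close>,
  and the linear term of each product is the Leibniz rule.\<close>

lemma log_mult: "mfps_log G (f * g) = mfps_log G f * g + f * mfps_log G g"
  unfolding mfps_eq_iff
proof
  fix m
  have "flow_coeff G (f * g) m = (\<Sum>(a, b)\<in>{(a, b). a + b = m}. flow_coeff G f a * flow_coeff G g b)"
    by (rule flow_coeff_eqI) (simp add: poly_flow_coeff iter_mult mfps_nth_mult poly_sum case_prod_unfold)
  then have "mfps_nth (mfps_log G (f * g)) m =
      (\<Sum>(a, b)\<in>{(a, b). a + b = m}. coeff (flow_coeff G f a * flow_coeff G g b) 1)"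
    by (simp add: mfps_log_def coeff_sum case_prod_unfold)
  also have "\<dots> = (\<Sum>(a, b)\<in>{(a, b). a + b = m}. mfps_nth (mfps_log G f) a * mfps_nth g b +
      mfps_nth f a * mfps_nth (mfps_log G g) b)"
    by (intro sum.cong) (auto simp: coeff_mult coeff_0_flow_coeff mfps_log_def)
  also have "\<dots> = mfps_nth (mfps_log G f * g + f * mfps_log G g) m"
    by (simp add: mfps_nth_mult sum.distrib case_prod_unfold)
  finally show "mfps_nth (mfps_log G (f * g)) m = mfps_nth (mfps_log G f * g + f * mfps_log G g) m" .
qed

lemma log_invariant:
  assumes "mfps_subst f G = f" shows "mfps_log G f = 0"
proof -
  have "iter t f = f" for t by (induction t) (simp_all add: assms)
  then have "flow_coeff G f m = [:mfps_nth f m:]" for m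
    by (intro flow_coeff_eqI) simp
  then show ?thesis by (simp add: mfps_log_def mfps_eq_iff)
qed

lemma order_ge_log:
  assumes "order_ge N f" shows "order_ge N (mfps_log G f)"
  unfolding order_ge_def
proof (intro allI impI)
  fix m :: "nat ^ 'n" assume m: "mdegree m < N"
  have "order_ge N (iter t f)" for t
    by (induction t) (simp_all add: assms order_ge_subst[OF tangent_no_const])
  then have "flow_coeff G f m = 0"
    by (intro flow_coeff_eqI) (simp add: order_geD[OF _ m])
  then show "mfps_nth (mfps_log G f) m = 0" by (simp add: mfps_log_def)
qed

lemma log_chain: "mfps_log G f = (\<Sum>k\<in>UNIV. mfps_pderiv k f * mfps_log G (mfps_X k))"
  using derivation_along_subst[of mX "mfps_log G" f, OF no_const_mX]
  by (simp add: log_add log_mult log_invariant order_ge_log order_ge_mono[of "Suc _"])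

text \<open>Modulo an invariant subspace \<open>L\<close> containing \<open>\<Delta>\<^sup>2 f\<close>, where \<open>\<Delta> f = f \<circ> G - f\<close>, the
  \<open>t\<close>-th iterate is \<open>f + t \<Delta> f\<close>.\<close>

lemma log_nth_modulo:
  assumes L: "L 0" "\<And>f g. L f \<Longrightarrow> L g \<Longrightarrow> L (f + g)" "\<And>c f. L f \<Longrightarrow> L (mfps_const c * f)"
      "\<And>f. L f \<Longrightarrow> L (mfps_subst f G)"
    and f: "L (twist G 1 (twist G 1 f))"
    and m: "\<And>f. L f \<Longrightarrow> mfps_nth f m = 0"
  shows "mfps_nth (mfps_log G f) m = mfps_nth (twist G 1 f) m"
proof -
  let ?d = "twist G 1 f"
  have "\<exists>e. L e \<and> iter t f = f + mfps_const (of_nat t) * ?d + e" for t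
  proof (induction t)
    case 0
    show ?case using L(1) by (intro exI[of _ 0]) simp
  next
    case (Suc t)
    then obtain e where e: "L e" "iter t f = f + mfps_const (of_nat t) * ?d + e" by blast
    have 1: "mfps_subst f G = f + ?d" by (simp add: twist_def)
    have 2: "mfps_subst ?d G = ?d + twist G 1 ?d" by (simp add: twist_def[of G 1 ?d])
    have "iter (Suc t) f = f + mfps_const (of_nat (Suc t)) * ?d +
        (mfps_const (of_nat t) * twist G 1 ?d + mfps_subst e G)"
      by (simp only: funpow.simps comp_def e(2) subst_add subst_const_mult 1 2)
        (simp add: mfps_const_add algebra_simps)
    moreover have "L (mfps_const (of_nat t) * twist G 1 ?d + mfps_subst e G)"
      by (intro L e f)
    ultimately show ?case by blast
  qed
  then have "mfps_nth (iter t f) m = mfps_nth f m + of_nat t * mfps_nth ?d m" for t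
  proof -
    assume *: "\<And>t. \<exists>e. L e \<and> iter t f = f + mfps_const (of_nat t) * ?d + e"
    obtain e where "L e" and e: "iter t f = f + mfps_const (of_nat t) * ?d + e" using *[of t] by blast
    then show ?thesis unfolding e by (simp add: m)
  qed
  then have "flow_coeff G f m = [:mfps_nth f m, mfps_nth ?d m:]"
    by (intro flow_coeff_eqI) simp
  then show ?thesis by (simp add: mfps_log_def)
qed

text \<open>If \<open>twist G 1 f\<close> has order \<open>N\<close>, its image under
  \<open>twist G 1\<close> has order \<open>N + 1\<close>, so up to degree \<open>N\<close> it
  agrees with the logarithm. A vanishing logarithm thus raises the order step by step.\<close>

lemma log_eq_0_imp_invariant:
  assumes "mfps_log G f = 0" shows "mfps_subst f G = f"
proof -
  have "order_ge N (twist G 1 f)" for N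
  proof (induction N)
    case (Suc N)
    have "mfps_nth (twist G 1 f) m = 0" if "mdegree m \<le> N" for m
    proof -
      have "mfps_nth (mfps_log G f) m = mfps_nth (twist G 1 f) m"
        by (rule log_nth_modulo[of "order_ge (Suc N)"])
          (use that in \<open>auto intro: order_ge_add order_ge_const_mult order_ge_subst[OF tangent_no_const]
            order_ge_twist_tangent[OF G Suc] order_geD\<close>)
      then show ?thesis using assms by simp
    qed
    then show ?case by (simp add: order_ge_def less_Suc_eq_le)
  qed simp
  then have "twist G 1 f = 0" by (rule order_ge_eq_0)
  then show ?thesis by (simp add: twist_def)
qed

end

section \<open>Functional independence and rank\<close>

text \<open>The expansion behind the Cauchy-Binet formula for a matrix product through fewer than
  \<open>q\<close> indices: each choice \<open>g\<close> of an index per row repeats an index, so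
  \<open>A g\<close> is a determinant with two equal rows.\<close>

lemma alternating_sum_rank_deficient:
  fixes J :: "nat \<Rightarrow> nat \<Rightarrow> 'a::{idom, ring_char_0}"
  assumes S: "finite S" "card S < q"
    and J: "\<And>j l. j < q \<Longrightarrow> l < q \<Longrightarrow> J j l = (\<Sum>c\<in>S. b j c * C c l)"
  shows "(\<Sum>\<sigma> | \<sigma> permutes {..<q}. of_int (sign \<sigma>) * (\<Prod>j<q. J j (\<sigma> j))) = 0"
proof -
  let ?P = "{\<sigma>. \<sigma> permutes {..<q}}"
  let ?F = "{..<q} \<rightarrow>\<^sub>E S"
  define A where "A g = (\<Sum>\<sigma>\<in>?P. of_int (sign \<sigma>) * (\<Prod>j<q. C (g j) (\<sigma> j)))" for g
  have A0: "A g = 0" if g: "g \<in> ?F" for g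
  proof -
    have "\<not> inj_on g {..<q}"
      using card_inj_on_le[of g "{..<q}" S] g S by auto
    then obtain j1 j2 where j: "j1 < q" "j2 < q" "j1 \<noteq> j2" "g j1 = g j2"
      by (auto simp: inj_on_def)
    \<comment> \<open>Exchanging the two equal rows reverses the sign, whence
      \<open>2 * A g = 0\<close>; characteristic zero finishes.\<close>
    let ?\<tau> = "Transposition.transpose j1 j2"
    have \<tau>: "?\<tau> permutes {..<q}" using j by (intro permutes_swap_id) auto
    have g\<tau>: "g (?\<tau> j) = g j" for j using j by (auto simp: Transposition.transpose_def)
    have "A g = (\<Sum>\<sigma>\<in>?P. of_int (sign (\<sigma> \<circ> ?\<tau>)) * (\<Prod>j<q. C (g j) ((\<sigma> \<circ> ?\<tau>) j)))"
      unfolding A_def by (rule sum_permutations_compose_right[OF \<tau>])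
    also have "\<dots> = (\<Sum>\<sigma>\<in>?P. - (of_int (sign \<sigma>) * (\<Prod>j<q. C (g j) (\<sigma> j))))"
    proof (rule sum.cong[OF refl])
      fix \<sigma> assume "\<sigma> \<in> ?P"
      then have p: "permutation \<sigma>" "permutation ?\<tau>"
        using \<tau> by (auto intro: permutes_imp_permutation[of "{..<q}"])
      have "(\<Prod>j<q. C (g j) (\<sigma> j)) = (\<Prod>j<q. C (g (?\<tau> j)) (\<sigma> (?\<tau> j)))"
        using prod.permute[OF \<tau>, of "\<lambda>j. C (g j) (\<sigma> j)"] by (simp add: comp_def)
      then show "of_int (sign (\<sigma> \<circ> ?\<tau>)) * (\<Prod>j<q. C (g j) ((\<sigma> \<circ> ?\<tau>) j)) =
          - (of_int (sign \<sigma>) * (\<Prod>j<q. C (g j) (\<sigma> j)))"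
        using j by (simp add: sign_compose[OF p] sign_swap_id g\<tau>)
    qed
    also have "\<dots> = - A g" by (simp add: A_def sum_negf)
    finally have "2 * A g = 0" by simp
    then show ?thesis by simp
  qed
  have "(\<Sum>\<sigma>\<in>?P. of_int (sign \<sigma>) * (\<Prod>j<q. J j (\<sigma> j))) =
      (\<Sum>\<sigma>\<in>?P. of_int (sign \<sigma>) * (\<Sum>g\<in>?F. (\<Prod>j<q. b j (g j) * C (g j) (\<sigma> j))))"
  proof (rule sum.cong[OF refl])
    fix \<sigma> assume "\<sigma> \<in> ?P"
    then have "\<sigma> j < q" if "j < q" for j using that permutes_in_image[of \<sigma> "{..<q}" j] by simp
    then have "(\<Prod>j<q. J j (\<sigma> j)) = (\<Prod>j<q. \<Sum>c\<in>S. b j c * C c (\<sigma> j))"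
      by (intro prod.cong) (auto simp: J)
    also have "\<dots> = (\<Sum>g\<in>?F. \<Prod>j<q. b j (g j) * C (g j) (\<sigma> j))"
      by (rule prod_sum_PiE) (use S in auto)
    finally show "of_int (sign \<sigma>) * (\<Prod>j<q. J j (\<sigma> j)) =
      of_int (sign \<sigma>) * (\<Sum>g\<in>?F. (\<Prod>j<q. b j (g j) * C (g j) (\<sigma> j)))" by simp
  qed
  also have "\<dots> = (\<Sum>g\<in>?F. \<Sum>\<sigma>\<in>?P. of_int (sign \<sigma>) * (\<Prod>j<q. b j (g j) * C (g j) (\<sigma> j)))"
    unfolding sum_distrib_left by (rule sum.swap)
  also have "\<dots> = (\<Sum>g\<in>?F. (\<Prod>j<q. b j (g j)) * A g)"
    unfolding A_def sum_distrib_left prod.distrib by (intro sum.cong refl) (simp only: mult.left_commute)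
  also have "\<dots> = 0" by (simp add: A0)
  finally show ?thesis .
qed

text \<open>The pairing is bilinear, without complex conjugation, as fits sums of exponents times
  logarithms.\<close>

definition perp :: "nat \<Rightarrow> (nat \<Rightarrow> complex ^ 'n) \<Rightarrow> complex ^ 'n::finite \<Rightarrow> bool" where
  "perp p w r \<longleftrightarrow> (\<forall>i<p. (\<Sum>k\<in>UNIV. r $ k * w i $ k) = 0)"

lemma family_independentD:
  assumes "family_independent K p v" "\<And>i. i < p \<Longrightarrow> c i \<in> K" "\<And>s. (\<Sum>i<p. c i * v i s) = 0" "i < p"
  shows "c i = 0"
proof -
  have "(\<forall>i<p. c i \<in> K) \<longrightarrow> (\<forall>s. (\<Sum>i<p. c i * v i s) = 0) \<longrightarrow> (\<forall>i<p. c i = 0)"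
    using assms(1) unfolding family_independent_def by (rule spec)
  then show ?thesis using assms(2-4) by simp
qed

text \<open>The orthogonal space meets the span of the conjugated weights, which has dimension
  \<open>p\<close>, only in 0; so its dimension is at most \<open>q\<close>.\<close>

lemma perp_spanned:
  fixes w :: "nat \<Rightarrow> complex ^ 'n::finite"
  assumes w: "family_independent UNIV p (\<lambda>i k. w i $ k)" and pq: "p + q = CARD('n)"
  obtains u :: "nat \<Rightarrow> complex ^ 'n" where
    "\<And>r. perp p w r \<Longrightarrow> \<exists>\<beta>. \<forall>k. r $ k = (\<Sum>c<q. \<beta> c * u c $ k)"
proof -
  \<comment> \<open>For a bilinear pairing a space may meet its orthogonal space. With conjugated
    weights a common vector \<open>v\<close> satisfies that the sum of all \<open>|v_k|^2\<close> is
    0.\<close>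
  define w' :: "nat \<Rightarrow> complex ^ 'n" where "w' i = (\<chi> k. cnj (w i $ k))" for i
  have indep: "\<forall>i<p. c i = 0" if "(\<Sum>i<p. c i *s w' i) = 0" for c
  proof -
    have "(\<Sum>i<p. cnj (c i) * w i $ k) = 0" for k
    proof -
      have "(\<Sum>i<p. c i * cnj (w i $ k)) = (\<Sum>i<p. c i *s w' i) $ k" by (simp add: w'_def)
      then have "(\<Sum>i<p. c i * cnj (w i $ k)) = 0" using that by simp
      then have "cnj (\<Sum>i<p. c i * cnj (w i $ k)) = 0" by simp
      then show ?thesis by simp
    qed
    from family_independentD[OF w UNIV_I this] have "cnj (c i) = 0" if "i < p" for i using that by blast
    then show ?thesis by simp
  qed
  have inj: "inj_on w' {..<p}"
  proof (rule inj_onI, rule ccontr)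
    fix i j assume ij: "i \<in> {..<p}" "j \<in> {..<p}" "w' i = w' j" "i \<noteq> j"
    let ?c = "\<lambda>l. if l = i then 1 else if l = j then - 1 else (0 :: complex)"
    have "(\<Sum>l<p. ?c l *s w' l) = (\<Sum>l\<in>{i, j}. ?c l *s w' l)"
      using ij by (intro sum.mono_neutral_right) auto
    also have "\<dots> = 0" using ij by simp
    finally have "\<forall>l<p. ?c l = 0" by (rule indep)
    then show False using ij(1) by (auto dest: spec[of _ i])
  qed
  have ind: "vec.independent (w' ` {..<p})"
    unfolding vec.independent_explicit
  proof (intro conjI allI impI ballI)
    fix c v assume 0: "(\<Sum>v\<in>w' ` {..<p}. c v *s v) = 0" and v: "v \<in> w' ` {..<p}"
    have "(\<Sum>i<p. c (w' i) *s w' i) = 0" using 0 by (simp add: sum.reindex[OF inj])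
    from indep[OF this] v show "c v = 0" by auto
  qed simp
  define U where "U = {r. perp p w r}"
  let ?W = "vec.span (w' ` {..<p})"
  have U: "vec.subspace U"
    unfolding U_def vec.subspace_def perp_def
    by (auto simp: algebra_simps sum.distrib simp flip: sum_distrib_left)
  have "v = 0" if v: "v \<in> U" "v \<in> ?W" for v
  proof -
    obtain a where a: "v = (\<Sum>x\<in>w' ` {..<p}. a x *s x)"
      using v(2) by (auto simp: vec.span_finite)
    then have a': "v = (\<Sum>i<p. a (w' i) *s w' i)" by (simp add: sum.reindex[OF inj])
    have w'_nth: "w' i $ k = cnj (w i $ k)" for i k by (simp add: w'_def)
    have "cnj (v $ k) = (\<Sum>i<p. cnj (a (w' i)) * w i $ k)" for k
      by (subst a') (simp add: w'_nth)
    then have "(\<Sum>k\<in>UNIV. v $ k * cnj (v $ k)) = (\<Sum>k\<in>UNIV. \<Sum>i<p. cnj (a (w' i)) * (v $ k * w i $ k))"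
      by (simp add: sum_distrib_left algebra_simps)
    also have "\<dots> = (\<Sum>i<p. cnj (a (w' i)) * (\<Sum>k\<in>UNIV. v $ k * w i $ k))"
      unfolding sum_distrib_left by (rule sum.swap)
    also have "\<dots> = 0" using v(1) by (simp add: U_def perp_def)
    finally have "complex_of_real (\<Sum>k\<in>UNIV. (cmod (v $ k))\<^sup>2) = 0"
      by (simp only: of_real_sum complex_norm_square)
    then have "(\<Sum>k\<in>UNIV. (cmod (v $ k))\<^sup>2) = 0" by (simp only: of_real_eq_0_iff)
    then have "\<forall>k\<in>UNIV. (cmod (v $ k))\<^sup>2 = 0" by (subst (asm) sum_nonneg_eq_0_iff) auto
    then show "v = 0" by (simp add: vec_eq_iff)
  qed
  then have "U \<inter> ?W \<subseteq> {0}" by blast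
  then have "vec.dim (U \<inter> ?W) = 0" by (simp add: vec.dim_eq_0)
  moreover have "vec.dim ?W = p"
    using vec.dim_span_eq_card_independent[OF ind] card_image[OF inj] by simp
  moreover have "vec.dim {x + y |x y. x \<in> U \<and> y \<in> ?W} \<le> CARD('n)"
    by (rule dim_subset_UNIV_cart_gen)
  ultimately have dimU: "vec.dim U \<le> q"
    using vec.dim_sums_Int[OF U vec.subspace_span, of "w' ` {..<p}"] pq by linarith
  obtain B where B: "B \<subseteq> U" "vec.independent B" "U \<subseteq> vec.span B" "card B = vec.dim U"
    by (rule vec.basis_exists)
  have fB: "finite B" using B(2) by (rule vec.finiteI_independent)
  then obtain e where e: "bij_betw e {..<card B} B"
    using ex_bij_betw_nat_finite[OF fB] by (auto simp: atLeast0LessThan)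
  show ?thesis
  \<comment> \<open>A basis of the orthogonal space, padded with zeros to length
    \<open>q\<close>.\<close>
  proof (rule that[of "\<lambda>c. if c < card B then e c else 0"])
    fix r assume "perp p w r"
    then have "r \<in> vec.span B" using B(3) by (auto simp: U_def)
    then obtain a where "r = (\<Sum>v\<in>B. a v *s v)" by (auto simp: vec.span_finite[OF fB])
    also have "\<dots> = (\<Sum>c<card B. a (e c) *s e c)"
      by (rule sum.reindex_bij_betw[OF e, symmetric])
    finally have "r $ k = (\<Sum>c<card B. a (e c) * e c $ k)" for k by simp
    also have "(\<Sum>c<card B. a (e c) * e c $ k) =
        (\<Sum>c<q. a (e c) * (if c < card B then e c else 0) $ k)" for k
      by (rule sum.mono_neutral_cong_left) (use dimU B(4) in auto)
    finally show "\<exists>\<beta>. \<forall>k. r $ k = (\<Sum>c<q. \<beta> c * (if c < card B then e c else 0) $ k)"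
      by (intro exI[of _ "\<lambda>c. a (e c)"] allI)
  qed
qed

lemma mfps_nth_mult_mpow_mX: "mfps_nth (f * mpow mX e) (m + e) = mfps_nth f m"
proof -
  have "mfps_nth (f * mpow mX e) (m + e) = (\<Sum>(a, b)\<in>{(m, e)}. mfps_nth f a * mfps_nth (mpow mX e) b)"
    unfolding mfps_nth_mult
    by (rule sum.mono_neutral_right[OF finite_vec_splits]) (auto simp: mfps_nth_mpow_mX split: if_splits)
  then show ?thesis by (simp add: mfps_nth_mpow_mX)
qed

lemma diag_linear_nth_axis:
  assumes "diag_linear \<mu> \<Phi>" shows "mfps_nth (\<Phi> $ k) (axis k 1) = \<mu> $ k"
proof -
  have "linear_part \<Phi> $ k $ k = diag_matrix \<mu> $ k $ k"
    using assms by (simp add: diag_linear_def)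
  then show ?thesis by (simp add: linear_part_def diag_matrix_def)
qed

text \<open>\<open>D\<close> acts as a common denominator: over the fraction field the Jacobian
  matrix factors through fewer than \<open>q\<close> indices. It enters once per row, hence
  \<open>D ^ q\<close>.\<close>

lemma wedge_coeff_eq_0:
  fixes F :: "nat \<Rightarrow> ('a::{idom, ring_char_0}, 'n::finite) mfps"
  assumes "finite S" "card S < q" "D \<noteq> 0"
    and "\<And>j k. j < q \<Longrightarrow> D * mfps_pderiv k (F j) = (\<Sum>c\<in>S. b j c * C c k)"
  shows "wedge_coeff q F s = 0"
proof -
  have "D ^ q * wedge_coeff q F s =
      (\<Sum>\<sigma> | \<sigma> permutes {..<q}. of_int (sign \<sigma>) * (\<Prod>j<q. D * mfps_pderiv (s (\<sigma> j)) (F j)))"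
    unfolding wedge_coeff_def sum_distrib_left prod.distrib by (simp add: mult.left_commute)
  also have "\<dots> = 0"
    using alternating_sum_rank_deficient[OF assms(1,2), of "\<lambda>j l. D * mfps_pderiv (s l) (F j)" b "\<lambda>c l. C c (s l)"]
      assms(4) by simp
  finally show ?thesis using assms(3) by simp
qed

text \<open>In logarithmic coordinates \<open>x\<^sub>k \<partial>\<^sub>k\<close> the differentials of \<open>F\<^sub>0, \<dots>, F\<^bsub>q-1\<^esub>\<close> have all their
  coefficients in the \<open>q\<close>-dimensional space orthogonal to the \<open>w i\<close>. As they are independent there,
  a vector field \<open>\<Sum>k Y k \<partial>\<^sub>k\<close> annihilating them annihilates every monomial with
  exponent in that space; denominators are cleared by multiplying with all the variables.\<close>

lemma common_annihilator:
  fixes w :: "nat \<Rightarrow> complex ^ 'n::finite" and F :: "nat \<Rightarrow> (complex, 'n) mfps"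
    and Y :: "'n \<Rightarrow> (complex, 'n) mfps"
  assumes w: "family_independent UNIV p (\<lambda>i k. w i $ k)" and pq: "p + q = CARD('n)"
    and F: "\<And>j m. j < q \<Longrightarrow> mfps_nth (F j) m \<noteq> 0 \<Longrightarrow> perp p w (\<chi> k. of_nat (m $ k))"
    and \<Psi>: "diag_linear (\<chi> k. 1) \<Psi>"
    and indep: "functionally_independent q (\<lambda>j. mfps_subst (F j) \<Psi>)"
    and Y: "\<And>j. j < q \<Longrightarrow> (\<Sum>k\<in>UNIV. mfps_pderiv k (F j) * Y k) = 0"
    and r: "perp p w r"
  shows "(\<Sum>k\<in>UNIV. mfps_const (r $ k) * (Y k * (\<Prod>l\<in>UNIV - {k}. mfps_X l))) = 0"
proof -
  have nc: "no_const \<Psi>" using \<Psi> by (rule diag_linear_no_const)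
  \<comment> \<open>This is \<open>Y k / x_k\<close> times the product of all variables.\<close>
  define y where "y k = Y k * (\<Prod>l\<in>UNIV - {k}. mfps_X l)" for k
  obtain u :: "nat \<Rightarrow> complex ^ 'n" where
    u: "\<And>r. perp p w r \<Longrightarrow> \<exists>\<beta>. \<forall>k. r $ k = (\<Sum>c<q. \<beta> c * u c $ k)"
    using perp_spanned[OF w pq] by metis
  have "\<exists>\<beta>. \<forall>k. of_nat (m $ k) * mfps_nth (F j) m = (\<Sum>c<q. \<beta> c * u c $ k)" if "j < q" for j m
  proof (cases "mfps_nth (F j) m = 0")
    case True
    then show ?thesis by (intro exI[of _ "\<lambda>_. 0"]) simp
  next
    case False
    from u[OF F[OF that False]] obtain \<beta> where
      \<beta>: "\<And>k. of_nat (m $ k) = (\<Sum>c<q. \<beta> c * u c $ k)" by auto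
    show ?thesis
      by (intro exI[of _ "\<lambda>c. mfps_nth (F j) m * \<beta> c"] allI)
        (simp add: \<beta> sum_distrib_left sum_distrib_right mult_ac)
  qed
  then obtain \<beta> where \<beta>: "\<And>j m k. j < q \<Longrightarrow>
      of_nat (m $ k) * mfps_nth (F j) m = (\<Sum>c<q. \<beta> j m c * u c $ k)" by metis
  \<comment> \<open>Coordinates of the logarithmic differential of \<open>F j\<close> in the
    spanning family \<open>u\<close>, chosen separately for each monomial and collected into
    series.\<close>
  define B where "B j c = Abs_mfps (\<lambda>m. \<beta> j m c)" for j c
  have B: "mfps_X k * mfps_pderiv k (F j) = (\<Sum>c<q. B j c * mfps_const (u c $ k))" if "j < q" for j k
    unfolding mfps_eq_iff
    by (simp add: mfps_nth_sum mult.commute[of _ "mfps_const _"] \<beta>[OF that] B_def) (simp add: mult.commute)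
  \<comment> \<open>The pairing of the field with \<open>u c\<close>. The vector \<open>Z\<close>
    lies in the kernel of the square matrix \<open>B\<close>; it remains to see that
    \<open>B\<close> is nonsingular.\<close>
  define Z where "Z c = (\<Sum>k\<in>UNIV. mfps_const (u c $ k) * y k)" for c
  have prod_X: "(\<Prod>l\<in>UNIV. f l) = f k * (\<Prod>l\<in>UNIV - {k}. f l)" for f :: "'n \<Rightarrow> (complex, 'n) mfps" and k
    by (simp add: prod.remove)
  have BZ: "(\<Sum>c<q. B j c * Z c) = 0" if "j < q" for j
  proof -
    have "0 = (\<Prod>l\<in>UNIV. mfps_X l) * (\<Sum>k\<in>UNIV. mfps_pderiv k (F j) * Y k)"
      by (simp add: Y[OF that])
    also have "\<dots> = (\<Sum>k\<in>UNIV. mfps_X k * mfps_pderiv k (F j) * y k)"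
      unfolding sum_distrib_left
      by (intro sum.cong refl) (simp add: prod_X[of mfps_X] y_def mult_ac)
    also have "\<dots> = (\<Sum>k\<in>UNIV. \<Sum>c<q. B j c * (mfps_const (u c $ k) * y k))"
      by (simp add: B[OF that] sum_distrib_right mult.assoc)
    also have "\<dots> = (\<Sum>c<q. B j c * Z c)"
      unfolding Z_def sum_distrib_left by (rule sum.swap)
    finally show ?thesis by simp
  qed
  have Z0: "Z c0 = 0" if c0: "c0 < q" for c0
  proof (rule ccontr)
    \<comment> \<open>The kernel relation now expresses \<open>Z c0\<close> times column
      \<open>c0\<close> of \<open>B\<close> through the other columns, so the differentials factor
      through \<open>q - 1\<close> indices. All of it is composed with \<Psi> because independence
      is given for the composed series.\<close>
    assume nz: "Z c0 \<noteq> 0"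
    define z where "z c = mfps_subst (Z c) \<Psi>" for c
    define b where "b j c = mfps_subst (B j c) \<Psi>" for j c
    define XX where "XX = (\<Prod>k\<in>UNIV. \<Psi> $ k)"
    define C where "C c m = (\<Sum>k\<in>UNIV. mfps_const (u c $ k) * (\<Prod>l\<in>UNIV - {k}. \<Psi> $ l) * mfps_pderiv m (\<Psi> $ k))" for c m
    have z0: "z c0 \<noteq> 0"
    proof
      assume "z c0 = 0"
      then have "mfps_subst (Z c0) \<Psi> = mfps_subst 0 \<Psi>" by (simp add: z_def)
      from subst_inj[OF \<Psi> _ this] nz show False by simp
    qed
    have "\<Psi> $ k \<noteq> 0" for k
      using diag_linear_nth_axis[OF \<Psi>, of k] by auto
    then have XX0: "XX \<noteq> 0" by (simp add: XX_def)
    have bz: "(\<Sum>c<q. b j c * z c) = 0" if "j < q" for j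
      using arg_cong[OF BZ[OF that], of "\<lambda>f. mfps_subst f \<Psi>"]
      by (simp add: subst_sum subst_mult[OF nc] b_def z_def)
    have bC: "XX * mfps_pderiv m (mfps_subst (F j) \<Psi>) = (\<Sum>c<q. b j c * C c m)" if "j < q" for j m
    proof -
      have E: "\<Psi> $ k * mfps_subst (mfps_pderiv k (F j)) \<Psi> = (\<Sum>c<q. b j c * mfps_const (u c $ k))" for k
        using arg_cong[OF B[OF that, of k], of "\<lambda>f. mfps_subst f \<Psi>"]
        by (simp add: subst_sum subst_mult[OF nc] b_def nc)
      have "XX * mfps_pderiv m (mfps_subst (F j) \<Psi>) =
          (\<Sum>k\<in>UNIV. (\<Psi> $ k * mfps_subst (mfps_pderiv k (F j)) \<Psi>) *
             ((\<Prod>l\<in>UNIV - {k}. \<Psi> $ l) * mfps_pderiv m (\<Psi> $ k)))"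
        unfolding pderiv_subst[OF nc] sum_distrib_left XX_def
        by (intro sum.cong refl) (simp add: prod_X[of "\<lambda>l. \<Psi> $ l"] mult_ac)
      also have "\<dots> = (\<Sum>k\<in>UNIV. \<Sum>c<q. b j c *
          (mfps_const (u c $ k) * (\<Prod>l\<in>UNIV - {k}. \<Psi> $ l) * mfps_pderiv m (\<Psi> $ k)))"
        unfolding E sum_distrib_right by (simp only: mult.assoc)
      also have "\<dots> = (\<Sum>c<q. b j c * C c m)"
        unfolding C_def sum_distrib_left by (rule sum.swap)
      finally show ?thesis .
    qed
    have "wedge_coeff q (\<lambda>j. mfps_subst (F j) \<Psi>) s = 0" for s
    proof (rule wedge_coeff_eq_0[where S = "{..<q} - {c0}" and D = "z c0 * XX"
          and b = b and C = "\<lambda>c m. z c0 * C c m - z c * C c0 m"])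
      fix j m assume j: "j < q"
      have split: "(\<Sum>c<q. f c) = f c0 + (\<Sum>c\<in>{..<q} - {c0}. f c)" for f :: "nat \<Rightarrow> (complex, 'n) mfps"
        using c0 by (simp add: sum.remove)
      have "b j c0 * z c0 = - (\<Sum>c\<in>{..<q} - {c0}. b j c * z c)"
        using bz[OF j] split[of "\<lambda>c. b j c * z c"] by (simp add: eq_neg_iff_add_eq_0)
      then have "(b j c0 * z c0) * C c0 m = - (\<Sum>c\<in>{..<q} - {c0}. b j c * z c * C c0 m)"
        by (simp add: sum_distrib_right)
      moreover have "z c0 * XX * mfps_pderiv m (mfps_subst (F j) \<Psi>) =
          (b j c0 * z c0) * C c0 m + (\<Sum>c\<in>{..<q} - {c0}. b j c * (z c0 * C c m))"
        unfolding mult.assoc[of "z c0" XX] bC[OF j] split[of "\<lambda>c. b j c * C c m"]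
        by (simp add: distrib_left sum_distrib_left mult_ac)
      ultimately show "z c0 * XX * mfps_pderiv m (mfps_subst (F j) \<Psi>) =
          (\<Sum>c\<in>{..<q} - {c0}. b j c * (z c0 * C c m - z c * C c0 m))"
        by (simp add: right_diff_distrib sum_subtractf mult.assoc)
    qed (use c0 z0 XX0 in auto)
    then show False using indep unfolding functionally_independent_def by blast
  qed
  obtain a where a: "\<And>k. r $ k = (\<Sum>c<q. a c * u c $ k)" using u[OF r] by blast
  have const_sum: "mfps_const (sum f S) = (\<Sum>c\<in>S. mfps_const (f c) :: (complex, 'n) mfps)" for f and S :: "nat set"
    by (simp add: mfps_eq_iff mfps_nth_sum mfps_nth_const)
  have "(\<Sum>k\<in>UNIV. mfps_const (r $ k) * y k) =
      (\<Sum>k\<in>UNIV. \<Sum>c<q. mfps_const (a c) * (mfps_const (u c $ k) * y k))"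
    by (simp add: a const_sum sum_distrib_right mfps_const_mult mult.assoc)
  also have "\<dots> = (\<Sum>c<q. mfps_const (a c) * Z c)"
    unfolding Z_def sum_distrib_left by (rule sum.swap)
  also have "\<dots> = 0" by (simp add: Z0)
  finally show ?thesis by (simp add: y_def)
qed

text \<open>Here the minimality of \<open>m\<close> makes \<open>G\<close> preserve the ideal \<open>(x\<^sub>k)\<close> up to degree
  \<open>mdegree m\<close>.\<close>

lemma log_X_nth_minimal:
  fixes G :: "('a::field_char_0, 'n::finite) fmap"
  assumes G: "diag_linear (\<chi> k. 1) G" and m: "m $ k = 0"
    and min: "\<And>m'. m' $ k = 0 \<Longrightarrow> mdegree m' < mdegree m \<Longrightarrow> mfps_nth (G $ k) m' = 0"
  shows "mfps_nth (mfps_log G (mfps_X k)) m = mfps_nth (G $ k) m"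
proof -
  have nc: "no_const G" using G by (rule diag_linear_no_const)
  define d where "d = mdegree m"
  \<comment> \<open>Divisibility by \<open>x_k\<close> up to degree \<open>d\<close>. Order 2
    ensures that the quotient by \<open>x_k\<close> has no constant term; a possibly nonzero
    coefficient of \<open>G $ k\<close> in degree \<open>d\<close> then only contributes in higher
    degrees, and \<open>L\<close> is preserved by composition with \<open>G\<close>.\<close>
  define L where "L f \<longleftrightarrow> order_ge 2 f \<and> (\<forall>m'. m' $ k = 0 \<longrightarrow> mdegree m' \<le> d \<longrightarrow> mfps_nth f m' = 0)"
    for f :: "('a, 'n) mfps"
  have L_add: "L f \<Longrightarrow> L g \<Longrightarrow> L (f + g)" for f g by (auto simp: L_def order_ge_add)
  have L_diff: "L f \<Longrightarrow> L g \<Longrightarrow> L (f - g)" for f g by (auto simp: L_def order_ge_diff)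
  have L_const: "L f \<Longrightarrow> L (mfps_const c * f)" for c f by (auto simp: L_def order_ge_const_mult)
  have L_subst: "L (mfps_subst f G)" if f: "L f" for f
  proof -
    define f' where "f' = Abs_mfps (\<lambda>m. if m $ k = 0 then mfps_nth f m else 0)"
    define h where "h = Abs_mfps (\<lambda>m. mfps_nth (f - f') (m + axis k 1))"
    have fh: "f - f' = mfps_X k * h"
      unfolding h_def by (rule mfps_X_dvd) (simp add: f'_def)
    have o: "order_ge (Suc d) f'"
      using f by (auto simp: order_ge_def L_def f'_def less_Suc_eq_le)
    have "mfps_nth h 0 = 0"
    proof -
      have "mfps_nth f (axis k 1) = 0"
        using f order_geD[of 2 f "axis k 1"] by (simp add: L_def)
      then show ?thesis by (simp add: h_def f'_def)
    qed
    then have h0: "mfps_nth (mfps_subst h G) 0 = 0" by (rule no_const_subst[OF nc])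
    have eq: "mfps_subst f G = G $ k * mfps_subst h G + mfps_subst f' G"
    proof -
      have "f = mfps_X k * h + f'" using fh by (simp add: algebra_simps)
      then show ?thesis using nc by (simp add: subst_add subst_mult[OF nc])
    qed
    have "mfps_nth (mfps_subst f G) m' = 0" if m': "m' $ k = 0" "mdegree m' \<le> d" for m'
    proof -
      have "mfps_nth (G $ k * mfps_subst h G) m' = 0"
        unfolding mfps_nth_mult
      proof (rule sum.neutral, rule ballI)
        fix x assume x: "x \<in> {(a, b). a + b = m'}"
        obtain a b where ab: "x = (a, b)" by (cases x)
        with x have eqm: "a + b = m'" by simp
        show "(case x of (a, b) \<Rightarrow> mfps_nth (G $ k) a * mfps_nth (mfps_subst h G) b) = 0"
        proof (cases "b = 0")
          case False
          have "mdegree a + mdegree b = mdegree m'" unfolding eqm[symmetric] by simp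
          moreover have "mdegree b \<noteq> 0" using False mdegree_zero_iff by blast
          ultimately have "mdegree a < mdegree m" using m'(2) unfolding d_def by linarith
          moreover have "a $ k = 0" using m'(1) unfolding eqm[symmetric] by simp
          ultimately show ?thesis using min ab by simp
        qed (simp add: ab h0)
      qed
      moreover have "mfps_nth (mfps_subst f' G) m' = 0"
        by (rule order_geD[OF order_ge_subst[OF nc o]]) (use m' in simp)
      ultimately show ?thesis by (simp add: eq)
    qed
    then show ?thesis using f order_ge_subst[OF nc] by (auto simp: L_def)
  qed
  define g where "g = twist G 1 (mfps_X k)"
  have g: "g = G $ k - mfps_X k" by (simp add: g_def twist_def nc)
  have g2: "order_ge 2 g" using diag_linear_order[OF G, of k] by (simp add: g)
  have g_nth: "mfps_nth g m' = mfps_nth (G $ k) m'" if "m' $ k = 0" for m'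
    using that by (auto simp: g mfps_nth_X axis_def)
  \<comment> \<open>The terms of \<open>g\<close> without \<open>x_k\<close>. By minimality they
    start in degree \<open>d\<close>, so \<open>twist G 1 \<rho>\<close> starts in degree
    \<open>d + 1\<close>, where \<open>L\<close> asks for no divisibility.\<close>
  define \<rho> where "\<rho> = Abs_mfps (\<lambda>m. if m $ k = 0 then mfps_nth g m else 0)"
  have \<rho>: "order_ge d \<rho>" using min by (auto simp: \<rho>_def order_ge_def g_nth d_def)
  have \<rho>2: "order_ge 2 \<rho>" using g2 by (auto simp: \<rho>_def order_ge_def)
  have L1: "L (g - \<rho>)" using g2 \<rho>2 by (auto simp: L_def \<rho>_def order_ge_diff)
  have L2: "L (twist G 1 (g - \<rho>))"
    unfolding twist_def mfps_const_1 mult_1 by (intro L_diff L_subst L1)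
  have L3: "L (twist G 1 \<rho>)"
    using order_ge_twist_tangent[OF G \<rho>] order_ge_mono[OF order_ge_twist_tangent[OF G \<rho>2], of 2]
    by (auto simp: L_def order_ge_def less_Suc_eq_le)
  have "L (twist G 1 g)"
    using L_add[OF L2 L3] by (simp flip: twist_add)
  then have LL: "L (twist G 1 (twist G 1 (mfps_X k)))" by (simp add: g_def)
  have L0: "L 0" by (simp add: L_def)
  have "mfps_nth (mfps_log G (mfps_X k)) m = mfps_nth (twist G 1 (mfps_X k)) m"
    by (rule log_nth_modulo[OF G, of L, OF L0 L_add L_const L_subst LL]) (use m in \<open>auto simp: L_def d_def\<close>)
  then show ?thesis using g_nth[OF m] by (simp add: g_def)
qed

section \<open>A normalized map tangent to the identity: divisibility and invariant
  monomials\<close>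

context
  fixes w :: "nat \<Rightarrow> complex ^ 'n::finite" and F :: "nat \<Rightarrow> (complex, 'n) mfps"
    and G \<Psi> :: "(complex, 'n) fmap" and p q :: nat
  assumes w: "family_independent UNIV p (\<lambda>i k. w i $ k)" and pq: "p + q = CARD('n)"
    and G: "diag_linear (\<chi> k. 1) G"
    and F: "\<And>j m. j < q \<Longrightarrow> mfps_nth (F j) m \<noteq> 0 \<Longrightarrow> perp p w (\<chi> k. of_nat (m $ k))"
    and FG: "\<And>j. j < q \<Longrightarrow> mfps_subst (F j) G = F j"
    and \<Psi>: "diag_linear (\<chi> k. 1) \<Psi>"
    and indep: "functionally_independent q (\<lambda>j. mfps_subst (F j) \<Psi>)"
begin

lemma log_annihilator:
  assumes "perp p w r"
  shows "(\<Sum>k\<in>UNIV. mfps_const (r $ k) * (mfps_log G (mfps_X k) * (\<Prod>l\<in>UNIV - {k}. mfps_X l))) = 0"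
proof (rule common_annihilator[OF w pq F \<Psi> indep _ assms])
  fix j assume "j < q"
  then show "(\<Sum>k\<in>UNIV. mfps_pderiv k (F j) * mfps_log G (mfps_X k)) = 0"
    using log_chain[OF G, of "F j"] log_invariant[OF G FG] by simp
qed

lemma resonant_divisible:
  assumes G_perp: "\<And>k m. mfps_nth (G $ k) m \<noteq> 0 \<Longrightarrow> perp p w (\<chi> l. of_nat (m $ l) - of_nat (axis k 1 $ l))"
    and mk: "m $ k = 0"
  shows "mfps_nth (G $ k) m = 0"
proof (rule ccontr)
  let ?P = "\<lambda>m. m $ k = 0 \<and> mfps_nth (G $ k) m \<noteq> 0"
  let ?Y = "\<lambda>k. mfps_log G (mfps_X k)"
  let ?y = "\<lambda>k. ?Y k * (\<Prod>l\<in>UNIV - {k}. mfps_X l)"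
  assume "mfps_nth (G $ k) m \<noteq> 0"
  with mk have "?P m" by simp
  then obtain m0 where m0: "?P m0" "\<And>m'. ?P m' \<Longrightarrow> mdegree m0 \<le> mdegree m'"
    using ex_has_least_nat[of ?P m mdegree] by blast
  define r :: "complex ^ 'n" where "r = (\<chi> l. of_nat (m0 $ l) - of_nat (axis k 1 $ l))"
  have "perp p w r" unfolding r_def using m0(1) by (intro G_perp) simp
  from log_annihilator[OF this] have "(\<Sum>l\<in>UNIV. mfps_const (r $ l) * ?y l) = 0" .
  moreover have "r $ k = - 1" using m0(1) by (simp add: r_def axis_def)
  \<comment> \<open>The coefficient -1 allows solving for the \<open>k\<close>-th summand. Every
    other summand contains \<open>x_k\<close> in its product of variables.\<close>
  ultimately have yk: "?y k = (\<Sum>l\<in>UNIV - {k}. mfps_const (r $ l) * ?y l)"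
    by (subst (asm) sum.remove[of _ k]) (auto simp: mfps_const_minus add_eq_0_iff)
  have y0: "mfps_nth (?y k) m' = 0" if "m' $ k = 0" for m'
    unfolding yk mfps_nth_sum
  proof (rule sum.neutral, rule ballI)
    fix l assume "l \<in> UNIV - {k}"
    then have "(\<Prod>j\<in>UNIV - {l}. mfps_X j) = mfps_X k * (\<Prod>j\<in>UNIV - {l} - {k}. mfps_X j :: (complex, 'n) mfps)"
      by (intro prod.remove) auto
    then have "mfps_const (r $ l) * ?y l = mfps_X k * (mfps_const (r $ l) * ?Y l * (\<Prod>j\<in>UNIV - {l} - {k}. mfps_X j))"
      by (simp add: mult_ac)
    then show "mfps_nth (mfps_const (r $ l) * ?y l) m' = 0"
      using mfps_nth_X_mult_eq_0[OF that] by metis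
  qed
  \<comment> \<open>The exponent of the product of all variables except \<open>x_k\<close>:
    multiplying by it shifts coefficients without changing the power of \<open>x_k\<close>.\<close>
  define e :: "nat ^ 'n" where "e = (\<chi> j. if j = k then 0 else 1)"
  have e: "(\<Prod>l\<in>UNIV - {k}. mfps_X l) = mpow mX e"
    unfolding mpow_def by (rule prod.mono_neutral_cong_left) (auto simp: e_def)
  have "mfps_nth (?y k) (m0 + e) = mfps_nth (?Y k) m0"
    unfolding e by (rule mfps_nth_mult_mpow_mX)
  moreover have "(m0 + e) $ k = 0" using m0(1) by (simp add: e_def)
  ultimately have "mfps_nth (?Y k) m0 = 0" using y0 by metis
  moreover have "mfps_nth (?Y k) m0 = mfps_nth (G $ k) m0"
    by (rule log_X_nth_minimal[OF G]) (use m0 in \<open>auto simp: not_le[symmetric]\<close>)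
  ultimately show False using m0(1) by simp
qed

text \<open>The monomial is an eigenvector of each Euler operator, with its exponent as eigenvalue.
  Up to the product of all variables its logarithm is therefore the monomial times the annihilated
  combination for \<open>r = \<gamma>\<close>, and a vanishing logarithm means invariance.\<close>

lemma resonant_monomial_invariant:
  assumes "perp p w (\<chi> k. of_nat (\<gamma> $ k))"
  shows "mpow G \<gamma> = mpow mX \<gamma>"
proof -
  let ?Y = "\<lambda>k. mfps_log G (mfps_X k)"
  let ?XX = "\<Prod>l\<in>UNIV. mfps_X l :: (complex, 'n) mfps"
  have nc: "no_const G" using G by (rule diag_linear_no_const)
  have D: "mfps_X k * mfps_pderiv k (mpow mX \<gamma>) = mfps_const (of_nat (\<gamma> $ k)) * mpow mX \<gamma>" for k
    by (simp add: mfps_eq_iff mfps_nth_mpow_mX)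
  have "?XX * mfps_log G (mpow mX \<gamma>) =
      (\<Sum>k\<in>UNIV. (mfps_X k * mfps_pderiv k (mpow mX \<gamma>)) * (?Y k * (\<Prod>l\<in>UNIV - {k}. mfps_X l)))"
    unfolding log_chain[OF G, of "mpow mX \<gamma>"] sum_distrib_left
  proof (rule sum.cong[OF refl])
    fix k
    have "?XX = mfps_X k * (\<Prod>l\<in>UNIV - {k}. mfps_X l)" by (simp add: prod.remove)
    then show "?XX * (mfps_pderiv k (mpow mX \<gamma>) * ?Y k) =
        (mfps_X k * mfps_pderiv k (mpow mX \<gamma>)) * (?Y k * (\<Prod>l\<in>UNIV - {k}. mfps_X l))"
      by (simp only: mult_ac)
  qed
  also have "\<dots> = mpow mX \<gamma> * (\<Sum>k\<in>UNIV. mfps_const (of_nat (\<gamma> $ k)) * (?Y k * (\<Prod>l\<in>UNIV - {k}. mfps_X l)))"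
    unfolding D sum_distrib_left by (simp only: mult_ac)
  also have "\<dots> = 0"
    using log_annihilator[OF assms] by simp
  finally have "?XX * mfps_log G (mpow mX \<gamma>) = 0" .
  moreover have "mfps_X k \<noteq> (0 :: (complex, 'n) mfps)" for k
    using mfps_nth_X[of k "axis k 1"] by (metis mfps_nth_0 zero_neq_one)
  ultimately have "mfps_log G (mpow mX \<gamma>) = 0" by simp
  from log_eq_0_imp_invariant[OF G this] show ?thesis
    by (simp add: subst_mpow_mX[OF nc])
qed

end

section \<open>Logarithms of diagonal matrices\<close>

lemma mat_power_0 [simp]: "mat_power B 0 = mat 1" by (simp add: mat_power_def)
lemma mat_power_Suc [simp]: "mat_power B (Suc k) = B ** mat_power B k" by (simp add: mat_power_def)

text \<open>A geometric bound on the powers, which makes every entry of the exponential series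
  absolutely convergent, as the Cauchy product requires.\<close>

lemma mat_power_bound:
  fixes B :: "complex ^ 'n::finite ^ 'n"
  shows "cmod (mat_power B k $ r $ s) \<le> (\<Sum>i\<in>UNIV. \<Sum>j\<in>UNIV. cmod (B $ i $ j)) ^ k"
proof (induction k arbitrary: r)
  case (Suc k)
  let ?b = "\<Sum>i\<in>UNIV. \<Sum>j\<in>UNIV. cmod (B $ i $ j)"
  have "cmod (mat_power B (Suc k) $ r $ s) \<le> (\<Sum>j\<in>UNIV. cmod (B $ r $ j) * cmod (mat_power B k $ j $ s))"
    unfolding mat_power_Suc matrix_matrix_mult_def by (simp add: norm_sum[THEN order_trans] norm_mult sum_mono)
  also have "\<dots> \<le> (\<Sum>j\<in>UNIV. cmod (B $ r $ j) * ?b ^ k)"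
    by (intro sum_mono mult_left_mono Suc) auto
  also have "\<dots> = (\<Sum>j\<in>UNIV. cmod (B $ r $ j)) * ?b ^ k" by (simp add: sum_distrib_right)
  also have "\<dots> \<le> ?b * ?b ^ k"
  proof (rule mult_right_mono)
    show "(\<Sum>j\<in>UNIV. cmod (B $ r $ j)) \<le> ?b"
      by (rule member_le_sum[of r UNIV "\<lambda>i. \<Sum>j\<in>UNIV. cmod (B $ i $ j)"]) (auto intro: sum_nonneg)
  qed (auto intro!: zero_le_power sum_nonneg)
  finally show ?case by simp
qed (simp add: mat_def)

lemma summable_matrix_exp_nth:
  fixes B :: "complex ^ 'n::finite ^ 'n"
  shows "summable (\<lambda>k. cmod (mat_power B k $ r $ s / fact k))"
proof (rule summable_comparison_test')
  let ?b = "\<Sum>i\<in>UNIV. \<Sum>j\<in>UNIV. cmod (B $ i $ j)"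
  show "summable (\<lambda>k. ?b ^ k /\<^sub>R fact k)" by (rule summable_exp_generic)
  fix k :: nat
  show "norm (cmod (mat_power B k $ r $ s / fact k)) \<le> ?b ^ k /\<^sub>R fact k"
  proof -
    have "cmod (mat_power B k $ r $ s / fact k) = inverse (fact k) * cmod (mat_power B k $ r $ s)"
      by (simp add: norm_divide field_simps)
    also have "\<dots> \<le> inverse (fact k) * ?b ^ k"
      by (intro mult_left_mono mat_power_bound) simp
    finally show ?thesis by simp
  qed
qed

lemma matrix_exp_sums:
  fixes B :: "complex ^ 'n::finite ^ 'n"
  shows "(\<lambda>k. mat_power B k $ r $ s / fact k) sums (matrix_exp B $ r $ s)"
proof -
  define E :: "complex ^ 'n ^ 'n" where "E = (\<chi> r s. \<Sum>k. mat_power B k $ r $ s / fact k)"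
  have E: "(\<lambda>k. mat_power B k $ r $ s / fact k) sums (E $ r $ s)" for r s
    using summable_norm_cancel[OF summable_matrix_exp_nth, of B r s] by (simp add: E_def summable_sums)
  have "(\<lambda>n. \<Sum>k<n. (1 / fact k) *\<^sub>R mat_power B k) \<longlonglongrightarrow> E"
  proof (intro vec_tendstoI)
    fix r s
    have "(\<lambda>n. (\<Sum>k<n. (1 / fact k) *\<^sub>R mat_power B k) $ r $ s) = (\<lambda>n. \<Sum>k<n. mat_power B k $ r $ s / fact k)"
      by (rule ext) (simp add: scaleR_conv_of_real[where 'a = complex] divide_inverse mult.commute)
    then show "(\<lambda>n. (\<Sum>k<n. (1 / fact k) *\<^sub>R mat_power B k) $ r $ s) \<longlonglongrightarrow> E $ r $ s"
      using E[of r s] by (simp add: sums_def)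
  qed
  then have "(\<lambda>k. (1 / fact k) *\<^sub>R mat_power B k) sums E" by (simp add: sums_def)
  then have "matrix_exp B = E" unfolding matrix_exp_def by (rule sums_unique[symmetric])
  with E show ?thesis by simp
qed

section \<open>Invertibility of the exponential\<close>

lemma mat_power_add: "mat_power B (i + j) = mat_power B i ** mat_power B j"
  by (induction i) (simp_all add: matrix_mul_assoc)

lemma mat_power_uminus:
  fixes B :: "complex ^ 'n::finite ^ 'n"
  shows "mat_power (- B) k $ r $ s = (- 1) ^ k * mat_power B k $ r $ s"
  by (induction k arbitrary: r) (simp_all add: matrix_matrix_mult_def sum_negf sum_distrib_left mult_ac)

text \<open>In the entrywise Cauchy product the term of index \<open>N\<close> is the corresponding
  entry of \<open>B^N / N!\<close> times \<open>(1 - 1)^N\<close>. The resulting invertibility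
  forces the multipliers \<open>\<mu> $ k\<close> to be nonzero.\<close>

lemma matrix_exp_uminus:
  fixes B :: "complex ^ 'n::finite ^ 'n"
  shows "matrix_exp B ** matrix_exp (- B) = mat 1"
  unfolding vec_eq_iff
proof (intro allI)
  fix r s :: 'n
  let ?a = "\<lambda>C r s k. mat_power C k $ r $ s / fact k"
  have "(\<lambda>N. \<Sum>i\<le>N. ?a B r l i * ?a (- B) l s (N - i)) sums (matrix_exp B $ r $ l * matrix_exp (- B) $ l $ s)" for l
    using Cauchy_product_sums[OF summable_matrix_exp_nth[of B r l] summable_matrix_exp_nth[of "- B" l s]]
    by (simp add: sums_unique[OF matrix_exp_sums])
  then have "(\<lambda>N. \<Sum>l\<in>UNIV. \<Sum>i\<le>N. ?a B r l i * ?a (- B) l s (N - i)) sums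
      (\<Sum>l\<in>UNIV. matrix_exp B $ r $ l * matrix_exp (- B) $ l $ s)"
    by (intro sums_sum) auto
  moreover have "(\<Sum>l\<in>UNIV. \<Sum>i\<le>N. ?a B r l i * ?a (- B) l s (N - i)) = (if N = 0 then mat 1 $ r $ s else 0)" for N
  proof -
    have *: "(\<Sum>l\<in>UNIV. ?a B r l i * ?a (- B) l s (N - i)) =
        mat_power B N $ r $ s / fact N * (of_nat (N choose i) * 1 ^ i * (- 1) ^ (N - i))" if "i \<le> N" for i
    proof -
      have "mat_power B N $ r $ s = (mat_power B i ** mat_power B (N - i)) $ r $ s"
        using that by (simp flip: mat_power_add)
      then have eq: "mat_power B N $ r $ s = (\<Sum>l\<in>UNIV. mat_power B i $ r $ l * mat_power B (N - i) $ l $ s)"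
        by (simp add: matrix_matrix_mult_def)
      show ?thesis
        unfolding mat_power_uminus eq binomial_fact[OF that]
        by (simp add: sum_distrib_left sum_distrib_right sum_divide_distrib field_simps)
    qed
    have "(\<Sum>l\<in>UNIV. \<Sum>i\<le>N. ?a B r l i * ?a (- B) l s (N - i)) =
        (\<Sum>i\<le>N. \<Sum>l\<in>UNIV. ?a B r l i * ?a (- B) l s (N - i))" by (rule sum.swap)
    also have "\<dots> = mat_power B N $ r $ s / fact N * (\<Sum>i\<le>N. of_nat (N choose i) * 1 ^ i * (- 1) ^ (N - i))"
      unfolding sum_distrib_left by (intro sum.cong refl *) simp
    also have "(\<Sum>i\<le>N. of_nat (N choose i) * 1 ^ i * (- 1 :: complex) ^ (N - i)) = (1 + - 1) ^ N"
      by (rule binomial_ring[symmetric])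
    finally show ?thesis by (cases "N = 0") auto
  qed
  ultimately have "(\<lambda>N. if N = 0 then mat 1 $ r $ s else 0) sums (matrix_exp B ** matrix_exp (- B)) $ r $ s"
    by (simp add: matrix_matrix_mult_def)
  moreover have "(\<lambda>N. if N = 0 then mat 1 $ r $ s else 0) sums (mat 1 $ r $ s :: complex)"
    using sums_single[of 0 "\<lambda>_. mat 1 $ r $ s :: complex"] by simp
  ultimately show "(matrix_exp B ** matrix_exp (- B)) $ r $ s = mat 1 $ r $ s"
    by (rule sums_unique2)
qed

lemma matrix_exp_0: "matrix_exp 0 = (mat 1 :: complex ^ 'n::finite ^ 'n)"
  unfolding vec_eq_iff
proof (intro allI)
  fix r s :: 'n
  have "(\<lambda>k. mat_power 0 k $ r $ s / fact k) = (\<lambda>k. if k = 0 then mat 1 $ r $ s else 0 :: complex)"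
  proof
    fix k show "mat_power 0 k $ r $ s / fact k = (if k = 0 then mat 1 $ r $ s else 0 :: complex)"
      by (cases k) auto
  qed
  then have "(\<lambda>k. if k = 0 then mat 1 $ r $ s else 0) sums (matrix_exp 0 $ r $ s)"
    using matrix_exp_sums[of 0 r s] by simp
  moreover have "(\<lambda>N. if N = 0 then mat 1 $ r $ s else 0) sums (mat 1 $ r $ s :: complex)"
    using sums_single[of 0 "\<lambda>_. mat 1 $ r $ s :: complex"] by simp
  ultimately show "matrix_exp 0 $ r $ s = (mat 1 $ r $ s :: complex)"
    by (rule sums_unique2)
qed

section \<open>Eigenvectors and Jordan chains under the exponential\<close>

lemma matrix_inv_both: "invertible A \<Longrightarrow> A ** matrix_inv A = mat 1 \<and> matrix_inv A ** A = mat 1"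
  unfolding invertible_def matrix_inv_def by (rule someI_ex)

lemma diag_matrix_mult_vec: "(diag_matrix d *v v) $ r = d $ r * v $ r" for d :: "'a::comm_semiring_1 ^ 'n::finite"
proof -
  have "(diag_matrix d *v v) $ r = (\<Sum>s\<in>UNIV. if s = r then d $ r * v $ r else 0)"
    unfolding matrix_vector_mult_def diag_matrix_def vec_lambda_beta by (rule sum.cong) auto
  then show ?thesis by simp
qed

lemma matrix_vector_mult_axis_nth: "(A *v axis l 1) $ r = A $ r $ l" for A :: "'a::comm_semiring_1 ^ 'n::finite ^ 'm"
proof -
  have "(A *v axis l 1) $ r = (\<Sum>j\<in>UNIV. if j = l then A $ r $ l else 0)"
    unfolding matrix_vector_mult_def axis_def vec_lambda_beta by (rule sum.cong) auto
  then show ?thesis by simp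
qed

lemma diag_matrix_exp_nonzero:
  assumes "matrix_exp B = diag_matrix \<mu>" shows "\<mu> $ k \<noteq> 0"
proof
  assume 0: "\<mu> $ k = 0"
  have "mat 1 $ k $ k = (diag_matrix \<mu> ** matrix_exp (- B)) $ k $ k"
    using matrix_exp_uminus[of B] by (simp add: assms)
  also have "\<dots> = 0"
    unfolding matrix_matrix_mult_def diag_matrix_def using 0 by (auto intro!: sum.neutral)
  finally show False by (simp add: mat_def)
qed

text \<open>On such a pair \<open>B^k v = l^k v + k l^(k-1) u\<close>, and both resulting series sum
  to \<open>exp l\<close>. The truncated subtraction at \<open>k = 0\<close> is harmless because of
  the factor \<open>k\<close>. With \<open>u = 0\<close> this is the case of an eigenvector.\<close>

lemma matrix_exp_jordan_pair:
  fixes B :: "complex ^ 'n::finite ^ 'n"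
  assumes v: "B *v v = l *s v + u" and u: "B *v u = l *s u"
  shows "matrix_exp B *v v = exp l *s (v + u)"
  unfolding vec_eq_iff
proof
  fix r
  have pw: "mat_power B k *v v = l ^ k *s v + (of_nat k * l ^ (k - 1)) *s u" for k
  proof (induction k)
    case (Suc k)
    have "mat_power B (Suc k) *v v = B *v (l ^ k *s v + (of_nat k * l ^ (k - 1)) *s u)"
      by (simp add: Suc flip: matrix_vector_mul_assoc)
    also have "\<dots> = l ^ k *s (l *s v + u) + (of_nat k * l ^ (k - 1)) *s (l *s u)"
      by (simp only: vec.add vec.scale v u)
    also have "\<dots> = l ^ Suc k *s v + (of_nat (Suc k) * l ^ k) *s u"
      by (cases k) (simp_all add: vec_eq_iff algebra_simps)
    finally show ?case by simp
  qed simp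
  have "(\<lambda>k. \<Sum>s\<in>UNIV. mat_power B k $ r $ s / fact k * v $ s) sums (\<Sum>s\<in>UNIV. matrix_exp B $ r $ s * v $ s)"
    by (intro sums_sum sums_mult2 matrix_exp_sums)
  then have "(\<lambda>k. (mat_power B k *v v) $ r / fact k) sums ((matrix_exp B *v v) $ r)"
    by (simp add: matrix_vector_mult_def sum_divide_distrib)
  then have 1: "(\<lambda>k. l ^ k / fact k * v $ r + of_nat k * l ^ (k - 1) / fact k * u $ r) sums ((matrix_exp B *v v) $ r)"
    by (simp add: pw add_divide_distrib)
  have e: "(\<lambda>k. l ^ k / fact k) sums exp l"
    using exp_converges[of l] by (simp add: scaleR_conv_of_real divide_inverse mult.commute)
  have "of_nat (Suc k) * l ^ (Suc k - 1) / fact (Suc k) = l ^ k / fact k" for k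
    by (simp del: of_nat_Suc)
  with e have "(\<lambda>k. of_nat (Suc k) * l ^ (Suc k - 1) / fact (Suc k)) sums exp l" by simp
  then have e': "(\<lambda>k. of_nat k * l ^ (k - 1) / fact k) sums exp l"
    by (subst (asm) sums_Suc_iff) simp
  have "(\<lambda>k. l ^ k / fact k * v $ r + of_nat k * l ^ (k - 1) / fact k * u $ r) sums (exp l * v $ r + exp l * u $ r)"
    by (intro sums_add sums_mult2 e e')
  with 1 have "(matrix_exp B *v v) $ r = exp l * v $ r + exp l * u $ r" by (rule sums_unique2)
  then show "(matrix_exp B *v v) $ r = (exp l *s (v + u)) $ r" by (simp add: distrib_left)
qed

lemma matrix_exp_eigenvector:
  fixes B :: "complex ^ 'n::finite ^ 'n"
  shows "B *v v = l *s v \<Longrightarrow> matrix_exp B *v v = exp l *s v"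
  using matrix_exp_jordan_pair[of B v l 0] by simp

text \<open>A nontrivial Jordan chain of \<open>B\<close> would give one of \<open>matrix_exp B\<close>.\<close>

lemma diag_exp_imp_semisimple:
  fixes B :: "complex ^ 'n::finite ^ 'n"
  assumes exp: "matrix_exp B = diag_matrix \<mu>"
    and nil: "mat_power (B - S) k = 0" and comm: "S ** (B - S) = (B - S) ** S"
    and v: "S *v v = l *s v"
  shows "B *v v = l *s v"
proof (rule ccontr)
  assume ne: "B *v v \<noteq> l *s v"
  define N where "N = B - S"
  have B: "B *v x = S *v x + N *v x" for x by (simp add: N_def flip: matrix_vector_mult_add_rdistrib)
  have Nv: "N *v v \<noteq> 0" using ne B[of v] v by auto
  have ex: "mat_power N k *v v = 0" using nil by (simp add: N_def)
  define j where "j = (LEAST j. mat_power N j *v v = 0)"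
  have j: "mat_power N j *v v = 0" unfolding j_def using ex by (rule LeastI)
  have j_min: "mat_power N i *v v \<noteq> 0" if "i < j" for i
    using not_less_Least[of i "\<lambda>j. mat_power N j *v v = 0"] that unfolding j_def by auto
  have "j \<noteq> 0"
  proof
    assume "j = 0"
    then have "v = 0" using j by simp
    then show False using Nv by simp
  qed
  moreover have "j \<noteq> 1"
  proof
    assume "j = 1"
    then show False using j Nv by simp
  qed
  ultimately obtain i where i: "j = Suc (Suc i)" by (metis One_nat_def not0_implies_Suc)
  \<comment> \<open>\<open>x\<close> and \<open>u\<close> are the last two nonzero vectors of the
    chain \<open>v, N v, N^2 v, ...\<close>; they form a Jordan pair of \<open>B\<close>.\<close>
  define x where "x = mat_power N i *v v"
  define u where "u = N *v x"
  have u0: "u \<noteq> 0" using j_min[of "Suc i"] by (simp add: u_def x_def i flip: matrix_vector_mul_assoc)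
  have Nu: "N *v u = 0" using j by (simp add: u_def x_def i flip: matrix_vector_mul_assoc)
  have SN: "S *v (N *v y) = N *v (S *v y)" for y
    using comm by (simp add: N_def matrix_vector_mul_assoc)
  have Sx: "S *v x = l *s x"
  proof -
    have "S *v (mat_power N i *v v) = l *s (mat_power N i *v v)" for i
      by (induction i) (simp_all add: v SN vec.scale flip: matrix_vector_mul_assoc)
    then show ?thesis by (simp add: x_def)
  qed
  have Su: "S *v u = l *s u" by (simp add: u_def SN Sx vec.scale)
  have Bx: "B *v x = l *s x + u" by (simp add: B Sx u_def)
  have Bu: "B *v u = l *s u" by (simp add: B Su Nu)
  have "u $ r = 0" for r
  proof (rule ccontr)
    assume nz: "u $ r \<noteq> 0"
    \<comment> \<open>As the exponential is diagonal, coordinate \<open>r\<close> can be compared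
      alone: \<open>u\<close> forces \<open>\<mu> $ r = exp l\<close>, and then \<open>x\<close>
      forces \<open>u $ r = 0\<close>.\<close>
    have 1: "\<mu> $ r * x $ r = exp l * (x $ r + u $ r)"
      using matrix_exp_jordan_pair[OF Bx Bu] diag_matrix_mult_vec[of \<mu> x r] by (simp add: exp distrib_left)
    have "\<mu> $ r * u $ r = exp l * u $ r"
      using matrix_exp_eigenvector[OF Bu] diag_matrix_mult_vec[of \<mu> u r] by (auto simp: exp)
    with nz have "\<mu> $ r = exp l" by simp
    with 1 nz show False by (simp add: distrib_left)
  qed
  then show False using u0 by (simp add: vec_eq_iff)
qed

section \<open>Weights orthogonal to all resonances\<close>

lemma family_independent_complexify:
  fixes v :: "nat \<Rightarrow> 'b \<Rightarrow> real"
  assumes "family_independent UNIV p v"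
  shows "family_independent (UNIV :: complex set) p (\<lambda>i s. of_real (v i s))"
  unfolding family_independent_def
proof (intro allI impI)
  fix c :: "nat \<Rightarrow> complex" and i assume c: "\<forall>s. (\<Sum>i<p. c i * of_real (v i s)) = 0" and i: "i < p"
  have "Re (\<Sum>i<p. c i * of_real (v i s)) = 0" "Im (\<Sum>i<p. c i * of_real (v i s)) = 0" for s
    using c by simp_all
  then have "(\<Sum>i<p. Re (c i) * v i s) = 0" "(\<Sum>i<p. Im (c i) * v i s) = 0" for s
    by simp_all
  from family_independentD[OF assms UNIV_I this(1) i] family_independentD[OF assms UNIV_I this(2) i]
  show "c i = 0" by (simp add: complex_eq_iff)
qed

text \<open>For \<open>K = \<real>\<close> the generators are independent over the reals, while
  orthogonality is counted over the complex numbers. Real entries bridge the gap: a complex relation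
  splits into its real and imaginary parts.\<close>

lemma family_independent_Reals:
  assumes ind: "family_independent \<real> p v" and v: "\<And>i s. i < p \<Longrightarrow> v i s \<in> (\<real> :: complex set)"
  shows "family_independent UNIV p v"
proof -
  have "family_independent UNIV p (\<lambda>i s. Re (v i s))"
    unfolding family_independent_def
  proof (intro allI impI)
    fix c :: "nat \<Rightarrow> real" and i assume c: "\<forall>s. (\<Sum>i<p. c i * Re (v i s)) = 0" and i: "i < p"
    have "(\<Sum>i<p. complex_of_real (c i) * v i s) = 0" for s
    proof -
      have "(\<Sum>i<p. complex_of_real (c i) * v i s) = of_real (\<Sum>i<p. c i * Re (v i s))"
        using v by (auto intro!: sum.cong)
      then show ?thesis using c by simp
    qed
    from family_independentD[OF ind _ this i] have "complex_of_real (c i) = 0"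
      by simp
    then show "c i = 0" by simp
  qed
  from family_independent_complexify[OF this]
  have "family_independent UNIV p (\<lambda>i s. complex_of_real (Re (v i s)))" .
  moreover have "complex_of_real (Re (v i s)) = v i s" if "i < p" for i s
    using v[OF that] by simp
  ultimately show ?thesis by (simp add: family_independent_def)
qed

text \<open>The common interface to the two alternative hypotheses. Comparing two exponents covers
  both kinds of resonance: \<open>b = 0\<close> for first integrals and elements of \<Omega>,
  \<open>b = axis k 1\<close> for terms of a \<open>k\<close>-th component.\<close>

definition resonance_weights :: "nat \<Rightarrow> (nat \<Rightarrow> complex ^ 'n) \<Rightarrow> (nat \<Rightarrow> complex ^ 'n::finite) \<Rightarrow> bool" where
  "resonance_weights p \<mu> w \<longleftrightarrow> family_independent UNIV p (\<lambda>i k. w i $ k) \<and>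
    (\<forall>a b. (\<forall>i<p. vpow (\<mu> i) a = vpow (\<mu> i) b) \<longrightarrow> perp p w (\<chi> k. of_nat (a $ k) - of_nat (b $ k)))"

text \<open>Logarithms of absolute values turn equality of multipliers into a linear equation, free
  of the ambiguity by multiples of \<open>2 \<pi> i\<close>.\<close>

lemma projectively_hyperbolic_weights:
  assumes hyp: "projectively_hyperbolic p \<mu>" and \<mu>: "\<And>i k. i < p \<Longrightarrow> \<mu> i $ k \<noteq> 0"
  shows "resonance_weights p \<mu> (\<lambda>i. \<chi> k. of_real (ln (cmod (\<mu> i $ k))))"
  unfolding resonance_weights_def
proof (intro conjI allI impI)
  show "family_independent UNIV p (\<lambda>i k. (\<chi> k. complex_of_real (ln (cmod (\<mu> i $ k)))) $ k)"
    using family_independent_complexify[OF hyp[unfolded projectively_hyperbolic_def]] by simp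
  fix a b :: "nat ^ 'a" assume ab: "\<forall>i<p. vpow (\<mu> i) a = vpow (\<mu> i) b"
  show "perp p (\<lambda>i. \<chi> k. of_real (ln (cmod (\<mu> i $ k)))) (\<chi> k. of_nat (a $ k) - of_nat (b $ k))"
    unfolding perp_def
  proof (intro allI impI)
    fix i assume i: "i < p"
    have ln: "ln (cmod (vpow (\<mu> i) c)) = (\<Sum>k\<in>UNIV. of_nat (c $ k) * ln (cmod (\<mu> i $ k)))" for c :: "nat ^ 'a"
    proof -
      have "ln (\<Prod>k\<in>UNIV. cmod (\<mu> i $ k) ^ (c $ k)) = (\<Sum>k\<in>UNIV. ln (cmod (\<mu> i $ k) ^ (c $ k)))"
        by (rule ln_prod) (use \<mu>[OF i] in auto)
      then show ?thesis using \<mu>[OF i] by (simp add: norm_power ln_realpow flip: prod_norm)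
    qed
    have "(\<Sum>k\<in>UNIV. (of_nat (a $ k) - of_nat (b $ k)) * ln (cmod (\<mu> i $ k))) = 0"
      using ln[of a] ln[of b] ab i by (simp add: left_diff_distrib sum_subtractf)
    then have "complex_of_real (\<Sum>k\<in>UNIV. (of_nat (a $ k) - of_nat (b $ k)) * ln (cmod (\<mu> i $ k))) = 0"
      by simp
    then show "(\<Sum>k\<in>UNIV. (\<chi> k. of_nat (a $ k) - of_nat (b $ k)) $ k *
        (\<chi> k. complex_of_real (ln (cmod (\<mu> i $ k)))) $ k) = 0"
      by simp
  qed
qed

text \<open>The weights are the eigenvalues of the generators, arranged so that the
  \<open>r\<close>-th one is a logarithm of \<open>\<mu> i $ r\<close>. Equal multipliers make the
  pairing with \<open>a - b\<close> an integral multiple of \<open>2 \<pi> i\<close> for every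
  \<open>i\<close>, and weak non-resonance then makes it 0. Independence is inherited from the
  generators, which are simultaneously diagonal in the basis given by \<open>P\<close>.\<close>

lemma weakly_nonresonant_weights:
  fixes \<mu> :: "nat \<Rightarrow> complex ^ 'n::finite"
  assumes K: "K = UNIV \<or> K = \<real>"
    and gen: "infinitesimal_generators K p A X"
    and A: "\<And>i. i < p \<Longrightarrow> A i = diag_matrix (\<mu> i)"
    and wnr: "weakly_nonresonant p X"
  shows "\<exists>w. resonance_weights p \<mu> w"
proof -
  obtain P lam where P: "invertible P"
    and ss: "\<And>i. i < p \<Longrightarrow> is_semisimple_part (P ** diag_matrix (lam i) ** matrix_inv P) (X i)"
    and nr: "\<not> (\<exists>k :: int ^ 'n.
             (\<forall>i<p. \<exists>z :: int. (\<Sum>m\<in>UNIV. of_int (k $ m) * lam i $ m) = 2 * \<i> * of_real pi * of_int z) \<and>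
             (\<exists>i<p. (\<Sum>m\<in>UNIV. of_int (k $ m) * lam i $ m) \<noteq> 0))"
    using wnr unfolding weakly_nonresonant_def by blast
  have PQ: "P ** matrix_inv P = mat 1" "matrix_inv P ** P = mat 1"
    using matrix_inv_both[OF P] by auto
  have exp: "matrix_exp (X i) = diag_matrix (\<mu> i)" if "i < p" for i
    using gen A that by (simp add: infinitesimal_generators_def is_matrix_log_def)
  define col where "col l = P *v axis l 1" for l
  have col_nth: "col l $ r = P $ r $ l" for l r
    by (simp add: col_def matrix_vector_mult_axis_nth)
  have diag_axis: "diag_matrix d *v axis l 1 = d $ l *s axis l (1 :: complex)" for d :: "complex ^ 'n" and l
    by (simp add: vec_eq_iff diag_matrix_mult_vec axis_def)
  have Xcol: "X i *v col l = lam i $ l *s col l" if i: "i < p" for i l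
  proof -
    let ?S = "P ** diag_matrix (lam i) ** matrix_inv P"
    have "?S *v col l = P *v (diag_matrix (lam i) *v ((matrix_inv P ** P) *v axis l 1))"
      by (simp add: col_def matrix_vector_mul_assoc matrix_mul_assoc)
    also have "\<dots> = lam i $ l *s col l"
      by (simp add: PQ diag_axis col_def vec.scale)
    finally have "?S *v col l = lam i $ l *s col l" .
    moreover obtain k where "mat_power (X i - ?S) k = 0" using ss[OF i] unfolding is_semisimple_part_def by blast
    moreover have "?S ** (X i - ?S) = (X i - ?S) ** ?S" using ss[OF i] unfolding is_semisimple_part_def by blast
    ultimately show ?thesis using diag_exp_imp_semisimple[OF exp[OF i]] by blast
  qed
  have eig: "\<mu> i $ r * P $ r $ l = exp (lam i $ l) * P $ r $ l" if i: "i < p" for i r l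
    using matrix_exp_eigenvector[OF Xcol[OF i, of l]] diag_matrix_mult_vec[of "\<mu> i" "col l" r]
    by (auto simp: exp[OF i] col_nth)
  have "det P \<noteq> 0" using P invertible_det_nz by blast
  \<comment> \<open>The columns of \<open>P\<close> need not be ordered like the coordinates. A
    nonzero term of the Leibniz formula for \<open>det P\<close> matches each coordinate
    \<open>r\<close> with a column that is nonzero there, and by \<open>eig\<close> the exponential
    of that column's eigenvalue is \<open>\<mu> i $ r\<close>.\<close>
  then have "\<exists>\<pi>. \<pi> permutes UNIV \<and> (\<Prod>r\<in>UNIV. P $ r $ \<pi> r) \<noteq> 0"
    unfolding det_def by (rule contrapos_np) (intro sum.neutral ballI; simp)
  then obtain \<pi> where \<pi>: "\<pi> permutes UNIV" "(\<Prod>r\<in>UNIV. P $ r $ \<pi> r) \<noteq> 0"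
    by blast
  have \<mu>: "\<mu> i $ r = exp (lam i $ \<pi> r)" if "i < p" for i r
    using eig[OF that, of r "\<pi> r"] \<pi>(2) by auto
  define w :: "nat \<Rightarrow> complex ^ 'n" where "w i = (\<chi> r. lam i $ \<pi> r)" for i
  have bij: "bij \<pi>" using \<pi>(1) by (rule permutes_bij)
  have "family_independent UNIV p (\<lambda>i k. w i $ k)"
    unfolding family_independent_def
  proof (intro allI impI)
    fix c i assume c: "\<forall>k. (\<Sum>i<p. c i * w i $ k) = 0" and i: "i < p"
    have cl: "(\<Sum>i<p. c i * lam i $ l) = 0" for l
    proof -
      obtain r where "l = \<pi> r" using bij by (metis bij_pointE)
      then show ?thesis using c by (simp add: w_def)
    qed
    \<comment> \<open>The generators equal their semi-simple parts, so a relation among the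
      eigenvalue vectors is one among the matrices \<open>X i\<close>.\<close>
    have Xi: "X i = P ** diag_matrix (lam i) ** matrix_inv P" if "i < p" for i
    proof -
      have "X i ** P = P ** diag_matrix (lam i)"
      proof -
        have "(X i ** P) *v axis l 1 = (P ** diag_matrix (lam i)) *v axis l 1" for l
          using Xcol[OF that, of l]
          by (simp add: col_def diag_axis vec.scale flip: matrix_vector_mul_assoc)
        from arg_cong[OF this, of "\<lambda>v. v $ r" for r] have "(X i ** P) $ r $ l = (P ** diag_matrix (lam i)) $ r $ l" for r l
          by (simp only: matrix_vector_mult_axis_nth)
        then show ?thesis by (simp add: vec_eq_iff)
      qed
      then have "X i ** (P ** matrix_inv P) = P ** diag_matrix (lam i) ** matrix_inv P"
        by (simp add: matrix_mul_assoc)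
      then show ?thesis by (simp add: PQ)
    qed
    have PD: "(P ** diag_matrix d) $ r $ l = P $ r $ l * d $ l" for d :: "complex ^ 'n" and r l
    proof -
      have "(P ** diag_matrix d) $ r $ l = (\<Sum>m\<in>UNIV. if m = l then P $ r $ l * d $ l else 0)"
        unfolding matrix_matrix_mult_def diag_matrix_def vec_lambda_beta by (rule sum.cong) auto
      then show ?thesis by simp
    qed
    have "(\<Sum>i<p. c i * X i $ r $ s) = 0" for r s
    proof -
      have "(\<Sum>i<p. c i * X i $ r $ s) =
          (\<Sum>i<p. \<Sum>l\<in>UNIV. P $ r $ l * matrix_inv P $ l $ s * (c i * lam i $ l))"
      proof (rule sum.cong[OF refl])
        fix i assume "i \<in> {..<p}"
        then have "X i $ r $ s = (\<Sum>l\<in>UNIV. (P ** diag_matrix (lam i)) $ r $ l * matrix_inv P $ l $ s)"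
          by (simp add: Xi matrix_matrix_mult_def[of "P ** diag_matrix (lam i)"])
        then show "c i * X i $ r $ s = (\<Sum>l\<in>UNIV. P $ r $ l * matrix_inv P $ l $ s * (c i * lam i $ l))"
          by (simp add: PD sum_distrib_left mult_ac)
      qed
      also have "\<dots> = (\<Sum>l\<in>UNIV. P $ r $ l * matrix_inv P $ l $ s * (\<Sum>i<p. c i * lam i $ l))"
        unfolding sum_distrib_left by (rule sum.swap)
      also have "\<dots> = 0" by (simp add: cl)
      finally show ?thesis .
    qed
    then have X0: "(\<Sum>i<p. c i * (case s of (r, s) \<Rightarrow> X i $ r $ s)) = 0" for s
      by (cases s) simp
    have ind: "family_independent K p (\<lambda>i (r, s). X i $ r $ s)"
      using gen by (simp add: infinitesimal_generators_def matrices_independent_def)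
    have "family_independent UNIV p (\<lambda>i (r, s). X i $ r $ s)"
    proof (cases "K = UNIV")
      case False
      then have "K = \<real>" using K by simp
      then show ?thesis
        using ind gen by (auto intro!: family_independent_Reals
            simp: infinitesimal_generators_def is_matrix_log_def)
    qed (use ind in simp)
    from family_independentD[OF this UNIV_I X0 i] show "c i = 0" .
  qed
  moreover have "perp p w (\<chi> k. of_nat (a $ k) - of_nat (b $ k))"
    if ab: "\<forall>i<p. vpow (\<mu> i) a = vpow (\<mu> i) b" for a b
  proof -
    \<comment> \<open>The inverse permutation is needed because \<open>lam\<close> follows the
      columns of \<open>P\<close>, while \<open>a\<close> and \<open>b\<close> follow the
      coordinates.\<close>
    define k :: "int ^ 'n" where "k = (\<chi> m. int (a $ inv \<pi> m) - int (b $ inv \<pi> m))"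
    have k: "(\<Sum>m\<in>UNIV. of_int (k $ m) * lam i $ m) =
        (\<Sum>r\<in>UNIV. (of_nat (a $ r) - of_nat (b $ r)) * lam i $ \<pi> r)" for i
    proof -
      have "(\<Sum>m\<in>UNIV. of_int (k $ m) * lam i $ m) = (\<Sum>r\<in>UNIV. of_int (k $ \<pi> r) * lam i $ \<pi> r)"
        by (rule sum.reindex_bij_betw[OF bij, symmetric])
      then show ?thesis by (simp add: k_def inv_f_f[OF bij_is_inj[OF bij]])
    qed
    have "\<exists>z :: int. (\<Sum>m\<in>UNIV. of_int (k $ m) * lam i $ m) = 2 * \<i> * of_real pi * of_int z" if i: "i < p" for i
    proof -
      let ?e = "\<lambda>c. \<Sum>r\<in>UNIV. of_nat (c $ r) * lam i $ \<pi> r"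
      have v: "vpow (\<mu> i) c = exp (?e c)" for c :: "nat ^ 'n"
        by (simp add: \<mu>[OF i] exp_sum exp_of_nat_mult)
      have "exp (?e a - ?e b) = 1" using v[of a] v[of b] ab i by (simp add: exp_diff)
      then have "exp (\<Sum>m\<in>UNIV. of_int (k $ m) * lam i $ m) = 1"
        by (simp add: k left_diff_distrib sum_subtractf)
      then obtain n :: int where n: "Re (\<Sum>m\<in>UNIV. of_int (k $ m) * lam i $ m) = 0"
        "Im (\<Sum>m\<in>UNIV. of_int (k $ m) * lam i $ m) = of_int (2 * n) * pi"
        unfolding exp_eq_1 by blast
      show ?thesis
        by (intro exI[of _ n]) (simp only: complex_eq_iff n, simp)
    qed
    with nr have "\<forall>i<p. (\<Sum>m\<in>UNIV. of_int (k $ m) * lam i $ m) = 0" by blast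
    then show ?thesis by (simp add: perp_def k w_def)
  qed
  ultimately show ?thesis unfolding resonance_weights_def by blast
qed

section \<open>Conjugation to the normal form\<close>

lemma linear_fmap_diag: "linear_fmap (diag_matrix \<mu>) $ k = mfps_const (\<mu> $ k) * mfps_X k"
proof -
  have "linear_fmap (diag_matrix \<mu>) $ k = (\<Sum>m\<in>UNIV. if m = k then mfps_const (\<mu> $ k) * mfps_X k else 0)"
    unfolding linear_fmap_def diag_matrix_def vec_lambda_beta by (rule sum.cong) auto
  then show ?thesis by simp
qed

lemma mpow_const_mult: "mpow (\<chi> k. mfps_const (c $ k) * \<Phi> $ k) l = mfps_const (vpow c l) * mpow \<Phi> l"
  by (simp add: mpow_def power_mult_distrib prod.distrib mfps_const_prod mfps_const_power)

lemma mfps_nth_subst_linear_diag: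
  "mfps_nth (mfps_subst f (linear_fmap (diag_matrix \<mu>))) m = vpow \<mu> m * mfps_nth f m"
proof -
  have "linear_fmap (diag_matrix \<mu>) = (\<chi> k. mfps_const (\<mu> $ k) * mX $ k)"
    by (simp add: vec_eq_iff linear_fmap_diag)
  then have "mfps_nth (mfps_subst f (linear_fmap (diag_matrix \<mu>))) m =
      (\<Sum>l | mdegree l \<le> mdegree m. mfps_nth f l * mfps_nth (mfps_const (vpow \<mu> l) * mpow mX l) m)"
    by (simp only: mfps_nth_subst mpow_const_mult)
  also have "\<dots> = (\<Sum>l\<in>{m}. mfps_nth f l * mfps_nth (mfps_const (vpow \<mu> l) * mpow mX l) m)"
    by (rule sum.mono_neutral_right) (auto simp: mfps_nth_mpow_mX)
  finally show ?thesis by (simp add: mfps_nth_mpow_mX)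
qed

lemma wedge_coeff_cong: "(\<And>j. j < q \<Longrightarrow> F j = F' j) \<Longrightarrow> wedge_coeff q F s = wedge_coeff q F' s"
  unfolding wedge_coeff_def by (auto intro!: sum.cong prod.cong)

lemma is_semisimple_part_diag: "is_semisimple_part (diag_matrix \<mu>) (diag_matrix \<mu>)"
  unfolding is_semisimple_part_def diagonalizable_def
proof (intro conjI exI)
  show inv: "invertible (mat 1 :: complex ^ 'a ^ 'a)"
    unfolding invertible_def by (intro exI[of _ "mat 1"]) simp
  have "matrix_inv (mat 1 :: complex ^ 'a ^ 'a) = mat 1"
    using matrix_inv_both[OF inv] by simp
  then show "diag_matrix \<mu> = mat 1 ** diag_matrix \<mu> ** matrix_inv (mat 1)" by simp
  show "mat_power (diag_matrix \<mu> - diag_matrix \<mu>) 1 = 0" by simp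
qed simp

theorem theorem2p6:
  fixes K :: "complex set" and p q :: nat
    and \<Phi> :: "nat \<Rightarrow> (complex, 'n::finite) fmap"
    and F :: "nat \<Rightarrow> (complex, 'n) mfps"
    and \<mu> :: "nat \<Rightarrow> complex ^ 'n"
  assumes K: "K = UNIV \<or> K = \<real>"
    and system: "integrable_system K p q \<Phi> F"
    and nondeg: "nondegenerate K p q \<Phi>"
    and diag: "\<forall>i<p. linear_part (\<Phi> i) = diag_matrix (\<mu> i)"
    and hyp: "projectively_hyperbolic p \<mu> \<or>
      (\<exists>X. infinitesimal_generators K p (\<lambda>i. linear_part (\<Phi> i)) X \<and> weakly_nonresonant p X)"
  shows "\<exists>(\<Psi> :: (complex, 'n) fmap) (\<phi> :: nat \<Rightarrow> (complex, 'n) mfps ^ 'n).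
      formal_diffeo K \<Psi> \<and> linear_part \<Psi> = mat 1 \<and>
      (\<forall>i<p. fmap_comp \<Psi> (\<Phi> i) = fmap_comp (scaled_fmap (\<mu> i) (\<phi> i)) \<Psi>) \<and>
      (\<forall>i<p. \<forall>k. coeffs_in K (\<phi> i $ k) \<and>
         (\<forall>j<p. first_integral (linear_fmap (linear_part (\<Phi> j))) (\<phi> i $ k))) \<and>
      poincare_dulac_nf p (\<lambda>i. scaled_fmap (\<mu> i) (\<phi> i)) \<and>
      (\<forall>i<p. \<forall>\<gamma>\<in>resonant_exponents p \<mu>. (\<Prod>k\<in>UNIV. (1 + \<phi> i $ k) ^ (\<gamma> $ k)) = 1)"
proof -
  have subK: "is_subfield K"
    using K
  proof
    assume "K = \<real>"
    then show ?thesis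
      by (simp add: is_subfield_def)
  qed (simp add: is_subfield_def)
  have diffeo: "formal_diffeo K (\<Phi> i)" if "i < p" for i
    using system that by (simp add: integrable_system_def)
  have comm: "fmap_comp (\<Phi> i) (\<Phi> j) = fmap_comp (\<Phi> j) (\<Phi> i)" if "i < p" "j < p" for i j
    using system that by (simp add: integrable_system_def)
  have FK: "coeffs_in K (F j)" and F_int: "\<And>i. i < p \<Longrightarrow> first_integral (\<Phi> i) (F j)" if "j < q" for j
    using system that by (auto simp: integrable_system_def)
  have pq: "p + q = CARD('n)" and indep: "functionally_independent q F"
    using system by (auto simp: integrable_system_def)
  have \<Phi>K: "coeffs_in K (\<Phi> i $ k)" if "i < p" for i k
    using diffeo[OF that] by (simp add: formal_diffeo_def)
  have \<Phi>: "diag_linear (\<mu> i) (\<Phi> i)" if "i < p" for i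
    using diffeo[OF that] diag that by (simp add: formal_diffeo_def diag_linear_def)
  have nc: "no_const (\<Phi> i)" if "i < p" for i using \<Phi>[OF that] by (rule diag_linear_no_const)
  have \<mu>K: "\<mu> i $ k \<in> K" if "i < p" for i k
    using coeffs_in_nth[OF \<Phi>K[OF that]] diag_linear_nth_axis[OF \<Phi>[OF that], of k] by metis
  have \<mu>0: "\<mu> i $ k \<noteq> 0" if i: "i < p" for i k
  proof -
    obtain B where "matrix_exp B = linear_part (\<Phi> i)"
      using diffeo[OF i] by (auto simp: formal_diffeo_def is_matrix_log_def)
    then have "matrix_exp B = diag_matrix (\<mu> i)" using diag i by simp
    then show ?thesis by (rule diag_matrix_exp_nonzero)
  qed
  obtain w where "resonance_weights p \<mu> w"
    using hyp
  proof
    assume "projectively_hyperbolic p \<mu>"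
    from projectively_hyperbolic_weights[OF this \<mu>0] show ?thesis by (rule that)
  next
    assume "\<exists>X. infinitesimal_generators K p (\<lambda>i. linear_part (\<Phi> i)) X \<and> weakly_nonresonant p X"
    then show ?thesis
      using weakly_nonresonant_weights[OF K, of p "\<lambda>i. linear_part (\<Phi> i)" _ \<mu>] diag that by blast
  qed
  then have w: "family_independent UNIV p (\<lambda>i k. w i $ k)"
    and res: "\<And>a b. (\<And>i. i < p \<Longrightarrow> vpow (\<mu> i) a = vpow (\<mu> i) b) \<Longrightarrow>
      perp p w (\<chi> k. of_nat (a $ k) - of_nat (b $ k))"
    by (auto simp: resonance_weights_def)
  obtain \<Psi> \<Phi>' where \<Psi>: "diag_linear (\<chi> k. 1) \<Psi>" and \<Psi>K: "\<And>k. coeffs_in K (\<Psi> $ k)"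
    and conj: "\<And>i. i < p \<Longrightarrow> fmap_comp \<Psi> (\<Phi> i) = fmap_comp (\<Phi>' i) \<Psi>"
    and \<Phi>': "\<And>i. i < p \<Longrightarrow> diag_linear (\<mu> i) (\<Phi>' i)" "\<And>i k. i < p \<Longrightarrow> coeffs_in K (\<Phi>' i $ k)"
    and \<Phi>'_res: "\<And>i j k m. i < p \<Longrightarrow> j < p \<Longrightarrow> mfps_nth (\<Phi>' i $ k) m \<noteq> 0 \<Longrightarrow> vpow (\<mu> j) m = \<mu> j $ k"
    and int_res: "\<And>F i m. \<forall>i<p. first_integral (\<Phi> i) (mfps_subst F \<Psi>) \<Longrightarrow> i < p \<Longrightarrow>
       mfps_nth F m \<noteq> 0 \<Longrightarrow> vpow (\<mu> i) m = 1"
  proof (rule poincare_dulac[of K p \<mu> \<Phi>], goal_cases)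
    case (6 \<Psi> \<Phi>')
    show ?case by (rule that; fact 6)
  qed (rule subK, (rule \<Phi> \<Phi>K comm \<mu>K; assumption)+)
  have nc\<Psi>: "no_const \<Psi>" using \<Psi> by (rule diag_linear_no_const)
  have nc': "no_const (\<Phi>' i)" if "i < p" for i using \<Phi>'(1)[OF that] by (rule diag_linear_no_const)
  have \<Psi>_inj: "f = g" if "mfps_subst f \<Psi> = mfps_subst g \<Psi>" for f g
    using subst_inj[OF \<Psi> _ that] by simp
  have conj': "mfps_subst (mfps_subst f (\<Phi>' i)) \<Psi> = mfps_subst (mfps_subst f \<Psi>) (\<Phi> i)" if "i < p" for i f
    using conj[OF that] by (simp add: subst_subst nc nc' nc\<Psi> that)
  have "\<exists>F'. mfps_subst F' \<Psi> = F j" if "j < q" for j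
    using subst_surj[OF subK \<Psi> \<Psi>K FK[OF that]] by metis
  then obtain F' where F': "\<And>j. j < q \<Longrightarrow> mfps_subst (F' j) \<Psi> = F j" by metis
  have F'_res: "vpow (\<mu> i) m = 1" if "j < q" "i < p" "mfps_nth (F' j) m \<noteq> 0" for i j m
    using int_res[of "F' j" i m] F' F_int that by simp
  have F'_perp: "perp p w (\<chi> k. of_nat (m $ k))" if "j < q" "mfps_nth (F' j) m \<noteq> 0" for j m
    using res[of m 0] F'_res that by simp
  have indep': "functionally_independent q (\<lambda>j. mfps_subst (F' j) \<Psi>)"
    using indep wedge_coeff_cong[of q "\<lambda>j. mfps_subst (F' j) \<Psi>" F] F'
    by (simp add: functionally_independent_def)
  \<comment> \<open>Division by the linear part makes the map tangent to the identity, as the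
    logarithm requires.\<close>
  define G where "G i = (\<chi> k. mfps_const (1 / \<mu> i $ k) * \<Phi>' i $ k)" for i
  have G: "diag_linear (\<chi> k. 1) (G i)" if "i < p" for i
  proof (rule diag_linearI)
    fix k
    have "G i $ k - mfps_const ((\<chi> k. 1) $ k) * mfps_X k =
        mfps_const (1 / \<mu> i $ k) * (\<Phi>' i $ k - mfps_const (\<mu> i $ k) * mfps_X k)"
      using \<mu>0[OF that] by (simp add: G_def right_diff_distrib flip: mfps_const_mult mult.assoc)
    then show "order_ge 2 (G i $ k - mfps_const ((\<chi> k. 1) $ k) * mfps_X k)"
      using diag_linear_order[OF \<Phi>'(1)[OF that]] by (simp add: order_ge_const_mult)
  qed
  have G_perp: "perp p w (\<chi> l. of_nat (m $ l) - of_nat (axis k 1 $ l))"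
    if "i < p" "mfps_nth (G i $ k) m \<noteq> 0" for i k m
  proof (rule res)
    fix j assume j: "j < p"
    have "mfps_nth (\<Phi>' i $ k) m \<noteq> 0" using that(2) by (auto simp: G_def)
    from \<Phi>'_res[OF that(1) j this] show "vpow (\<mu> j) m = vpow (\<mu> j) (axis k 1)"
      unfolding vpow_axis .
  qed
  have F'G: "mfps_subst (F' j) (G i) = F' j" if "i < p" "j < q" for i j
  proof -
    have "mfps_subst (F' j) (\<Phi>' i) = F' j"
      by (rule \<Psi>_inj) (use F_int[OF that(2,1)] F'[OF that(2)] conj'[OF that(1)] in \<open>simp add: first_integral_def\<close>)
    \<comment> \<open>Every monomial of \<open>F' j\<close> has multiplier 1, so dividing the map by
      its linear part does not affect the composition.\<close>
    moreover have eq: "mfps_nth (F' j) l * mfps_nth (mpow (G i) l) m = mfps_nth (F' j) l * mfps_nth (mpow (\<Phi>' i) l) m" for l m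
    proof (cases "mfps_nth (F' j) l = 0")
      case False
      have "G i = (\<chi> k. mfps_const ((\<chi> k. 1 / \<mu> i $ k) $ k) * \<Phi>' i $ k)" by (simp add: G_def)
      then have "mpow (G i) l = mfps_const (vpow (\<chi> k. 1 / \<mu> i $ k) l) * mpow (\<Phi>' i) l"
        by (simp only: mpow_const_mult)
      moreover have "vpow (\<chi> k. 1 / \<mu> i $ k) l = 1 / vpow (\<mu> i) l"
        by (simp add: power_one_over prod_dividef)
      ultimately show ?thesis using F'_res[OF that(2,1) False] by simp
    qed simp
    have "mfps_subst (F' j) (G i) = mfps_subst (F' j) (\<Phi>' i)"
      by (simp only: mfps_eq_iff mfps_nth_subst eq) simp
    ultimately show ?thesis by simp
  qed
  \<comment> \<open>The quotient of \<open>G i $ k\<close> by \<open>x_k\<close>, minus 1; the index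
    shift performs an exact division once \<open>x_k\<close> is known to divide.\<close>
  define \<phi> where "\<phi> i = (\<chi> k. Abs_mfps (\<lambda>m. mfps_nth (G i $ k) (m + axis k 1)) - 1)" for i
  have G_\<phi>: "G i $ k = mfps_X k * (1 + \<phi> i $ k)" if "i < p" for i k
  proof -
    have "mfps_nth (G i $ k) m = 0" if "m $ k = 0" for m
      by (rule resonant_divisible[OF w pq G[OF \<open>i < p\<close>] F'_perp F'G[OF \<open>i < p\<close>] \<Psi> indep' G_perp[OF \<open>i < p\<close>] that])
    from mfps_X_dvd[of k "G i $ k", OF this] show ?thesis by (simp add: \<phi>_def)
  qed
  have scaled: "scaled_fmap (\<mu> i) (\<phi> i) = \<Phi>' i" if "i < p" for i
  proof -
    have "mfps_const (\<mu> i $ k) * mfps_X k * (1 + \<phi> i $ k) = \<Phi>' i $ k" for k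
    proof -
      have "mfps_const (\<mu> i $ k) * (mfps_X k * (1 + \<phi> i $ k)) = mfps_const (\<mu> i $ k) * G i $ k"
        using G_\<phi>[OF that] by simp
      also have "\<dots> = \<Phi>' i $ k"
        using \<mu>0[OF that, of k] by (simp add: G_def flip: mfps_const_mult mult.assoc)
      finally show ?thesis by (simp add: mult.assoc)
    qed
    then show ?thesis by (simp add: scaled_fmap_def vec_eq_iff)
  qed
  have \<phi>K: "coeffs_in K (\<phi> i $ k)" if "i < p" for i k
  proof -
    have "coeffs_in K (G i $ k)"
      unfolding G_def vec_lambda_beta
      by (intro coeffs_in_const_mult[OF subK] \<Phi>'(2)[OF that] subfield_divide[OF subK] \<mu>K[OF that] subfield_closed(2)[OF subK])
    then have "coeffs_in K (Abs_mfps (\<lambda>m. mfps_nth (G i $ k) (m + axis k 1)))"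
      by (simp add: coeffs_in_def)
    then show ?thesis by (simp add: \<phi>_def coeffs_in_diff[OF subK] coeffs_in_1[OF subK])
  qed
  have \<phi>_int: "first_integral (linear_fmap (linear_part (\<Phi> j))) (\<phi> i $ k)" if ij: "i < p" "j < p" for i j k
  proof -
    have "vpow (\<mu> j) m * mfps_nth (\<phi> i $ k) m = mfps_nth (\<phi> i $ k) m" for m
    \<comment> \<open>Exponent 0 is set apart because the subtracted 1 alters that coefficient; its
      multiplier is 1 in any case.\<close>
    proof (cases "m = 0 \<or> mfps_nth (\<phi> i $ k) m = 0")
      case False
      then have "mfps_nth (G i $ k) (m + axis k 1) \<noteq> 0" by (auto simp: \<phi>_def mfps_nth_1)
      then have "mfps_nth (\<Phi>' i $ k) (m + axis k 1) \<noteq> 0" by (auto simp: G_def)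
      from \<Phi>'_res[OF ij this] have "vpow (\<mu> j) m = 1"
        unfolding vpow_add vpow_axis using \<mu>0[OF ij(2)] by simp
      then show ?thesis by simp
    qed auto
    then show ?thesis
      using diag ij by (simp add: first_integral_def mfps_eq_iff mfps_nth_subst_linear_diag)
  qed
  have \<phi>_prod: "(\<Prod>k\<in>UNIV. (1 + \<phi> i $ k) ^ (\<gamma> $ k)) = 1" if i: "i < p" and \<gamma>: "\<gamma> \<in> resonant_exponents p \<mu>" for i \<gamma>
  proof -
    have "perp p w (\<chi> k. of_nat (\<gamma> $ k))"
      using res[of \<gamma> 0] \<gamma> by (simp add: resonant_exponents_def)
    from resonant_monomial_invariant[OF w pq G[OF i] F'_perp F'G[OF i] \<Psi> indep' this]
    have "mpow (G i) \<gamma> = mpow mX \<gamma>" .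
    moreover have "mpow (G i) \<gamma> = mpow mX \<gamma> * (\<Prod>k\<in>UNIV. (1 + \<phi> i $ k) ^ (\<gamma> $ k))"
      by (simp add: mpow_def G_\<phi>[OF i] power_mult_distrib prod.distrib)
    moreover have "mpow mX \<gamma> \<noteq> (0 :: (complex, 'n) mfps)"
      using mfps_nth_mpow_mX[of \<gamma> \<gamma>] by (metis mfps_nth_0 zero_neq_one)
    ultimately show ?thesis by simp
  qed
  have nf: "poincare_dulac_nf p (\<lambda>i. scaled_fmap (\<mu> i) (\<phi> i))"
    unfolding poincare_dulac_nf_def
  proof (intro conjI exI[of _ "\<lambda>j. diag_matrix (\<mu> j)"] allI impI)
    fix i j assume ij: "i < p" "j < p"
    have "mfps_subst (\<Phi>' i $ k) (\<Phi>' j) = mfps_subst (\<Phi>' j $ k) (\<Phi>' i)" for k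
    \<comment> \<open>Commutation is inherited from the original maps: after composition with \<Psi>
      both sides become \<open>\<Psi> $ k\<close> composed with \<open>\<Phi> i\<close> and
      \<open>\<Phi> j\<close>, in the two orders.\<close>
    proof (rule \<Psi>_inj)
      have *: "mfps_subst (\<Phi>' i $ k) \<Psi> = mfps_subst (\<Psi> $ k) (\<Phi> i)" if "i < p" for i
        using conj[OF that] by (simp add: fmap_comp_def vec_eq_iff)
      show "mfps_subst (mfps_subst (\<Phi>' i $ k) (\<Phi>' j)) \<Psi> = mfps_subst (mfps_subst (\<Phi>' j $ k) (\<Phi>' i)) \<Psi>"
        using comm[OF ij] by (simp add: conj' * ij subst_subst nc)
    qed
    then show "fmap_comp (scaled_fmap (\<mu> i) (\<phi> i)) (scaled_fmap (\<mu> j) (\<phi> j)) =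
        fmap_comp (scaled_fmap (\<mu> j) (\<phi> j)) (scaled_fmap (\<mu> i) (\<phi> i))"
      by (simp add: scaled ij fmap_comp_def)
  next
    fix j assume j: "j < p"
    show "is_semisimple_part (diag_matrix (\<mu> j)) (linear_part (scaled_fmap (\<mu> j) (\<phi> j)))"
      using \<Phi>'(1)[OF j] is_semisimple_part_diag by (simp add: scaled[OF j] diag_linear_def)
    fix i assume i: "i < p"
    \<comment> \<open>All terms of the \<open>k\<close>-th component share the multiplier
      \<open>\<mu> j $ k\<close>, so the component is an eigenvector of the linear part, just like
      \<open>x_k\<close>.\<close>
    have "mfps_subst (\<Phi>' i $ k) (linear_fmap (diag_matrix (\<mu> j))) = mfps_const (\<mu> j $ k) * \<Phi>' i $ k" for k
      using \<Phi>'_res[OF i j] by (auto simp: mfps_eq_iff mfps_nth_subst_linear_diag)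
    moreover have "mfps_subst (linear_fmap (diag_matrix (\<mu> j)) $ k) (\<Phi>' i) = mfps_const (\<mu> j $ k) * \<Phi>' i $ k" for k
      by (simp add: linear_fmap_diag subst_const_mult nc' i)
    ultimately show "fmap_comp (scaled_fmap (\<mu> i) (\<phi> i)) (linear_fmap (diag_matrix (\<mu> j))) =
        fmap_comp (linear_fmap (diag_matrix (\<mu> j))) (scaled_fmap (\<mu> i) (\<phi> i))"
      by (simp add: scaled[OF i] fmap_comp_def)
  qed
  have lin\<Psi>: "linear_part \<Psi> = mat 1"
    using \<Psi> by (simp add: diag_linear_def diag_matrix_def mat_def vec_eq_iff)
  have "is_matrix_log K (linear_part \<Psi>) 0"
    using subfield_closed(1)[OF subK] by (simp add: is_matrix_log_def lin\<Psi> matrix_exp_0)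
  then have \<Psi>_diffeo: "formal_diffeo K \<Psi>"
    using \<Psi>K nc\<Psi> by (auto simp: formal_diffeo_def)
  have conj_scaled: "fmap_comp \<Psi> (\<Phi> i) = fmap_comp (scaled_fmap (\<mu> i) (\<phi> i)) \<Psi>" if "i < p" for i
    unfolding scaled[OF that] by (rule conj[OF that])
  show ?thesis
    by (intro exI[of _ \<Psi>] exI[of _ \<phi>] conjI allI impI ballI)
      ((rule \<Psi>_diffeo lin\<Psi> nf) | (rule conj_scaled \<phi>K \<phi>_int \<phi>_prod; assumption))+
qed

end
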